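(* Let $L_1$ be an analytic Jordan curve, $h$ a positive analytic weight on $L_1$, and let $P_n$, $\gamma_n$, $\phi$, $\Delta_e$, $\Delta_i$, $\rho$, $\Omega_s$, $G_s$, $L_s$ and $W$ be as defined in the context. Fix $r$ with $\rho<r<1$ and let $f_n^{(k)}$, $\Lambda_r$, $\Lambda_r'$, $M_r$ be as defined in the context. Then for every integer $n\ge 0$ such that $$\frac{\Lambda_r\Lambda'_rM_rr^{2n}}{1/r-r}<1,$$ we have (all series being convergent) $$ \frac{\Delta_e(\infty)P_n(z)}{[\phi'(\infty)]^{-n-1/2}}=\begin{cases} \displaystyle \Delta_e(z)\sqrt{\phi'(z)}\,[\phi(z)]^n\sum_{k=0}^\infty f_n^{(2k)}(z), & z\in \Omega_{1/r},\\[2mm] \displaystyle \Delta_e(z)\sqrt{\phi'(z)}\,[\phi(z)]^n\sum_{k=0}^\infty f_n^{(2k)}(z)-\frac{1}{\Delta_i(z)}\sum_{k=0}^\infty f_n^{(2k+1)}(z), & z\in \Omega_{r}\cap G_{1/r},\\[2mm] \displaystyle -\frac{1}{\Delta_i(z)}\sum_{k=0}^\infty f_n^{(2k+1)}(z), & z\in G_{r}, \end{cases} $$ and $$ \gamma_n^{-2}=\Delta_e(\infty)^{-2}[\phi'(\infty)]^{-2n-1}\left(1+\sum_{k=0}^\infty \frac{1}{2\pi i}\oint_{L_{1/r}}\frac{f_n^{(2k+1)}(\zeta)\sqrt{\phi'(\zeta)}\,[\phi(\zeta)]^{-n-1}d\zeta}{\Delta_e(\zeta)\Delta_i(\zeta)}\right).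 $$
   Context: Notation: $\mathbb{T}_s=\{|w|=s\}$, $\mathbb{E}_s=\{w: s<|w|\le\infty\}$, $\mathbb{D}_s=\{|w|<s\}$. A function is called analytic on a closed set if it is analytic on a neighborhood of it (possibly after analytic continuation). Contours are positively oriented. Orthogonal polynomials. $L_1$ is an analytic Jordan curve in $\mathbb{C}$ and $h$ is analytic in a neighborhood of $L_1$ with $h(z)>0$ for all $z\in L_1$. $p_n(z)=\gamma_nz^n+\cdots$, $\gamma_n>0$, $n\ge0$, are the orthonormal polynomials: $\frac{1}{2\pi}\oint_{L_1}p_n(z)\overline{p_m(z)}h(z)|dz|=\delta_{nm}$. $P_n=\gamma_n^{-1}p_n$ is the monic orthogonal polynomial. Exterior map. $\Omega_1$ is the unbounded component of $\overline{\mathbb{C}}\setminus L_1$; $\psi$ is the conformal map of $\mathbb{E}_1$ onto $\Omega_1$ with $\psi(\infty)=\infty$, $\psi'(\infty)>0$. $\widehat\rho\ge0$ is the smallest number such that $\psi$ has an analytic and univalent continuation to $\mathbb{E}_{\widehat\rho}$ (so $\widehat\rho<1$). For $\widehat\rho\le s<\infty$: $\Omega_s=\psi(\mathbb{E}_s)$, $L_s=\partial\Omega_s$, $G_s=\mathbb{C}\setminus\overline{\Omega}_s$; if $s=1/0=\infty$, $G_\infty=\mathbb{C}$. $\phi:\Omega_{\widehat\rho}\to\mathbb{E}_{\widehat\rho}$ is the inverse of $\psi$; $\sqrt{\phi'}$ is the analytic branch on $\Omega_{\widehat\rho}$ with $\sqrt{\phi'(\infty)}>0$. The Schwarz reflection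 about $L_1$ is $z^*=\psi\big(1/\overline{\phi(z)}\big)$, $z\in\Omega_{\widehat\rho}\cap G_{1/\widehat\rho}$. Szegő functions. The exterior Szegő function $\Delta_e$ for $h$ is the unique function analytic and never zero on $\overline{\Omega}_1$ with $\Delta_e(\infty)>0$ and $|\Delta_e(z)|^{-2}=h(z)$ on $L_1$. An interior Szegő function $\Delta_i$ is a function analytic and never zero on $\overline{G}_1$ with $|\Delta_i(z)|^2=h(z)$ on $L_1$; it is unique up to a multiplicative constant of modulus 1, and one is fixed. $\rho$ is the smallest number $\ge\widehat\rho$ such that $\Delta_e$ is analytic on $\Omega_\rho$ (so $\widehat\rho\le\rho<1$). The function $1/\Delta_i$ has an analytic continuation from $\overline{G}_1$ to $G_{1/\rho}$, given by $\frac1{\Delta_i(z)}:=\Delta_e(z)\overline{\Delta_e(z^* )}\,\overline{\Delta_i(z^* )}$ for $z\in G_{1/\rho}\setminus\overline{G}_1$; this is the meaning of $1/\Delta_i$ outside $\overline G_1$. Kernel. For a conformal map $\varphi$ of $G_1$ onto $\mathbb{D}_1$, $W(\zeta,z)=\frac{\sqrt{\varphi'(z)}\sqrt{\varphi'(\zeta)}}{\varphi(\zeta)-\varphi(z)}$, $\zeta,z\in G_1$ (same branch of $\sqrt{\varphi'}$ in both factors); it does not depend on the choice of $\varphi$. Choosing $\varphi$ with no zero in $\Omega_{\widehat\rho}\cap G_1$, $\varphi$ extends analytically and univalently to $G_{1/\widehat\rho}$ by $\varphi(z)=1/\overline{\varphi(z^* )}$, $z\in G_{1/\widehat\rho}\setminus\overline{G}_1$,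 and so $W$ extends by the same formula to $G_{1/\widehat\rho}\times G_{1/\widehat\rho}$; for fixed $z$ it is analytic in $\zeta\neq z$ with a simple pole at $\zeta=z$ of residue 1. Integral transforms. For fixed $\rho<r<1$ and each integer $n\ge0$: $f_n^{(0)}(z)=1$ for $z\in\overline{\mathbb{C}}$, and for $k\ge0$, $$f_n^{(2k+1)}(z)=-\frac{1}{2\pi i}\oint_{L_r}f_n^{(2k)}(\zeta)\Delta_e(\zeta)\Delta_i(\zeta)W(\zeta,z)\sqrt{\phi'(\zeta)}\,[\phi(\zeta)]^nd\zeta,\quad z\in G_{1/\rho}\setminus L_r,$$ $$f_n^{(2k+2)}(z)=\frac{1}{2\pi i}\oint_{L_{1/r}}\frac{f_n^{(2k+1)}(\zeta)\sqrt{\phi'(\zeta)}\,[\phi(\zeta)]^{-n}d\zeta}{\Delta_e(\zeta)\Delta_i(\zeta)[\phi(\zeta)-\phi(z)]},\quad z\in\Omega_\rho\setminus L_{1/r}.$$ Constants: $$\Lambda_r=\max_{\zeta\in L_r}\left|\frac{\Delta_e(\zeta)\Delta_i(\zeta)}{\sqrt{\phi'(\zeta)}}\right|,\quad \Lambda'_r=\max_{\zeta\in L_{1/r}}\left|\sqrt{\phi'(\zeta)}\Delta_e(\zeta)\Delta_i(\zeta)\right|^{-1},\quad M_r=\max_{(\zeta,z)\in L_r\times L_{1/r}}|W(\zeta,z)|.$$ Formulas for $P_n(z)$ are understood for finite $z$. *)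

theory Defs
  imports "HOL-Complex_Analysis.Complex_Analysis"
begin

text \<open>
  Regions of the Riemann sphere that contain the point at infinity are represented by their finite
  parts. A function is analytic at infinity iff it is holomorphic near infinity and has
  a finite limit along the filter \<open>at_infinity\<close>; this limit is its value at infinity.
\<close>

definition analytic_jordan_curve :: "complex set \<Rightarrow> bool" where
  "analytic_jordan_curve L \<longleftrightarrow>
     (\<exists>g U. open U \<and> sphere 0 1 \<subseteq> U \<and> g holomorphic_on U \<and> inj_on g U \<and> L = g ` sphere 0 1)"

definition positive_weight :: "complex set \<Rightarrow> (complex \<Rightarrow> complex) \<Rightarrow> bool" where
  "positive_weight L h \<longleftrightarrow> h analytic_on L \<and> (\<forall>z\<in>L. h z \<in> \<real> \<and> Re (h z) > 0)"

definition positive_at_infinity :: "(complex \<Rightarrow> complex) \<Rightarrow> bool" where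
  "positive_at_infinity f \<longleftrightarrow> (\<exists>c>0. (f \<longlongrightarrow> complex_of_real c) at_infinity)"

definition ext_disk :: "real \<Rightarrow> complex set" where
  "ext_disk s = {w. s < cmod w}"

definition Omega :: "(complex \<Rightarrow> complex) \<Rightarrow> real \<Rightarrow> complex set" where
  "Omega \<psi> s = \<psi> ` ext_disk s"

definition level_curve :: "(complex \<Rightarrow> complex) \<Rightarrow> real \<Rightarrow> complex set" where
  "level_curve \<psi> s = frontier (Omega \<psi> s)"

text \<open>The index is an extended real because \<open>G\<^sub>s\<close> is needed for \<open>s = 1/0 = \<infinity>\<close>; note that
  \<open>1 / ereal 0 = \<infinity>\<close>, whereas \<open>1 / 0 = 0\<close> on the reals.\<close>

definition G_region :: "(complex \<Rightarrow> complex) \<Rightarrow> ereal \<Rightarrow> complex set" where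
  "G_region \<psi> s = (if s = \<infinity> then UNIV else - closure (Omega \<psi> (real_of_ereal s)))"

text \<open>The curve \<open>L\<^sub>s\<close>, traversed once in the positive direction by \<open>t \<mapsto> \<psi> (s exp (2 \<pi> i t))\<close>.\<close>

definition level_path :: "(complex \<Rightarrow> complex) \<Rightarrow> real \<Rightarrow> real \<Rightarrow> complex" where
  "level_path \<psi> s = \<psi> \<circ> circlepath 0 s"

text \<open>The line integral of \<open>f |dz|\<close>. It does not depend on the regular parametrization \<open>c\<close> of the curve;
  for \<open>L\<^sub>1\<close> the analytic parametrization \<open>level_path \<psi> 1\<close> is used.\<close>

definition arclength_integral :: "(real \<Rightarrow> complex) \<Rightarrow> (complex \<Rightarrow> complex) \<Rightarrow> complex" where
  "arclength_integral c f =
     integral {0..1} (\<lambda>t. f (c t) * complex_of_real (cmod (vector_derivative c (at t within {0..1}))))"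

definition orthonormal_polys ::
  "(real \<Rightarrow> complex) \<Rightarrow> (complex \<Rightarrow> complex) \<Rightarrow> (nat \<Rightarrow> complex poly) \<Rightarrow> (nat \<Rightarrow> real) \<Rightarrow> bool" where
  "orthonormal_polys c h p \<gamma> \<longleftrightarrow>
     (\<forall>n. degree (p n) = n \<and> lead_coeff (p n) = complex_of_real (\<gamma> n) \<and> \<gamma> n > 0) \<and>
     (\<forall>n m. 1 / (2 * complex_of_real pi) *
              arclength_integral c (\<lambda>z. poly (p n) z * cnj (poly (p m) z) * h z)
            = (if n = m then 1 else 0))"

definition exterior_map :: "complex set \<Rightarrow> (complex \<Rightarrow> complex) \<Rightarrow> bool" where
  "exterior_map L \<psi> \<longleftrightarrow>
     \<psi> holomorphic_on ext_disk 1 \<and> inj_on \<psi> (ext_disk 1) \<and> \<psi> ` ext_disk 1 = outside L \<and>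
     filterlim \<psi> at_infinity at_infinity \<and> positive_at_infinity (deriv \<psi>)"

text \<open>In the next two definitions of a smallest radius, the function itself is already the
  continued one.\<close>

definition least_univalence_radius :: "(complex \<Rightarrow> complex) \<Rightarrow> real \<Rightarrow> bool" where
  "least_univalence_radius \<psi> \<rho>h \<longleftrightarrow>
     0 \<le> \<rho>h \<and> \<psi> holomorphic_on ext_disk \<rho>h \<and> inj_on \<psi> (ext_disk \<rho>h) \<and>
     (\<forall>s. 0 \<le> s \<and> s < \<rho>h \<longrightarrow>
        \<not> (\<exists>g. g holomorphic_on ext_disk s \<and> inj_on g (ext_disk s) \<and> (\<forall>w\<in>ext_disk 1. g w = \<psi> w)))"

definition least_analyticity_radius ::
  "(complex \<Rightarrow> complex) \<Rightarrow> real \<Rightarrow> (complex \<Rightarrow> complex) \<Rightarrow> real \<Rightarrow> bool" where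
  "least_analyticity_radius \<psi> \<rho>h \<Delta>e \<rho> \<longleftrightarrow>
     \<rho>h \<le> \<rho> \<and> \<Delta>e holomorphic_on Omega \<psi> \<rho> \<and>
     (\<forall>s. \<rho>h \<le> s \<and> s < \<rho> \<longrightarrow>
        \<not> (\<exists>g. g holomorphic_on Omega \<psi> s \<and> (\<forall>z\<in>Omega \<psi> 1. g z = \<Delta>e z)))"

definition ext_inverse :: "(complex \<Rightarrow> complex) \<Rightarrow> real \<Rightarrow> complex \<Rightarrow> complex" where
  "ext_inverse \<psi> \<rho>h = the_inv_into (ext_disk \<rho>h) \<psi>"

definition sqrt_branch :: "complex set \<Rightarrow> (complex \<Rightarrow> complex) \<Rightarrow> (complex \<Rightarrow> complex) \<Rightarrow> bool" where
  "sqrt_branch A f q \<longleftrightarrow> q holomorphic_on A \<and> (\<forall>z\<in>A. (q z)\<^sup>2 = f z)"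

definition schwarz_reflection ::
  "(complex \<Rightarrow> complex) \<Rightarrow> (complex \<Rightarrow> complex) \<Rightarrow> complex \<Rightarrow> complex" where
  "schwarz_reflection \<psi> \<phi> z = \<psi> (1 / cnj (\<phi> z))"

definition exterior_szego ::
  "complex set \<Rightarrow> (complex \<Rightarrow> complex) \<Rightarrow> (complex \<Rightarrow> complex) \<Rightarrow> (complex \<Rightarrow> complex) \<Rightarrow> bool" where
  "exterior_szego L \<psi> h \<Delta>e \<longleftrightarrow>
     \<Delta>e analytic_on closure (Omega \<psi> 1) \<and> (\<forall>z\<in>closure (Omega \<psi> 1). \<Delta>e z \<noteq> 0) \<and>
     positive_at_infinity \<Delta>e \<and>
     (\<forall>z\<in>L. complex_of_real (1 / (cmod (\<Delta>e z))\<^sup>2) = h z)"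

definition interior_szego ::
  "complex set \<Rightarrow> (complex \<Rightarrow> complex) \<Rightarrow> (complex \<Rightarrow> complex) \<Rightarrow> (complex \<Rightarrow> complex) \<Rightarrow> bool" where
  "interior_szego L \<psi> h \<Delta>i \<longleftrightarrow>
     \<Delta>i analytic_on closure (G_region \<psi> 1) \<and> (\<forall>z\<in>closure (G_region \<psi> 1). \<Delta>i z \<noteq> 0) \<and>
     (\<forall>z\<in>L. complex_of_real ((cmod (\<Delta>i z))\<^sup>2) = h z)"

text \<open>The continuation of \<open>1/\<Delta>\<^sub>i\<close>. It may vanish outside \<open>closure G\<^sub>1\<close>, so the reciprocal, and not
  \<open>\<Delta>\<^sub>i\<close>, is continued.\<close>

definition recip_interior_szego ::
  "(complex \<Rightarrow> complex) \<Rightarrow> (complex \<Rightarrow> complex) \<Rightarrow> (complex \<Rightarrow> complex) \<Rightarrow> (complex \<Rightarrow> complex) \<Rightarrow>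
   complex \<Rightarrow> complex" where
  "recip_interior_szego \<psi> \<phi> \<Delta>e \<Delta>i z =
     (if z \<in> closure (G_region \<psi> 1) then 1 / \<Delta>i z
      else \<Delta>e z * cnj (\<Delta>e (schwarz_reflection \<psi> \<phi> z)) * cnj (\<Delta>i (schwarz_reflection \<psi> \<phi> z)))"

text \<open>\<open>\<kappa>\<close> is a conformal map of \<open>G\<^sub>1\<close> onto the unit disk without zeros in \<open>\<Omega>\<^sub>\<rho>\<^sub>h \<inter> G\<^sub>1\<close>, already
  extended to \<open>G\<close> of index \<open>1/\<rho>h\<close> by reflection.\<close>

definition interior_map ::
  "(complex \<Rightarrow> complex) \<Rightarrow> real \<Rightarrow> (complex \<Rightarrow> complex) \<Rightarrow> (complex \<Rightarrow> complex) \<Rightarrow> bool" where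
  "interior_map \<psi> \<rho>h \<phi> \<kappa> \<longleftrightarrow>
     \<kappa> holomorphic_on G_region \<psi> (1 / ereal \<rho>h) \<and> inj_on \<kappa> (G_region \<psi> (1 / ereal \<rho>h)) \<and>
     \<kappa> ` G_region \<psi> 1 = ball 0 1 \<and>
     (\<forall>z\<in>Omega \<psi> \<rho>h \<inter> G_region \<psi> 1. \<kappa> z \<noteq> 0) \<and>
     (\<forall>z\<in>G_region \<psi> (1 / ereal \<rho>h) - closure (G_region \<psi> 1).
        \<kappa> z = 1 / cnj (\<kappa> (schwarz_reflection \<psi> \<phi> z)))"

definition kernel_W ::
  "(complex \<Rightarrow> complex) \<Rightarrow> (complex \<Rightarrow> complex) \<Rightarrow> complex \<Rightarrow> complex \<Rightarrow> complex" where
  "kernel_W \<kappa> q \<zeta> z = q z * q \<zeta> / (\<kappa> \<zeta> - \<kappa> z)"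

text \<open>The arguments \<open>S\<close> and \<open>R\<close> stand for the branch of \<open>sqrt \<phi>'\<close> and for the continued \<open>1/\<Delta>\<^sub>i\<close>.
  The argument \<open>k\<close> comes last: \<open>f_transform \<dots> n k\<close> is \<open>f\<close> with lower index \<open>n\<close> and upper index \<open>k\<close>.\<close>

primrec f_transform ::
  "(complex \<Rightarrow> complex) \<Rightarrow> (complex \<Rightarrow> complex) \<Rightarrow> (complex \<Rightarrow> complex) \<Rightarrow> (complex \<Rightarrow> complex) \<Rightarrow>
   (complex \<Rightarrow> complex) \<Rightarrow> (complex \<Rightarrow> complex) \<Rightarrow> (complex \<Rightarrow> complex \<Rightarrow> complex) \<Rightarrow> real \<Rightarrow> nat \<Rightarrow>
   nat \<Rightarrow> complex \<Rightarrow> complex" where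
  "f_transform \<psi> \<phi> S \<Delta>e \<Delta>i R W r n 0 = (\<lambda>z. 1)"
| "f_transform \<psi> \<phi> S \<Delta>e \<Delta>i R W r n (Suc k) =
     (if even k
      then (\<lambda>z. - (1 / (2 * complex_of_real pi * \<i>)) *
             contour_integral (level_path \<psi> r)
               (\<lambda>\<zeta>. f_transform \<psi> \<phi> S \<Delta>e \<Delta>i R W r n k \<zeta> * \<Delta>e \<zeta> * \<Delta>i \<zeta> * W \<zeta> z * S \<zeta> * \<phi> \<zeta> ^ n))
      else (\<lambda>z. 1 / (2 * complex_of_real pi * \<i>) *
             contour_integral (level_path \<psi> (1 / r))
               (\<lambda>\<zeta>. f_transform \<psi> \<phi> S \<Delta>e \<Delta>i R W r n k \<zeta> * S \<zeta> * \<phi> \<zeta> powi (- int n) * R \<zeta>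
                     / (\<Delta>e \<zeta> * (\<phi> \<zeta> - \<phi> z)))))"

text \<open>The maxima over compact curves are written as suprema, since \<open>Max\<close> is meaningful for
  finite sets only.\<close>

definition Lambda_const ::
  "(complex \<Rightarrow> complex) \<Rightarrow> (complex \<Rightarrow> complex) \<Rightarrow> (complex \<Rightarrow> complex) \<Rightarrow> (complex \<Rightarrow> complex) \<Rightarrow>
   real \<Rightarrow> real" where
  "Lambda_const \<psi> S \<Delta>e \<Delta>i r = (SUP \<zeta>\<in>level_curve \<psi> r. cmod (\<Delta>e \<zeta> * \<Delta>i \<zeta> / S \<zeta>))"

definition Lambda'_const ::
  "(complex \<Rightarrow> complex) \<Rightarrow> (complex \<Rightarrow> complex) \<Rightarrow> (complex \<Rightarrow> complex) \<Rightarrow> (complex \<Rightarrow> complex) \<Rightarrow>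
   real \<Rightarrow> real" where
  "Lambda'_const \<psi> S \<Delta>e R r = (SUP \<zeta>\<in>level_curve \<psi> (1 / r). cmod (R \<zeta> / (S \<zeta> * \<Delta>e \<zeta>)))"

definition M_const ::
  "(complex \<Rightarrow> complex) \<Rightarrow> (complex \<Rightarrow> complex \<Rightarrow> complex) \<Rightarrow> real \<Rightarrow> real" where
  "M_const \<psi> W r = (SUP (\<zeta>, z)\<in>level_curve \<psi> r \<times> level_curve \<psi> (1 / r). cmod (W \<zeta> z))"

end

theory Submission
  imports Defs
begin

text \<open>
  Let \<open>A\<close> be the functions analytic inside \<open>L\<^sub>1\<close> and \<open>B\<close> those of the form \<open>e g\<close> with \<open>e = \<Delta>\<^sub>e sqrt \<phi>' \<phi>\<^sup>n\<close>
  and \<open>g\<close> analytic outside \<open>L\<^sub>1\<close> with \<open>g(\<infinity>) = 0\<close>, both in \<open>L\<^sup>2\<close> of \<open>h |dz|\<close>. On \<open>L\<^sub>1\<close>, the functions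
  \<open>x\<^sub>2\<^sub>k = e f\<^sup>(\<^sup>2\<^sup>k\<^sup>)\<close> and \<open>x\<^sub>2\<^sub>k\<^sub>+\<^sub>1 = f\<^sup>(\<^sup>2\<^sup>k\<^sup>+\<^sup>1\<^sup>)/\<Delta>\<^sub>i\<close> arise from \<open>x\<^sub>0 = e\<close> by projecting alternately onto the
  orthogonal complements of \<open>A\<close> and of \<open>B\<close>. So \<open>F = x\<^sub>0 - x\<^sub>1 + x\<^sub>2 - \<dots>\<close> lies in \<open>A\<close> (group the terms as
  \<open>x\<^sub>2\<^sub>k - x\<^sub>2\<^sub>k\<^sub>+\<^sub>1\<close>) and in \<open>e + B\<close> (group them as \<open>x\<^sub>2\<^sub>k\<^sub>+\<^sub>1 - x\<^sub>2\<^sub>k\<^sub>+\<^sub>2\<close>): it is a polynomial of degree \<open>n\<close> with the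
  leading coefficient of \<open>e\<close>. It is orthogonal to \<open>A \<inter> B\<close>, the polynomials of degree less than \<open>n\<close>, because
  the even terms are orthogonal to \<open>B\<close> and the odd ones to \<open>A\<close>. Pairing \<open>F\<close> with itself leaves only the
  even terms paired with \<open>e\<close>, which gives the norm. All integrals are pulled back to circles by \<open>\<psi>\<close>,
  membership in \<open>A\<close> and \<open>B\<close> becomes analytic continuation across \<open>L\<^sub>r\<close> and \<open>L\<^sub>1\<^sub>/\<^sub>r\<close>, and the smallness
  hypothesis makes the double step of the iteration a contraction.
\<close>

subsection \<open>Polynomials and limits at infinity\<close>

text \<open>The obstacle is that no single coordinate covers the plane: \<open>\<phi>\<close> lives
  outside, \<open>\<kappa>\<close> inside, and only the annulus between \<open>\<rho>0\<close> and
  \<open>1 / \<rho>0\<close> sees both. On it the kernel \<open>W\<close> becomes a Cauchy kernel in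
  \<open>M = \<kappa> \<circ> \<psi>\<close>, so that crossing a contour costs one explicit residue.
  Estimates are made only on \<open>L_r\<close> and \<open>L_{1/r}\<close>: each transform
  integrates over one of these curves and is next sampled on the other. Convergence elsewhere
  follows by integrating a uniformly convergent series against the kernel. A double step costs
  \<open>\<Lambda>_r\<close>, \<open>\<Lambda>'_r\<close>, \<open>M_r\<close>, a factor
  \<open>r^n\<close> from each contour and the distance \<open>1/r - r\<close> of the two circles,
  which explains the hypothesis. The sum of the even terms is kept as a function of
  \<open>u = \<phi> z\<close>, because it extends to the whole disk \<open>|u| < 1/r\<close>. Its
  value at \<open>u = 0\<close>, which \<open>\<phi>\<close> does not take on its domain, is the
  bracket in the formula for \<open>\<gamma>_n\<close>.\<close>

lemma tendsto_times_infinity_quotient: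
  fixes f :: "complex \<Rightarrow> complex"
  assumes hol: "\<And>z. B \<le> cmod z \<Longrightarrow> f field_differentiable at z"
    and lim: "(deriv f \<longlongrightarrow> c) at_infinity"
  shows "((\<lambda>z. f z / z) \<longlongrightarrow> c) at_infinity"
proof (rule tendstoI)
  fix e :: real assume "e > 0"
  \<comment> \<open>The derivative of \<open>k\<close> tends to 0, so \<open>k\<close> grows slowly
    along any path; it remains to reach \<open>z\<close> from a fixed compact circle through points
    where \<open>f\<close> is differentiable.\<close>
  define k where "k z = f z - c * z" for z
  from tendstoD[OF lim, of "e/2"] \<open>e > 0\<close> obtain B1 where B1: "\<And>z. B1 \<le> cmod z \<Longrightarrow> dist (deriv f z) c < e/2"
    unfolding eventually_at_infinity by auto
  define B2 where "B2 = max 1 (max B B1)"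
  have B2: "B2 \<ge> 1" "B2 \<ge> B" "B2 \<ge> B1" by (auto simp: B2_def)
  have dk: "(k has_field_derivative (deriv f z - c)) (at z)" if "cmod z \<ge> B2" for z
    unfolding k_def using hol[of z] that B2
    by (auto intro!: derivative_eq_intros simp: DERIV_deriv_iff_field_differentiable)
  have "continuous_on (sphere 0 B2) k"
    using dk by (intro continuous_at_imp_continuous_on ballI) (auto intro: DERIV_isCont)
  then have "bounded (k ` sphere 0 B2)"
    by (intro compact_imp_bounded compact_continuous_image) auto
  then obtain C where "C > 0" "\<forall>x\<in>k ` sphere 0 B2. cmod x \<le> C"
    unfolding bounded_pos by blast
  then have C: "\<And>z. cmod z = B2 \<Longrightarrow> cmod (k z) \<le> C" "C > 0"
    by auto
  have bd: "cmod (k z) \<le> C + e/2 * cmod z" if z: "cmod z \<ge> B2" for z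
  proof -
    \<comment> \<open>The point of the circle of radius \<open>B2\<close> on the ray through
      \<open>z\<close>: the segment from \<open>y\<close> to \<open>z\<close> is radial and stays
      outside the disk about which nothing is known.\<close>
    define y where "y = of_real (B2 / cmod z) * z"
    have zpos: "cmod z > 0" using z B2 by linarith
    have y: "cmod y = B2" using z zpos B2 by (simp add: y_def norm_mult norm_divide)
    have seg: "B2 \<le> cmod x" if x: "x \<in> closed_segment y z" for x
    proof -
      obtain u where u: "0 \<le> u" "u \<le> 1" "x = (1 - u) *\<^sub>R y + u *\<^sub>R z"
        using x by (auto simp: closed_segment_def)
      have "x = of_real ((1-u) * (B2 / cmod z) + u) * z"
        by (simp add: u y_def scaleR_conv_of_real algebra_simps)
      then have "cmod x = ((1-u) * (B2 / cmod z) + u) * cmod z"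
        using u B2 by (simp only: norm_mult norm_of_real) (simp add: abs_of_nonneg)
      also have "\<dots> = (1-u) * B2 + u * cmod z"
        using zpos by (simp add: field_simps)
      also have "\<dots> \<ge> (1-u) * B2 + u * B2" using z u by (intro add_left_mono mult_left_mono) auto
      finally show ?thesis by (simp add: algebra_simps)
    qed
    have "cmod (k z - k y) \<le> e/2 * cmod (z - y)"
    proof (rule field_differentiable_bound[where S = "closed_segment y z"])
      show "(k has_field_derivative (deriv f x - c)) (at x within closed_segment y z)"
        if "x \<in> closed_segment y z" for x
        using dk[OF seg[OF that]] by (rule has_field_derivative_at_within)
      show "cmod (deriv f x - c) \<le> e/2" if "x \<in> closed_segment y z" for x
        using B1[of x] seg[OF that] B2 by (auto simp: dist_norm)
    qed auto
    also have "cmod (z - y) \<le> cmod z"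
    proof -
      have "z - y = of_real (1 - B2 / cmod z) * z" by (simp add: y_def algebra_simps)
      then have "cmod (z - y) = \<bar>1 - B2 / cmod z\<bar> * cmod z" by (simp only: norm_mult norm_of_real)
      also have "\<dots> \<le> 1 * cmod z"
        using zpos z B2 by (intro mult_right_mono) (auto simp: field_simps)
      finally show ?thesis by simp
    qed
    finally have "cmod (k z - k y) \<le> e/2 * cmod z" using \<open>e > 0\<close> by auto
    then show ?thesis using C(1)[OF y] norm_triangle_sub[of "k z" "k y"] by linarith
  qed
  show "\<forall>\<^sub>F z in at_infinity. dist (f z / z) c < e"
    unfolding eventually_at_infinity
  proof (intro exI allI impI)
    fix z assume "max B2 (4 * C / e) \<le> cmod z"
    then have z: "B2 \<le> cmod z" "4 * C / e \<le> cmod z" by auto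
    then have pos: "cmod z > 0" using B2 by linarith
    have "f z / z - c = k z / z" using pos by (auto simp: k_def field_simps)
    then have "dist (f z / z) c = cmod (k z) / cmod z" by (simp add: dist_norm norm_divide)
    also have "\<dots> \<le> (C + e/2 * cmod z) / cmod z" using bd[OF z(1)] pos by (simp add: divide_right_mono)
    also have "\<dots> = C / cmod z + e/2" using pos by (simp add: field_simps)
    also have "C / cmod z \<le> e/4" using z(2) \<open>e > 0\<close> pos by (simp add: field_simps)
    finally show "dist (f z / z) c < e" using \<open>e > 0\<close> by simp
  qed
qed

lemma coeff_sum_tendsto_at_infinity:
  fixes a :: "nat \<Rightarrow> complex"
  shows "((\<lambda>z. (\<Sum>k\<le>n. a k * z ^ k) / z ^ n) \<longlongrightarrow> a n) at_infinity"
proof -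
  have "((\<lambda>z. \<Sum>k\<le>n. a k * inverse z ^ (n - k)) \<longlongrightarrow> (\<Sum>k\<le>n. a k * 0 ^ (n - k))) at_infinity"
    by (intro tendsto_intros tendsto_inverse_0)
  moreover have "(\<Sum>k\<le>n. a k * 0 ^ (n - k)) = a n"
  proof -
    have "(\<Sum>k\<le>n. a k * 0 ^ (n - k)) = (\<Sum>k\<in>{n}. a k * 0 ^ (n - k))"
      by (intro sum.mono_neutral_right) auto
    then show ?thesis by simp
  qed
  moreover have "\<forall>\<^sub>F z in at_infinity. (\<Sum>k\<le>n. a k * inverse z ^ (n - k)) = (\<Sum>k\<le>n. a k * z ^ k) / z ^ n"
    unfolding eventually_at_infinity
  proof (intro exI[of _ 1] allI impI)
    fix z :: complex assume "1 \<le> cmod z"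
    then have "z \<noteq> 0" by auto
    have "a k * inverse z ^ (n - k) = a k * z ^ k / z ^ n" if "k \<le> n" for k
    proof -
      have "z ^ n = z ^ (n - k) * z ^ k" using that by (simp flip: power_add)
      then show ?thesis using \<open>z \<noteq> 0\<close> by (simp add: field_simps)
    qed
    then show "(\<Sum>k\<le>n. a k * inverse z ^ (n - k)) = (\<Sum>k\<le>n. a k * z ^ k) / z ^ n"
      by (simp add: sum_divide_distrib)
  qed
  ultimately show ?thesis
    using Lim_transform_eventually by fastforce
qed

lemma poly_lead_tendsto_at_infinity:
  fixes p :: "complex poly"
  assumes "degree p \<le> n"
  shows "((\<lambda>z. poly p z / z ^ n) \<longlongrightarrow> coeff p n) at_infinity"
proof -
  have "poly p z = (\<Sum>k\<le>n. coeff p k * z ^ k)" for z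
    unfolding poly_altdef using assms by (intro sum.mono_neutral_left) (auto simp: coeff_eq_0)
  then show ?thesis using coeff_sum_tendsto_at_infinity[of "coeff p" n] by simp
qed

text \<open>Triangular elimination: \<open>p N\<close> has degree exactly \<open>N\<close>, so a
  multiple of it removes the coefficient of index \<open>N\<close>. Vanishing coefficients replace a
  degree bound because for \<open>N = 0\<close> the condition has to say
  \<open>d = 0\<close>.\<close>

lemma poly_expansion_in_graded_basis:
  fixes p :: "nat \<Rightarrow> complex poly"
  assumes deg: "\<And>m. degree (p m) = m" and nz: "\<And>m. p m \<noteq> 0"
    and "\<And>k. N \<le> k \<Longrightarrow> coeff d k = 0"
  shows "\<exists>c. d = (\<Sum>m<N. smult (c m) (p m))"
  using assms(3)
proof (induction N arbitrary: d)
  case 0 then show ?case by (auto simp: poly_eq_iff)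
next
  case (Suc N)
  define a where "a = coeff d N / coeff (p N) N"
  have lc: "coeff (p N) N \<noteq> 0" using deg[of N] nz[of N] by (metis leading_coeff_0_iff)
  have "coeff (d - smult a (p N)) k = 0" if "N \<le> k" for k
  proof (cases "k = N")
    case True then show ?thesis using lc by (simp add: a_def)
  next
    case False
    then have "coeff d k = 0" "coeff (p N) k = 0" using that Suc.prems[of k] deg[of N]
      by (auto intro: coeff_eq_0)
    then show ?thesis by simp
  qed
  from Suc.IH[OF this] obtain c where c: "d - smult a (p N) = (\<Sum>m<N. smult (c m) (p m))" by blast
  have "d = (\<Sum>m<Suc N. smult ((c(N := a)) m) (p m))"
    using c by (simp add: algebra_simps)
  then show ?case by blast
qed

lemma poly_holo: "poly p holomorphic_on A"
  unfolding holomorphic_on_def field_differentiable_def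
  using poly_DERIV has_field_derivative_at_within by blast

lemma positive_at_infinity_Lim:
  assumes "positive_at_infinity g"
  shows "(g \<longlongrightarrow> of_real (Re (Lim at_infinity g))) at_infinity" "0 < Re (Lim at_infinity g)"
    "Lim at_infinity g = of_real (Re (Lim at_infinity g))"
proof -
  obtain c where c: "c > 0" "(g \<longlongrightarrow> complex_of_real c) at_infinity"
    using assms by (auto simp: positive_at_infinity_def)
  have "Lim at_infinity g = complex_of_real c" by (rule tendsto_Lim[OF trivial_limit_at_infinity c(2)])
  then show "(g \<longlongrightarrow> of_real (Re (Lim at_infinity g))) at_infinity" "0 < Re (Lim at_infinity g)"
    "Lim at_infinity g = of_real (Re (Lim at_infinity g))" using c by simp_all
qed

subsection \<open>Integrals over circles\<close>

lemma open_annulus: "open {w::complex. a < cmod w \<and> cmod w < b}"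
  by (intro open_Collect_conj open_Collect_less continuous_intros)

text \<open>Two conjugations cancel: the function is \<open>cnj \<circ> k \<circ> cnj\<close> after
  the inversion \<open>w \<mapsto> 1 / w\<close>. It serves the continuation of
  \<open>1 / \<Delta>i\<close> and the conjugated factor in \<open>even_pairing\<close>.\<close>

lemma holomorphic_on_circle_reflection:
  assumes "k holomorphic_on A" "\<And>w. w \<in> B \<Longrightarrow> w \<noteq> 0 \<and> 1 / cnj w \<in> A" "open A"
  shows "(\<lambda>w. cnj (k (1 / cnj w))) holomorphic_on B"
proof -
  have "(cnj \<circ> k \<circ> cnj) holomorphic_on cnj ` A"
  proof (rule holomorphic_on_compose_cnj_cnj)
    show "open (cnj ` A)"
      unfolding image_cnj_conv_vimage_cnj using assms by (intro open_vimage) auto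
  qed (use assms in \<open>simp add: image_image\<close>)
  moreover have "(\<lambda>w. 1 / w) holomorphic_on B" using assms(2)
    by (intro holomorphic_intros) auto
  moreover have "(\<lambda>w. 1 / w) ` B \<subseteq> cnj ` A"
  proof
    fix x assume "x \<in> (\<lambda>w. 1 / w) ` B"
    then obtain w where "w \<in> B" "x = 1 / w" by auto
    then have "x = cnj (1 / cnj w)" "1 / cnj w \<in> A" using assms(2) by auto
    then show "x \<in> cnj ` A" by blast
  qed
  ultimately have "((cnj \<circ> k \<circ> cnj) \<circ> (\<lambda>w. 1 / w)) holomorphic_on B"
    using holomorphic_on_compose_gen by blast
  then show ?thesis by (simp add: o_def)
qed

lemma continuous_contour_integrable_circlepath:
  assumes "continuous_on (sphere 0 s) f" "0 < s"
  shows "f contour_integrable_on circlepath 0 s"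
  using assms by (intro contour_integrable_continuous_circlepath) simp

lemma norm_contour_integral_circlepath_le:
  assumes "continuous_on (sphere 0 s) f" "0 < s" "0 \<le> B" "\<And>w. cmod w = s \<Longrightarrow> cmod (f w) \<le> B"
  shows "cmod (1 / (2 * complex_of_real pi * \<i>) * contour_integral (circlepath 0 s) f) \<le> B * s"
proof -
  have "cmod (contour_integral (circlepath 0 s) f) \<le> B * (2 * pi * s)"
    using continuous_contour_integrable_circlepath[OF assms(1,2)] assms
    by (intro has_contour_integral_bound_circlepath[where f = f and z = 0])
       (auto simp: has_contour_integral_integral)
  then show ?thesis by (simp add: norm_mult norm_divide field_simps)
qed

text \<open>Weierstrass test on a compact circle. Every exchange of an infinite sum with an integral
  goes through this; \<open>g\<close> is the fixed part of the integrand.\<close>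

lemma circlepath_integral_sums:
  fixes a :: "nat \<Rightarrow> complex \<Rightarrow> complex"
  assumes s: "0 < s" and a: "\<And>k. continuous_on (sphere 0 s) (a k)"
    and B: "summable B" "\<And>k w. cmod w = s \<Longrightarrow> cmod (a k w) \<le> B k"
    and g: "continuous_on (sphere 0 s) g"
  shows "continuous_on (sphere 0 s) (\<lambda>w. \<Sum>k. a k w)"
    and "(\<lambda>k. contour_integral (circlepath 0 s) (\<lambda>w. a k w * g w)) sums
           contour_integral (circlepath 0 s) (\<lambda>w. (\<Sum>k. a k w) * g w)"
proof -
  have ul: "uniform_limit (sphere 0 s) (\<lambda>N w. \<Sum>k<N. a k w) (\<lambda>w. \<Sum>k. a k w) sequentially"
    using B by (intro Weierstrass_m_test[where M = B]) auto
  show cont: "continuous_on (sphere 0 s) (\<lambda>w. \<Sum>k. a k w)"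
    using ul by (rule uniform_limit_theorem[rotated]) (auto intro!: always_eventually continuous_intros a)
  have bnd: "bounded ((\<lambda>w. \<Sum>k. a k w) ` sphere 0 s)" "bounded (g ` sphere 0 s)"
    using cont g by (auto intro!: compact_imp_bounded compact_continuous_image)
  have "uniform_limit (sphere 0 s) (\<lambda>N w. (\<Sum>k<N. a k w) * g w) (\<lambda>w. (\<Sum>k. a k w) * g w) sequentially"
    using bnd by (intro bounded_bilinear.bounded_uniform_limit[OF bounded_bilinear_mult ul]
        uniform_limit_const) auto
  then have lim: "(\<lambda>N. contour_integral (circlepath 0 s) (\<lambda>w. (\<Sum>k<N. a k w) * g w)) \<longlonglongrightarrow>
          contour_integral (circlepath 0 s) (\<lambda>w. (\<Sum>k. a k w) * g w)"
    using s by (intro contour_integral_uniform_limit_circlepath(2))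
      (auto intro!: always_eventually continuous_contour_integrable_circlepath continuous_intros a g)
  moreover have "contour_integral (circlepath 0 s) (\<lambda>w. (\<Sum>k<N. a k w) * g w) =
      (\<Sum>k<N. contour_integral (circlepath 0 s) (\<lambda>w. a k w * g w))" for N
    unfolding sum_distrib_right using s
    by (intro contour_integral_sum continuous_contour_integrable_circlepath continuous_intros a g) auto
  ultimately show "(\<lambda>k. contour_integral (circlepath 0 s) (\<lambda>w. a k w * g w)) sums
           contour_integral (circlepath 0 s) (\<lambda>w. (\<Sum>k. a k w) * g w)"
    by (simp add: sums_def)
qed

section \<open>Cauchy transforms over circles\<close>

lemma contour_integral_cmult:
  "contour_integral g (\<lambda>w. c * f w) = c * contour_integral g (f :: complex \<Rightarrow> complex)"
  unfolding contour_integral_integral by (simp add: mult.assoc)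

text \<open>A Cauchy integral whose integration variable is sent through \<open>M\<close>. With
  \<open>M\<close> the identity it carries the even transforms, with
  \<open>M = \<kappa> \<circ> \<psi>\<close> the odd ones, so both kernels share the lemmas on
  convergence and residues.\<close>

definition cauchy_transform ::
  "real \<Rightarrow> (complex \<Rightarrow> complex) \<Rightarrow> (complex \<Rightarrow> complex) \<Rightarrow> complex \<Rightarrow> complex" where
  "cauchy_transform s m M u =
     1 / (2 * complex_of_real pi * \<i>) * contour_integral (circlepath 0 s) (\<lambda>w. m w / (M w - u))"

lemma circlepath_in_sphere: "0 < s \<Longrightarrow> circlepath 0 s t \<in> sphere 0 s"
  by (simp add: circlepath norm_mult)

lemma contour_integral_circlepath_cong:
  assumes "0 < s" "\<And>w. cmod w = s \<Longrightarrow> f w = g w"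
  shows "contour_integral (circlepath 0 s) f = contour_integral (circlepath 0 s) g"
  using assms by (intro contour_integral_cong) auto

lemma cauchy_transform_cong:
  assumes "0 < s" "\<And>w. cmod w = s \<Longrightarrow> m w = m' w"
  shows "cauchy_transform s m M u = cauchy_transform s m' M u"
  unfolding cauchy_transform_def using assms
  by (intro arg_cong2[where f = times] contour_integral_circlepath_cong) auto

text \<open>Differentiation under the integral sign after parametrizing the circle. Only
  \<open>u\<close> is differentiated, so continuity of \<open>m\<close> and \<open>M\<close>
  suffices.\<close>

lemma holomorphic_on_cauchy_transform:
  assumes s: "0 < s" and m: "continuous_on (sphere 0 s) m" and M: "continuous_on (sphere 0 s) M"
  shows "cauchy_transform s m M holomorphic_on - M ` sphere 0 s"
proof -
  define c where "c = circlepath 0 s"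
  define v where "v t = 2 * of_real pi * \<i> * of_real s * exp (2 * of_real pi * \<i> * of_real t)" for t :: real
  have c: "continuous_on {0..1} c" "\<And>t. c t \<in> sphere 0 s"
    using s path_circlepath[of 0 s] circlepath_in_sphere by (auto simp: c_def path_def)
  have mc: "continuous_on {0..1} (\<lambda>t. m (c t))" "continuous_on {0..1} (\<lambda>t. M (c t))"
    by (rule continuous_on_compose2[OF m c(1)] continuous_on_compose2[OF M c(1)], use c in auto)+
  have v: "continuous_on X v" for X unfolding v_def by (intro continuous_intros)
  have op: "open (- M ` sphere 0 s)"
    by (intro open_Compl compact_imp_closed compact_continuous_image M) auto
  have eq: "cauchy_transform s m M u =
      1 / (2 * complex_of_real pi * \<i>) * integral (cbox 0 1) (\<lambda>t. m (c t) / (M (c t) - u) * v t)" for u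
    by (simp add: cauchy_transform_def contour_integral_integral c_def v_def vector_derivative_circlepath)
  have "cauchy_transform s m M field_differentiable at u" if u: "u \<in> - M ` sphere 0 s" for u
  proof -
    obtain d where d: "d > 0" "ball u d \<subseteq> - M ` sphere 0 s" using op u open_contains_ball by blast
    have ne: "M (c t) - x \<noteq> 0" if "x \<in> ball u d" for x t
    proof
      assume "M (c t) - x = 0"
      then have "x = M (c t)" by simp
      then have "x \<in> M ` sphere 0 s" using c(2) by blast
      then show False using d that by blast
    qed
    have "(\<lambda>u. integral (cbox 0 1) (\<lambda>t. m (c t) / (M (c t) - u) * v t)) holomorphic_on ball u d"
    proof (rule leibniz_rule_holomorphic[where fx = "\<lambda>x t. m (c t) / (M (c t) - x)^2 * v t"])
      show "((\<lambda>x. m (c t) / (M (c t) - x) * v t) has_field_derivative m (c t) / (M (c t) - x)^2 * v t)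
              (at x within ball u d)" if "x \<in> ball u d" for x t
        using ne[OF that, of t]
        by (auto intro!: derivative_eq_intros simp: power2_eq_square field_simps)
      show "(\<lambda>t. m (c t) / (M (c t) - x) * v t) integrable_on cbox 0 1" if "x \<in> ball u d" for x
        using ne[OF that] by (intro integrable_continuous) (auto intro!: continuous_intros mc v)
      have mc2: "continuous_on (ball u d \<times> {0..1}) (\<lambda>p. m (c (snd p)))"
                "continuous_on (ball u d \<times> {0..1}) (\<lambda>p. M (c (snd p)))"
                "continuous_on (ball u d \<times> {0..1}) (\<lambda>p. v (snd p))"
        by (rule continuous_on_compose2[OF mc(1)] continuous_on_compose2[OF mc(2)]
            continuous_on_compose2[OF v]; auto intro!: continuous_intros)+
      show "continuous_on (ball u d \<times> cbox 0 1) (\<lambda>(x, t). m (c t) / (M (c t) - x)\<^sup>2 * v t)"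
        using ne by (auto simp: case_prod_unfold intro!: continuous_intros mc2)
    qed auto
    then have "cauchy_transform s m M holomorphic_on ball u d"
      unfolding eq[abs_def] by (intro holomorphic_intros)
    then show ?thesis using d(1) holomorphic_on_imp_differentiable_at by auto
  qed
  then show ?thesis by (simp add: holomorphic_on_def field_differentiable_at_within)
qed

lemma cauchy_transform_sums:
  assumes s: "0 < s" and a: "\<And>k. continuous_on (sphere 0 s) (a k)"
    and B: "summable B" "\<And>k w. cmod w = s \<Longrightarrow> cmod (a k w) \<le> B k"
    and m: "continuous_on (sphere 0 s) m" and M: "continuous_on (sphere 0 s) M"
    and u: "u \<notin> M ` sphere 0 s"
  shows "(\<lambda>k. cauchy_transform s (\<lambda>w. a k w * m w) M u) sums
           cauchy_transform s (\<lambda>w. (\<Sum>k. a k w) * m w) M u"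
proof -
  have "continuous_on (sphere 0 s) (\<lambda>w. m w / (M w - u))"
    using u by (intro continuous_intros m M) auto
  from circlepath_integral_sums(2)[OF s a B this]
  show ?thesis unfolding cauchy_transform_def by (intro sums_mult) simp
qed

lemma norm_cauchy_transform_le:
  assumes s: "0 < s" and m: "continuous_on (sphere 0 s) m" and M: "continuous_on (sphere 0 s) M"
    and u: "u \<notin> M ` sphere 0 s" and B: "0 \<le> B" "\<And>w. cmod w = s \<Longrightarrow> cmod (m w / (M w - u)) \<le> B"
  shows "cmod (cauchy_transform s m M u) \<le> B * s"
proof -
  have "continuous_on (sphere 0 s) (\<lambda>w. m w / (M w - u))"
    using u by (intro continuous_intros m M) auto
  then show ?thesis
    unfolding cauchy_transform_def by (rule norm_contour_integral_circlepath_le[OF _ s B])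
qed

lemma cauchy_transform_tendsto_0:
  assumes s: "0 < s" and m: "continuous_on (sphere 0 s) m"
  shows "(cauchy_transform s m (\<lambda>w. w) \<longlongrightarrow> 0) at_infinity"
proof -
  have "bounded (m ` sphere 0 s)" by (intro compact_imp_bounded compact_continuous_image m) auto
  then obtain C where C: "C > 0" "\<forall>x\<in>m ` sphere 0 s. cmod x \<le> C" unfolding bounded_pos by blast
  have bd: "cmod (cauchy_transform s m (\<lambda>w. w) u) \<le> 2 * C * s / cmod u" if "2 * s \<le> cmod u" for u
  proof -
    have "cmod (cauchy_transform s m (\<lambda>w. w) u) \<le> (2 * C / cmod u) * s"
    proof (rule norm_cauchy_transform_le)
      fix w assume w: "cmod w = s"
      have "cmod u / 2 \<le> cmod (w - u)" using that w norm_triangle_ineq2[of u w] by (simp add: norm_minus_commute)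
      then have "cmod (m w) / cmod (w - u) \<le> C / (cmod u / 2)"
        using C w that s by (intro frac_le) auto
      then show "cmod (m w / (w - u)) \<le> 2 * C / cmod u" by (simp add: norm_divide mult.commute)
    qed (use s C that m in auto)
    then show ?thesis by simp
  qed
  show ?thesis
  proof (rule Lim_null_comparison[where g = "\<lambda>u. 2 * C * s * cmod (inverse u)"])
    show "\<forall>\<^sub>F u in at_infinity. cmod (cauchy_transform s m (\<lambda>w. w) u) \<le> 2 * C * s * cmod (inverse u)"
      unfolding eventually_at_infinity using bd by (auto simp: norm_inverse divide_inverse)
    show "((\<lambda>u::complex. 2 * C * s * cmod (inverse u)) \<longlongrightarrow> 0) at_infinity"
      by (intro tendsto_mult_right_zero tendsto_norm_zero tendsto_inverse_0)
  qed
qed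

text \<open>The linear homotopy moves each point of the inner circle along its ray, hence never
  leaves the annulus.\<close>

lemma contour_integral_circlepath_annulus:
  assumes "f holomorphic_on A" "open A" "0 < s1" "s1 \<le> s2"
    and sub: "{w. s1 \<le> cmod w \<and> cmod w \<le> s2} \<subseteq> A"
  shows "contour_integral (circlepath 0 s1) f = contour_integral (circlepath 0 s2) f"
proof (rule Cauchy_theorem_homotopic_loops[OF homotopic_loops_linear assms(2,1)])
  fix t :: real
  show "closed_segment (circlepath 0 s1 t) (circlepath 0 s2 t) \<subseteq> A"
  proof
    fix x assume "x \<in> closed_segment (circlepath 0 s1 t) (circlepath 0 s2 t)"
    then obtain u where u: "0 \<le> u" "u \<le> 1"
      "x = (1 - u) *\<^sub>R circlepath 0 s1 t + u *\<^sub>R circlepath 0 s2 t"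
      by (auto simp: closed_segment_def)
    have "x = of_real ((1 - u) * s1 + u * s2) * exp (2 * of_real pi * \<i> * of_real t)"
      by (simp add: u circlepath scaleR_conv_of_real algebra_simps)
    then have "cmod x = \<bar>(1 - u) * s1 + u * s2\<bar> * cmod (exp (2 * of_real pi * \<i> * of_real t))"
      by (simp only: norm_mult norm_of_real)
    moreover have "(1 - u) * s1 + u * s2 = s1 + u * (s2 - s1)" by (simp add: algebra_simps)
    moreover have "0 \<le> u * (s2 - s1)" "u * (s2 - s1) \<le> s2 - s1"
      using u assms(4) by (auto intro: mult_left_le_one_le)
    ultimately have "s1 \<le> cmod x \<and> cmod x \<le> s2" using assms(3) by simp
    then show "x \<in> A" using sub by auto
  qed
qed auto

text \<open>If \<open>M\<close> does not take the value \<open>u\<close> on the closed annulus, the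
  integrand is holomorphic near it once the closed set \<open>M w = u\<close> is removed from
  \<open>A\<close>.\<close>

lemma cauchy_transform_annulus:
  assumes "m holomorphic_on A" "M holomorphic_on A" "open A" "0 < s1" "s1 \<le> s2"
    and "{w. s1 \<le> cmod w \<and> cmod w \<le> s2} \<subseteq> A"
    and "u \<notin> M ` {w. s1 \<le> cmod w \<and> cmod w \<le> s2}"
  shows "cauchy_transform s1 m M u = cauchy_transform s2 m M u"
proof -
  define A' where "A' = A \<inter> M -` (- {u})"
  have "open A'"
    unfolding A'_def using assms(2,3)
    by (intro continuous_open_preimage[OF holomorphic_on_imp_continuous_on]) auto
  moreover have "m holomorphic_on A'" "M holomorphic_on A'"
    using assms(1,2) holomorphic_on_subset by (auto simp: A'_def)
  then have "(\<lambda>w. m w / (M w - u)) holomorphic_on A'"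
    by (intro holomorphic_intros) (auto simp: A'_def)
  moreover have "{w. s1 \<le> cmod w \<and> cmod w \<le> s2} \<subseteq> A'" using assms(6,7) by (auto simp: A'_def)
  ultimately have "contour_integral (circlepath 0 s1) (\<lambda>w. m w / (M w - u)) =
      contour_integral (circlepath 0 s2) (\<lambda>w. m w / (M w - u))"
    using contour_integral_circlepath_annulus assms(4,5) by blast
  then show ?thesis by (simp only: cauchy_transform_def)
qed

text \<open>Contours on the two sides of \<open>w0\<close> differ by the residue of
  \<open>m w / (M w - M w0)\<close>, whose only pole in \<open>A\<close> is \<open>w0\<close>
  because \<open>M\<close> is injective. \<open>A\<close> need not contain the inner disk, so the
  pole is split off by hand: the rest is holomorphic on \<open>A\<close>, and only the fraction
  \<open>k w0 / (w - w0)\<close> is evaluated over each full circle.\<close>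

lemma cauchy_transform_jump:
  assumes m: "m holomorphic_on A" and M: "M holomorphic_on A" and A: "open A" "inj_on M A" and "0 < s1"
    and sub: "{w. s1 \<le> cmod w \<and> cmod w \<le> s2} \<subseteq> A"
    and w0: "s1 < cmod w0" "cmod w0 < s2"
  shows "cauchy_transform s2 m M (M w0) = cauchy_transform s1 m M (M w0) + m w0 / deriv M w0"
proof -
  have s2: "0 < s2" and w0A: "w0 \<in> A" using assms(5) w0 sub by auto
  \<comment> \<open>The completed difference quotient of \<open>M\<close> is never zero by
    injectivity; hence \<open>m / (M - M w0) = k / (w - w0)\<close> with \<open>k\<close>
    holomorphic. The quotient \<open>k2\<close> of \<open>k\<close> is the part without a
    pole.\<close>
  define D where "D w = (if w = w0 then deriv M w0 else (M w - M w0) / (w - w0))" for w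
  define k where "k w = m w / D w" for w
  define k2 where "k2 w = (if w = w0 then deriv k w0 else (k w - k w0) / (w - w0))" for w
  have D: "D holomorphic_on A" unfolding D_def[abs_def] by (intro pole_lemma_open M A)
  have "D w \<noteq> 0" if "w \<in> A" for w
    using holomorphic_injective_imp_regular[OF M A w0A] inj_onD[OF A(2), of w w0] that w0A by (auto simp: D_def)
  then have k: "k holomorphic_on A" unfolding k_def[abs_def] by (intro holomorphic_intros m D)
  have k2: "k2 holomorphic_on A" unfolding k2_def[abs_def] by (intro pole_lemma_open k A)
  have int: "contour_integral (circlepath 0 s) (\<lambda>w. m w / (M w - M w0)) =
      contour_integral (circlepath 0 s) k2 + I"
    if s: "0 < s" "s = s1 \<or> s = s2" and I: "((\<lambda>w. k w0 / (w - w0)) has_contour_integral I) (circlepath 0 s)" for s I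
  proof -
    have "k2 contour_integrable_on circlepath 0 s"
      using s sub w0
      by (intro continuous_contour_integrable_circlepath holomorphic_on_imp_continuous_on
          holomorphic_on_subset[OF k2]) auto
    then have "((\<lambda>w. k2 w + k w0 / (w - w0)) has_contour_integral
        contour_integral (circlepath 0 s) k2 + I) (circlepath 0 s)"
      by (intro has_contour_integral_add I) (simp add: has_contour_integral_integral)
    then have *: "contour_integral (circlepath 0 s) (\<lambda>w. k2 w + k w0 / (w - w0)) =
        contour_integral (circlepath 0 s) k2 + I"
      by (rule contour_integral_unique)
    have "contour_integral (circlepath 0 s) (\<lambda>w. m w / (M w - M w0)) =
        contour_integral (circlepath 0 s) (\<lambda>w. k2 w + k w0 / (w - w0))"
    proof (rule contour_integral_circlepath_cong[OF s(1)])
      fix w assume "cmod w = s"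
      then have "w \<noteq> w0" "w \<in> A" using s sub w0 by auto
      then have "M w - M w0 \<noteq> 0" using inj_onD[OF A(2), of w w0] w0A by auto
      then have "m w / (M w - M w0) = k w / (w - w0)"
        using \<open>w \<noteq> w0\<close> by (simp add: k_def D_def)
      also have "\<dots> = k2 w + k w0 / (w - w0)"
        using \<open>w \<noteq> w0\<close> by (simp add: k2_def flip: add_divide_distrib)
      finally show "m w / (M w - M w0) = k2 w + k w0 / (w - w0)" .
    qed
    with * show ?thesis by simp
  qed
  have "((\<lambda>w. k w0 / (w - w0)) has_contour_integral (2 * of_real pi * \<i> * k w0)) (circlepath 0 s2)"
    by (rule Cauchy_integral_circlepath[where f = "\<lambda>_. k w0"]) (use w0 in auto)
  then have i2: "contour_integral (circlepath 0 s2) (\<lambda>w. m w / (M w - M w0)) =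
      contour_integral (circlepath 0 s2) k2 + 2 * of_real pi * \<i> * k w0"
    by (intro int[OF s2]) simp
  \<comment> \<open>The inner circle does not enclose \<open>w0\<close>: the fraction is holomorphic
    on the disk of radius \<open>|w0|\<close>.\<close>
  have "((\<lambda>w. k w0 / (w - w0)) has_contour_integral 0) (circlepath 0 s1)"
    by (rule Cauchy_theorem_disc_simple[where a = 0 and e = "cmod w0"])
       (use w0 assms(5) in \<open>auto intro!: holomorphic_intros\<close>)
  then have i1: "contour_integral (circlepath 0 s1) (\<lambda>w. m w / (M w - M w0)) =
      contour_integral (circlepath 0 s1) k2 + 0"
    by (intro int[OF assms(5)]) simp
  have "contour_integral (circlepath 0 s1) k2 = contour_integral (circlepath 0 s2) k2"
    by (rule contour_integral_circlepath_annulus[OF k2 A(1) assms(5) _ sub]) (use w0 in auto)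
  with i1 i2 have "contour_integral (circlepath 0 s2) (\<lambda>w. m w / (M w - M w0)) =
      contour_integral (circlepath 0 s1) (\<lambda>w. m w / (M w - M w0)) + 2 * of_real pi * \<i> * k w0"
    by simp
  moreover have "k w0 = m w0 / deriv M w0" by (simp add: k_def D_def)
  ultimately show ?thesis by (simp add: cauchy_transform_def distrib_left)
qed

lemma cauchy_transform_cmult: "cauchy_transform s (\<lambda>w. c * m w) M u = c * cauchy_transform s m M u"
  using contour_integral_cmult[of "circlepath 0 s" c "\<lambda>w. m w / (M w - u)"]
  by (simp add: cauchy_transform_def)

section \<open>Change of variables between level curves and circles\<close>

lemma contour_integral_level_path:
  assumes "\<psi> holomorphic_on A" "open A" "sphere 0 s \<subseteq> A" "0 < s"
  shows "contour_integral (level_path \<psi> s) f = contour_integral (circlepath 0 s) (\<lambda>w. f (\<psi> w) * deriv \<psi> w)"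
  unfolding level_path_def
  by (subst contour_integral_comp_analyticW[of _ A])
     (use assms in \<open>simp_all add: analytic_on_open mult.commute\<close>)

text \<open>On the unit circle \<open>|dw| = dw / (\<i> w)\<close>, and \<open>\<psi>\<close>
  stretches lengths by \<open>|\<psi>'|\<close>. The \<open>1 / w\<close> in all later pairings has
  this origin.\<close>

lemma arclength_integral_level_path:
  assumes "\<psi> holomorphic_on A" "open A" "sphere 0 1 \<subseteq> A"
  shows "arclength_integral (level_path \<psi> 1) f =
           contour_integral (circlepath 0 1) (\<lambda>w. f (\<psi> w) * of_real (cmod (deriv \<psi> w)) / w) / \<i>"
proof -
  define c where "c = circlepath 0 1"
  have cs: "c t \<in> sphere 0 1" for t using circlepath_in_sphere[of 1 t] by (simp add: c_def)
  have vd: "(c has_vector_derivative 2 * pi * \<i> * c t) (at t)" for t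
  proof -
    define A where "A = complex_of_real (2 * pi) * \<i>"
    have "2 * complex_of_real pi * \<i> * complex_of_real u = u *\<^sub>R A" for u
      by (simp add: A_def scaleR_conv_of_real)
    then have c: "c = (\<lambda>u. exp (u *\<^sub>R A))"
      unfolding c_def circlepath by simp
    have "((\<lambda>u. exp (u *\<^sub>R A)) has_vector_derivative exp (t *\<^sub>R A) * A) (at t)"
      by (rule exp_scaleR_has_vector_derivative_right)
    then show ?thesis unfolding c A_def[symmetric] by (simp only: mult.commute)
  qed
  have vd2: "vector_derivative (\<psi> \<circ> c) (at t within {0..1}) = 2 * pi * \<i> * c t * deriv \<psi> (c t)"
    if "t \<in> {0..1}" for t
  proof (rule vector_derivative_at_within_ivl)
    show "(\<psi> \<circ> c has_vector_derivative 2 * pi * \<i> * c t * deriv \<psi> (c t)) (at t)"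
      using field_vector_diff_chain_at[OF vd] holomorphic_derivI[OF assms(1,2)] cs assms(3) by blast
  qed (use that in auto)
  have nc: "cmod (c t) = 1" "c t \<noteq> 0" for t using cs[of t] by (auto)
  have "arclength_integral (level_path \<psi> 1) f =
      integral {0..1} (\<lambda>t. f (\<psi> (c t)) * of_real (cmod (2 * pi * \<i> * c t * deriv \<psi> (c t))))"
    unfolding arclength_integral_def level_path_def c_def[symmetric]
    by (intro integral_cong) (simp only: vd2 o_apply)
  also have "\<dots> = integral {0..1} (\<lambda>t. f (\<psi> (c t)) * of_real (cmod (deriv \<psi> (c t))) / c t * (2 * pi * \<i> * c t) / \<i>)"
  proof (intro integral_cong)
    fix t
    have *: "cmod (2 * pi * \<i> * c t * deriv \<psi> (c t)) = 2 * pi * cmod (deriv \<psi> (c t))"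
      by (simp only: norm_mult nc(1)) simp
    show "f (\<psi> (c t)) * of_real (cmod (2 * pi * \<i> * c t * deriv \<psi> (c t))) =
        f (\<psi> (c t)) * of_real (cmod (deriv \<psi> (c t))) / c t * (2 * pi * \<i> * c t) / \<i>"
      unfolding * using nc(2)[of t] by (simp add: field_simps)
  qed
  also have "\<dots> = integral {0..1} (\<lambda>t. f (\<psi> (c t)) * of_real (cmod (deriv \<psi> (c t))) / c t * (2 * pi * \<i> * c t)) / \<i>"
    by (rule integral_divide)
  also have "\<dots> = contour_integral c (\<lambda>w. f (\<psi> w) * of_real (cmod (deriv \<psi> w)) / w) / \<i>"
    unfolding contour_integral_integral by (simp only: vector_derivative_at[OF vd])
  finally show ?thesis by (simp add: c_def)
qed

text \<open>On the unit circle the conjugate of \<open>dw\<close> is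
  \<open>- dw / w^2\<close>.\<close>

lemma contour_integral_circlepath_cnj:
  "contour_integral (circlepath 0 1) (\<lambda>w. cnj (X w)) = - cnj (contour_integral (circlepath 0 1) (\<lambda>w. X w / w\<^sup>2))"
proof -
  define c where "c = circlepath 0 1"
  have vd: "vector_derivative c (at t) = 2 * of_real pi * \<i> * c t" for t
    by (simp only: c_def vector_derivative_circlepath) (simp add: circlepath)
  have c: "c t * cnj (c t) = 1" for t
    using complex_norm_square[of "c t"] circlepath_in_sphere[of 1 t] by (simp add: c_def)
  have "cnj (X (c t)) * (2 * of_real pi * \<i> * c t) = - cnj (X (c t) / (c t)\<^sup>2 * (2 * of_real pi * \<i> * c t))" for t
  proof -
    have "c t \<noteq> 0" "cnj (c t) \<noteq> 0" using c[of t] by auto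
    then have "cnj (X (c t)) / (cnj (c t))\<^sup>2 * (2 * of_real pi * \<i> * cnj (c t)) = cnj (X (c t)) * (2 * of_real pi * \<i>) * (1 / cnj (c t))"
      by (simp add: power2_eq_square)
    also have "1 / cnj (c t) = c t" using c[of t] \<open>cnj (c t) \<noteq> 0\<close> by (simp add: divide_eq_eq)
    finally show ?thesis by simp
  qed
  then have "integral {0..1} (\<lambda>t. cnj (X (c t)) * (2 * of_real pi * \<i> * c t)) =
      integral {0..1} (\<lambda>t. - cnj (X (c t) / (c t)\<^sup>2 * (2 * of_real pi * \<i> * c t)))" by simp
  also have "\<dots> = - cnj (integral {0..1} (\<lambda>t. X (c t) / (c t)\<^sup>2 * (2 * of_real pi * \<i> * c t)))"
    by (simp only: integral_neg integral_cnj)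
  finally show ?thesis unfolding contour_integral_integral c_def[symmetric] vd .
qed

text \<open>The derivative of \<open>|M|\<^sup>2\<close> vanishes along the circle and is nonnegative in the radial direction, so
  \<open>w M'(w) / M(w)\<close> is real and nonnegative.\<close>

lemma boundary_tangent:
  fixes M :: "complex \<Rightarrow> complex"
  assumes D: "(M has_field_derivative D) (at w)" and w: "cmod w = 1"
    and circ: "\<And>v. cmod v = 1 \<Longrightarrow> cmod (M v) = 1"
    and "0 < \<delta>" and inside: "\<And>t. 0 < t \<Longrightarrow> t < \<delta> \<Longrightarrow> cmod (M (w * exp (of_real (- t)))) \<le> 1"
  shows "w * D = M w * of_real (cmod D)"
proof -
  define a where "a = cnj (M w) * (w * D)"
  define N where "N s t = Re (M (w * exp (of_real t * s)) * cnj (M (w * exp (of_real t * s))))" for s :: complex and t :: real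
  have N: "N s t = (cmod (M (w * exp (of_real t * s))))\<^sup>2" for s t
    by (simp add: N_def complex_norm_square[symmetric])
  have dN: "(N s has_real_derivative 2 * Re (a * s)) (at 0)" for s
  proof -
    have "((\<lambda>x. w * exp (x * s)) has_field_derivative w * s) (at 0)"
      by (auto intro!: derivative_eq_intros)
    from DERIV_chain2[of M D "\<lambda>x. w * exp (x * s)", OF _ this] D
    have "((\<lambda>x. M (w * exp (x * s))) has_field_derivative D * (w * s)) (at (of_real 0))" by simp
    from has_vector_derivative_real_field[OF this]
    have \<gamma>: "((\<lambda>t. M (w * exp (of_real t * s))) has_vector_derivative D * (w * s)) (at 0)" by simp
    have "((\<lambda>t. M (w * exp (of_real t * s)) * cnj (M (w * exp (of_real t * s)))) has_vector_derivative
        M w * cnj (D * (w * s)) + D * (w * s) * cnj (M w)) (at 0)"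
      using has_vector_derivative_mult[OF \<gamma> has_vector_derivative_cnj[OF \<gamma>]] by simp
    from bounded_linear.has_vector_derivative[OF bounded_linear_Re this]
    have "(N s has_vector_derivative Re (M w * cnj (D * (w * s)) + D * (w * s) * cnj (M w))) (at 0)"
      unfolding N_def[abs_def] .
    moreover have "D * (w * s) * cnj (M w) = a * s" "M w * cnj (D * (w * s)) = cnj (a * s)"
      by (simp_all add: a_def mult_ac)
    then have "Re (M w * cnj (D * (w * s)) + D * (w * s) * cnj (M w)) = 2 * Re (a * s)"
      by (simp only: plus_complex.sel complex_cnj cnj.sel)
    ultimately show ?thesis
      by (simp only: has_real_derivative_iff_has_vector_derivative)
  qed
  have "N \<i> t = 1" for t unfolding N using w by (subst circ) (simp_all add: norm_mult)
  then have "N \<i> = (\<lambda>_. 1)" by auto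
  then have "(N \<i> has_real_derivative 0) (at 0)" by simp
  from DERIV_unique[OF this dN] have Im: "Im a = 0" by simp
  have Re: "0 \<le> Re a"
  proof (rule ccontr)
    assume "\<not> 0 \<le> Re a"
    then have "2 * Re (a * 1) < 0" by simp
    from DERIV_neg_dec_left[OF dN this] obtain d where d: "d > 0" "\<And>t. t > 0 \<Longrightarrow> t < d \<Longrightarrow> N 1 0 < N 1 (0 - t)"
      by blast
    define t where "t = min d \<delta> / 2"
    have t: "0 < t" "t < d" "t < \<delta>" using d \<open>0 < \<delta>\<close> by (auto simp: t_def)
    have "N 1 0 = 1" unfolding N using circ[OF w] by simp
    moreover have "N 1 (0 - t) \<le> 1" unfolding N using inside[OF t(1,3)] by (simp add: power_le_one)
    ultimately show False using d(2)[OF t(1,2)] by simp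
  qed
  have "cmod a = cmod D" using w circ[OF w] by (simp add: a_def norm_mult)
  then have "a = of_real (cmod D)" using Im Re by (simp add: complex_eq_iff cmod_eq_Re)
  moreover have "M w * cnj (M w) = 1" using circ[OF w] complex_norm_square[of "M w"] by simp
  then have "M w * a = w * D" unfolding a_def by (metis mult.assoc mult.left_neutral)
  ultimately show ?thesis by simp
qed

subsection \<open>The exterior map\<close>

locale exterior_domain =
  fixes L :: "complex set" and \<psi> \<phi> :: "complex \<Rightarrow> complex" and \<rho>h :: real
  assumes jordan: "analytic_jordan_curve L"
    and ext_map: "exterior_map L \<psi>"
    and radius: "least_univalence_radius \<psi> \<rho>h"
    and radius_less_1: "\<rho>h < 1"
    and \<phi>_eq: "\<phi> = ext_inverse \<psi> \<rho>h"
begin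

lemma radius_nonneg: "0 \<le> \<rho>h"
  and psi_holo: "\<psi> holomorphic_on ext_disk \<rho>h"
  and psi_inj: "inj_on \<psi> (ext_disk \<rho>h)"
  using radius by (auto simp: least_univalence_radius_def)

lemma psi_infinity: "filterlim \<psi> at_infinity at_infinity"
  and Omega_1: "Omega \<psi> 1 = outside L"
  using ext_map by (auto simp: exterior_map_def Omega_def)

lemma open_ext_disk: "open (ext_disk s)"
  by (simp add: ext_disk_def open_Collect_less continuous_on_norm_id)

lemma psi_inj_iff: "\<rho>h < cmod v \<Longrightarrow> \<rho>h < cmod w \<Longrightarrow> \<psi> v = \<psi> w \<longleftrightarrow> v = w"
  using inj_onD[OF psi_inj, of v w] by (auto simp: ext_disk_def)

lemma phi_psi [simp]: "\<rho>h < cmod w \<Longrightarrow> \<phi> (\<psi> w) = w"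
  unfolding \<phi>_eq ext_inverse_def by (rule the_inv_into_f_f[OF psi_inj]) (simp add: ext_disk_def)

lemma psi_cont: "\<rho>h < s \<Longrightarrow> continuous_on {w. s \<le> cmod w} \<psi>"
  by (rule holomorphic_on_imp_continuous_on, rule holomorphic_on_subset[OF psi_holo])
     (auto simp: ext_disk_def)

text \<open>\<open>\<psi>\<close> is proper at infinity: near a given point only its values on a
  compact annulus matter, and a compact image is closed.\<close>

lemma closed_psi_image:
  assumes s: "\<rho>h < s"
  shows "closed (\<psi> ` {w. s \<le> cmod w})"
  unfolding closed_def open_contains_ball
proof
  fix z assume z: "z \<in> - \<psi> ` {w. s \<le> cmod w}"
  obtain B where B: "\<And>w. B \<le> cmod w \<Longrightarrow> cmod z + 1 \<le> cmod (\<psi> w)"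
    using psi_infinity[unfolded filterlim_at_infinity_conv_norm_at_top filterlim_at_top, rule_format, of "cmod z + 1"]
    by (auto simp: eventually_at_infinity)
  define K where "K = \<psi> ` {w. s \<le> cmod w \<and> cmod w \<le> B}"
  have "compact {w::complex. s \<le> cmod w \<and> cmod w \<le> B}"
  proof -
    have "{w::complex. s \<le> cmod w \<and> cmod w \<le> B} = cball 0 B - ball 0 s" by auto
    then show ?thesis by (simp add: compact_diff)
  qed
  then have "compact K" unfolding K_def
    by (intro compact_continuous_image continuous_on_subset[OF psi_cont[OF s]]) auto
  moreover have "z \<notin> K" using z by (auto simp: K_def)
  ultimately obtain e where e: "e > 0" "ball z e \<subseteq> - K"
    using compact_imp_closed[of K] by (metis Compl_iff closed_def open_contains_ball)
  have "ball z (min e 1) \<subseteq> - \<psi> ` {w. s \<le> cmod w}"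
  proof (rule, rule)
    fix x assume x: "x \<in> ball z (min e 1)" "x \<in> \<psi> ` {w. s \<le> cmod w}"
    then obtain w where w: "x = \<psi> w" "s \<le> cmod w" by auto
    have "cmod x < cmod z + 1"
      using x(1) norm_triangle_ineq2[of x z] by (auto simp: dist_norm norm_minus_commute)
    then have "\<not> B \<le> cmod w" using B[of w] w by auto
    then have "x \<in> K" using w by (auto simp: K_def)
    then show False using e x by auto
  qed
  then show "\<exists>e>0. ball z e \<subseteq> - \<psi> ` {w. s \<le> cmod w}"
    using e by (intro exI[of _ "min e 1"]) auto
qed

lemma closure_Omega:
  assumes s: "\<rho>h < s"
  shows "closure (Omega \<psi> s) = \<psi> ` {w. s \<le> cmod w}"
proof
  show "closure (Omega \<psi> s) \<subseteq> \<psi> ` {w. s \<le> cmod w}"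
    using closed_psi_image[OF s] by (intro closure_minimal) (auto simp: Omega_def ext_disk_def)
  have "ext_disk s = - cball 0 s" by (auto simp: ext_disk_def)
  then have cl: "closure (ext_disk s) = {w. s \<le> cmod w}"
    using s radius_nonneg by (auto simp: closure_complement)
  have "\<psi> ` closure (ext_disk s) \<subseteq> closure (Omega \<psi> s)"
    by (rule image_closure_subset)
       (use psi_cont[OF s] closure_subset[of "\<psi> ` ext_disk s"] in \<open>auto simp: cl Omega_def\<close>)
  then show "\<psi> ` {w. s \<le> cmod w} \<subseteq> closure (Omega \<psi> s)" by (simp add: cl)
qed

lemma open_Omega: "\<rho>h \<le> s \<Longrightarrow> open (Omega \<psi> s)"
  unfolding Omega_def
  by (rule open_mapping_thm3[OF holomorphic_on_subset[OF psi_holo] open_ext_disk inj_on_subset[OF psi_inj]])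
     (auto simp: ext_disk_def)

lemma psi_in_Omega_iff [simp]: "\<rho>h \<le> s \<Longrightarrow> \<rho>h < cmod w \<Longrightarrow> \<psi> w \<in> Omega \<psi> s \<longleftrightarrow> s < cmod w"
  by (auto simp: Omega_def ext_disk_def psi_inj_iff)

lemma OmegaE:
  assumes "z \<in> Omega \<psi> s" obtains w where "z = \<psi> w" "s < cmod w"
  using assms by (auto simp: Omega_def ext_disk_def)

lemma level_curve_eq:
  assumes s: "\<rho>h < s"
  shows "level_curve \<psi> s = \<psi> ` sphere 0 s"
proof -
  have "level_curve \<psi> s = \<psi> ` {w. s \<le> cmod w} - Omega \<psi> s"
    using s by (simp add: level_curve_def frontier_def closure_Omega interior_open open_Omega)
  also have "\<dots> = \<psi> ` sphere 0 s"
  proof (intro set_eqI iffI)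
    fix z assume "z \<in> \<psi> ` {w. s \<le> cmod w} - Omega \<psi> s"
    then obtain w where w: "z = \<psi> w" "s \<le> cmod w" "\<psi> w \<notin> Omega \<psi> s" by auto
    then show "z \<in> \<psi> ` sphere 0 s" using s by auto
  next
    fix z assume "z \<in> \<psi> ` sphere 0 s"
    then show "z \<in> \<psi> ` {w. s \<le> cmod w} - Omega \<psi> s" using s by auto
  qed
  finally show ?thesis .
qed

lemma G_region_eq: "\<rho>h < s \<Longrightarrow> G_region \<psi> (ereal s) = - \<psi> ` {w. s \<le> cmod w}"
  by (simp add: G_region_def closure_Omega)

lemma open_G_region: "\<rho>h < s \<Longrightarrow> open (G_region \<psi> (ereal s))"
  using closed_psi_image by (simp add: G_region_eq closed_def)

lemma psi_in_G_region_iff [simp]: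
  "\<rho>h < s \<Longrightarrow> \<rho>h < cmod w \<Longrightarrow> \<psi> w \<in> G_region \<psi> (ereal s) \<longleftrightarrow> cmod w < s"
  by (force simp: G_region_eq psi_inj_iff)

lemma not_in_G_regionE:
  assumes "z \<notin> G_region \<psi> (ereal s)" "\<rho>h < s" obtains w where "z = \<psi> w" "s \<le> cmod w"
  using assms by (auto simp: G_region_eq)

lemma G_region_mono: "\<rho>h < s \<Longrightarrow> s \<le> t \<Longrightarrow> G_region \<psi> (ereal s) \<subseteq> G_region \<psi> (ereal t)"
  by (auto simp: G_region_eq)

lemma G_region_subset_maximal: "\<rho>h < s \<Longrightarrow> s * \<rho>h < 1 \<Longrightarrow> G_region \<psi> (ereal s) \<subseteq> G_region \<psi> (1 / ereal \<rho>h)"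
proof (cases "\<rho>h = 0")
  case True then show ?thesis by (simp add: G_region_def)
next
  case False
  assume s: "\<rho>h < s" "s * \<rho>h < 1"
  have "1 / ereal \<rho>h = ereal (1 / \<rho>h)" using False by (simp add: one_ereal_def)
  then show ?thesis using G_region_mono[OF s(1), of "1 / \<rho>h"] s False radius_nonneg
    by (simp add: field_simps)
qed

lemma G_region_one: "G_region \<psi> 1 = - \<psi> ` {w. 1 \<le> cmod w}"
  using G_region_eq[of 1] radius_less_1 by (simp add: one_ereal_def)

section \<open>The curve \<open>L\<close> and neighbourhoods of infinity\<close>

lemma jordan_frontier: "frontier (outside L) = L" "frontier (inside L) = L"
  and compact_L: "compact L"
proof -
  obtain g U where g: "open U" "sphere 0 1 \<subseteq> U" "g holomorphic_on U" "inj_on g U" "L = g ` sphere 0 1"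
    using jordan by (auto simp: analytic_jordan_curve_def)
  have cont: "continuous_on (sphere 0 1) g"
    using g holomorphic_on_imp_continuous_on holomorphic_on_subset by blast
  then show "compact L" unfolding g(5) by (intro compact_continuous_image) auto
  have "simple_path (g \<circ> circlepath 0 1)"
    using cont g inj_on_subset[OF g(4,2)]
    by (intro simple_path_continuous_image) (auto simp: simple_path_circlepath)
  moreover have "path_image (g \<circ> circlepath 0 1) = L" using g(5) by (simp add: path_image_compose)
  moreover have "pathfinish (g \<circ> circlepath 0 1) = pathstart (g \<circ> circlepath 0 1)"
    by (simp add: pathfinish_compose pathstart_compose)
  ultimately show "frontier (outside L) = L" "frontier (inside L) = L"
    using Jordan_inside_outside[of "g \<circ> circlepath 0 1"] by auto
qed

text \<open>\<open>L\<close> comes with an unrelated parametrization; both sets are recognized as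
  the boundary of the same exterior domain, which is where the Jordan curve theorem enters.\<close>

lemma L_eq: "L = \<psi> ` sphere 0 1"
  using level_curve_eq[OF radius_less_1] jordan_frontier by (simp add: level_curve_def Omega_1)

lemma closure_Omega_1: "closure (Omega \<psi> 1) = \<psi> ` {w. 1 \<le> cmod w}"
  by (rule closure_Omega[OF radius_less_1])

text \<open>By the Jordan curve theorem \<open>G_1\<close> is the inside of \<open>L\<close> and has
  all of \<open>L\<close> as its boundary. Consequently the points of \<open>L\<close> fall under
  the first case of \<open>recip_interior_szego\<close>, where it is
  \<open>1 / \<Delta>i\<close>.\<close>

lemma closure_G_region_one: "closure (G_region \<psi> 1) = - Omega \<psi> 1"
proof -
  have "closure (outside L) = outside L \<union> L"
    using jordan_frontier(1) by (metis closure_Un_frontier)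
  with closure_Omega_1[unfolded Omega_1, symmetric]
  have "\<psi> ` {w. 1 \<le> cmod w} = outside L \<union> L" by (rule trans)
  then have "G_region \<psi> 1 = inside L"
    unfolding G_region_one using inside_Un_outside[of L] inside_Int_outside[of L] by blast
  then have "closure (G_region \<psi> 1) = inside L \<union> L"
    using jordan_frontier(2) closure_Un_frontier[of "inside L"] by (simp only:)
  then show ?thesis
    unfolding Omega_1 using union_with_inside[of L] by (simp only: Un_commute)
qed

text \<open>What is missing from \<open>Omega \<psi> s\<close> lies in the bounded complement of
  \<open>outside L\<close> or in the compact image of the annulus between the radii 1 and
  \<open>s\<close>. This lets limits at infinity be computed at points
  \<open>\<psi> w\<close>.\<close>

lemma eventually_in_Omega: "\<rho>h \<le> s \<Longrightarrow> \<forall>\<^sub>F z in at_infinity. z \<in> Omega \<psi> s"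
proof -
  assume s: "\<rho>h \<le> s"
  have "{w::complex. 1 \<le> cmod w \<and> cmod w \<le> s} = cball 0 s - ball 0 1" by auto
  then have "compact {w::complex. 1 \<le> cmod w \<and> cmod w \<le> s}" by (simp add: compact_diff)
  then have "compact (\<psi> ` {w. 1 \<le> cmod w \<and> cmod w \<le> s})"
    using radius_less_1 by (intro compact_continuous_image continuous_on_subset[OF psi_cont[of 1]]) auto
  moreover have "bounded (- outside L)" by (intro cobounded_outside compact_imp_bounded compact_L)
  ultimately have "bounded (- outside L \<union> \<psi> ` {w. 1 \<le> cmod w \<and> cmod w \<le> s})"
    by (auto dest: compact_imp_bounded)
  moreover have "- Omega \<psi> s \<subseteq> - outside L \<union> \<psi> ` {w. 1 \<le> cmod w \<and> cmod w \<le> s}"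
  proof
    fix z assume z: "z \<in> - Omega \<psi> s"
    show "z \<in> - outside L \<union> \<psi> ` {w. 1 \<le> cmod w \<and> cmod w \<le> s}"
    proof (cases "z \<in> outside L")
      case True
      then obtain w where "z = \<psi> w" "1 < cmod w" using Omega_1 OmegaE by metis
      then show ?thesis using z s radius_less_1 by auto
    qed auto
  qed
  ultimately have "bounded (- Omega \<psi> s)" by (rule bounded_subset)
  then obtain B where B: "\<And>z. z \<notin> Omega \<psi> s \<Longrightarrow> cmod z \<le> B" unfolding bounded_iff by auto
  have "z \<in> Omega \<psi> s" if "B + 1 \<le> cmod z" for z
    using B[of z] that by fastforce
  then show ?thesis unfolding eventually_at_infinity by blast
qed

lemma phi_infinity: "filterlim \<phi> at_infinity at_infinity"
  unfolding filterlim_at_infinity_conv_norm_at_top filterlim_at_top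
proof
  fix Z :: real
  have "\<forall>\<^sub>F z in at_infinity. z \<in> Omega \<psi> (max \<rho>h Z)" by (rule eventually_in_Omega) simp
  then show "\<forall>\<^sub>F z in at_infinity. Z \<le> cmod (\<phi> z)"
  proof eventually_elim
    case (elim z)
    then obtain w where "z = \<psi> w" "max \<rho>h Z < cmod w" by (rule OmegaE)
    then show ?case by simp
  qed
qed

lemma psi_has_derivative: "\<rho>h < cmod w \<Longrightarrow> (\<psi> has_field_derivative deriv \<psi> w) (at w)"
  by (rule holomorphic_derivI[OF psi_holo open_ext_disk]) (simp add: ext_disk_def)

lemma deriv_psi_nonzero: "\<rho>h < cmod w \<Longrightarrow> deriv \<psi> w \<noteq> 0"
  by (rule holomorphic_injective_imp_regular[OF psi_holo open_ext_disk psi_inj]) (simp add: ext_disk_def)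

lemma deriv_psi_holo: "deriv \<psi> holomorphic_on ext_disk \<rho>h"
  by (rule holomorphic_deriv[OF psi_holo open_ext_disk])

lemma phi_has_derivative:
  assumes "\<rho>h < cmod w" shows "(\<phi> has_field_derivative 1 / deriv \<psi> w) (at (\<psi> w))"
  using has_field_derivative_inverse_strong[OF psi_has_derivative[OF assms] deriv_psi_nonzero[OF assms]
      open_ext_disk _ holomorphic_on_imp_continuous_on[OF psi_holo], of \<phi>] assms
  by (auto simp: ext_disk_def inverse_eq_divide)

lemma phi_holo: "\<phi> holomorphic_on Omega \<psi> \<rho>h"
  by (auto simp: holomorphic_on_open open_Omega elim!: OmegaE intro: phi_has_derivative)

lemma deriv_phi: "\<rho>h < cmod w \<Longrightarrow> deriv \<phi> (\<psi> w) = 1 / deriv \<psi> w"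
  by (rule DERIV_imp_deriv[OF phi_has_derivative])

lemma holo_compose_psi:
  assumes "f holomorphic_on B" "\<And>w. w \<in> A \<Longrightarrow> \<rho>h < cmod w \<and> \<psi> w \<in> B"
  shows "(\<lambda>w. f (\<psi> w)) holomorphic_on A"
  using holomorphic_on_compose_gen[OF holomorphic_on_subset[OF psi_holo, of A] assms(1)] assms(2)
  by (auto simp: o_def ext_disk_def image_subset_iff)

lemma schwarz_reflection_psi: "\<rho>h < cmod w \<Longrightarrow> schwarz_reflection \<psi> \<phi> (\<psi> w) = \<psi> (1 / cnj w)"
  by (simp add: schwarz_reflection_def)

end

subsection \<open>Szego functions and the interior map\<close>

locale szego_setting = exterior_domain L \<psi> \<phi> \<rho>h
  for L :: "complex set" and \<psi> \<phi> :: "complex \<Rightarrow> complex" and \<rho>h :: real +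
  fixes h S \<Delta>e \<Delta>i \<kappa> q :: "complex \<Rightarrow> complex" and \<rho> r :: real and n :: nat
  assumes S: "sqrt_branch (Omega \<psi> \<rho>h) (deriv \<phi>) S"
    and S_inf: "positive_at_infinity S"
    and ext_szego: "exterior_szego L \<psi> h \<Delta>e"
    and \<rho>: "least_analyticity_radius \<psi> \<rho>h \<Delta>e \<rho>"
    and int_szego: "interior_szego L \<psi> h \<Delta>i"
    and \<kappa>: "interior_map \<psi> \<rho>h \<phi> \<kappa>"
    and q: "sqrt_branch (G_region \<psi> (1 / ereal \<rho>h)) (deriv \<kappa>) q"
    and r: "\<rho> < r" "r < 1"
begin

abbreviation R :: "complex \<Rightarrow> complex" where
  "R \<equiv> recip_interior_szego \<psi> \<phi> \<Delta>e \<Delta>i"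

text \<open>The data are used outside radius \<open>\<rho>0\<close> only, and inside \<open>1/\<rho>0\<close> after reflection; unlike \<open>\<rho>\<close>, the radius \<open>\<rho>0\<close> is
  never zero, so that \<open>1/\<rho>0\<close> is not a junk value.\<close>

definition \<rho>0 :: real where "\<rho>0 = (\<rho> + r) / 2"

definition M :: "complex \<Rightarrow> complex" where "M w = \<kappa> (\<psi> w)"

text \<open>The densities of the two integral transforms, pulled back to circles. In the odd one the kernel
  \<open>W\<close> is left as \<open>q(z) / (M(w) - \<kappa>(z))\<close>.\<close>

definition odd_density :: "complex \<Rightarrow> complex" where
  "odd_density w = \<Delta>e (\<psi> w) * \<Delta>i (\<psi> w) * S (\<psi> w) * q (\<psi> w) * w ^ n * deriv \<psi> w"

definition even_density :: "complex \<Rightarrow> complex" where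
  "even_density w = S (\<psi> w) * R (\<psi> w) * deriv \<psi> w / (w ^ n * \<Delta>e (\<psi> w))"

text \<open>The function \<open>e\<close> of the overview; off \<open>L\<close> it is the leading
  factor of the outer formula.\<close>

definition lead :: "complex \<Rightarrow> complex" where "lead z = \<Delta>e z * S z * \<phi> z ^ n"

lemma rho0: "0 < \<rho>0" "\<rho>h < \<rho>0" "\<rho> < \<rho>0" "\<rho>0 < r" "0 < r" "\<rho>h < r" "\<rho>0 < 1" "\<rho>h \<le> \<rho>"
  using r \<rho> radius_nonneg by (auto simp: \<rho>0_def least_analyticity_radius_def)

lemma radii: "1 < 1 / r" "1 / r < 1 / \<rho>0" "r * \<rho>0 < 1" "0 < 1 / r" "1 < 1 / \<rho>0" "\<rho>h < 1 / r" "\<rho>h < 1 / \<rho>0"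
proof -
  have "r * \<rho>0 < 1 * 1" using rho0 r by (intro mult_strict_mono) auto
  then show "r * \<rho>0 < 1" by simp
  show "1 < 1 / r" "0 < 1 / r" "1 / r < 1 / \<rho>0" "1 < 1 / \<rho>0"
    using rho0 r by (auto simp: field_simps)
  then show "\<rho>h < 1 / r" "\<rho>h < 1 / \<rho>0" using radius_less_1 by linarith+
qed

lemma le_one_less_inv: "x \<le> 1 \<Longrightarrow> x < 1 / \<rho>0"
  using radii(5) by linarith

lemma deriv_phi_eq: "\<rho>h < cmod w \<Longrightarrow> (S (\<psi> w))\<^sup>2 = 1 / deriv \<psi> w"
  using S by (simp add: sqrt_branch_def deriv_phi radius_nonneg)

lemma S_sq: "\<rho>h < cmod w \<Longrightarrow> (S (\<psi> w))\<^sup>2 * deriv \<psi> w = 1"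
  using deriv_psi_nonzero[of w] by (simp add: deriv_phi_eq)

lemma S_nonzero: "\<rho>h < cmod w \<Longrightarrow> S (\<psi> w) \<noteq> 0"
  using S_sq[of w] by auto

lemma S_holo: "S holomorphic_on Omega \<psi> \<rho>h"
  using S by (simp add: sqrt_branch_def)

lemma Omega_mono: "s \<le> t \<Longrightarrow> Omega \<psi> t \<subseteq> Omega \<psi> s"
  by (auto simp: Omega_def ext_disk_def)

lemma Delta_e_holo: "\<Delta>e holomorphic_on Omega \<psi> \<rho>0"
  using \<rho> rho0 Omega_mono[of \<rho> \<rho>0] holomorphic_on_subset by (auto simp: least_analyticity_radius_def)

lemma Delta_e_nonzero: "1 \<le> cmod w \<Longrightarrow> \<Delta>e (\<psi> w) \<noteq> 0"
  using ext_szego by (auto simp: exterior_szego_def closure_Omega_1)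

lemma h_eq_e: "cmod w = 1 \<Longrightarrow> h (\<psi> w) = of_real (1 / (cmod (\<Delta>e (\<psi> w)))\<^sup>2)"
  using ext_szego by (auto simp: exterior_szego_def L_eq)

lemma h_eq_i: "cmod w = 1 \<Longrightarrow> h (\<psi> w) = of_real ((cmod (\<Delta>i (\<psi> w)))\<^sup>2)"
  using int_szego by (auto simp: interior_szego_def L_eq)

lemma Delta_i_nbhd:
  obtains U where "open U" "- Omega \<psi> 1 \<subseteq> U" "\<Delta>i holomorphic_on U"
  using int_szego by (auto simp: interior_szego_def closure_G_region_one analytic_on_holomorphic)

lemma Delta_i_nonzero: "z \<notin> Omega \<psi> 1 \<Longrightarrow> \<Delta>i z \<noteq> 0"
  using int_szego by (auto simp: interior_szego_def closure_G_region_one)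

lemma Delta_i_holo: "\<Delta>i holomorphic_on G_region \<psi> 1"
proof -
  obtain U where "- Omega \<psi> 1 \<subseteq> U" "\<Delta>i holomorphic_on U" by (rule Delta_i_nbhd)
  moreover have "G_region \<psi> 1 \<subseteq> - Omega \<psi> 1" using closure_subset closure_G_region_one by blast
  ultimately show ?thesis using holomorphic_on_subset by blast
qed

section \<open>The interior map and its boundary values\<close>

lemma subset_maximal_region: "G_region \<psi> (ereal (1 / \<rho>0)) \<subseteq> G_region \<psi> (1 / ereal \<rho>h)"
  using rho0 radii by (intro G_region_subset_maximal) (auto simp: field_simps)

lemma kappa_holo: "\<kappa> holomorphic_on G_region \<psi> (ereal (1 / \<rho>0))"
  and kappa_inj: "inj_on \<kappa> (G_region \<psi> (ereal (1 / \<rho>0)))"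
  using \<kappa> holomorphic_on_subset[OF _ subset_maximal_region] inj_on_subset[OF _ subset_maximal_region]
  unfolding interior_map_def by blast+

lemma q_holo: "q holomorphic_on G_region \<psi> (ereal (1 / \<rho>0))"
  and q_sq: "z \<in> G_region \<psi> (ereal (1 / \<rho>0)) \<Longrightarrow> (q z)\<^sup>2 = deriv \<kappa> z"
  using q holomorphic_on_subset[OF _ subset_maximal_region] subset_maximal_region
  unfolding sqrt_branch_def by blast+

lemma open_max_region: "open (G_region \<psi> (ereal (1 / \<rho>0)))"
  using open_G_region radii by blast

lemma q_nonzero: "z \<in> G_region \<psi> (ereal (1 / \<rho>0)) \<Longrightarrow> q z \<noteq> 0"
  using q_sq[of z] holomorphic_injective_imp_regular[OF kappa_holo open_max_region kappa_inj, of z] by auto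

lemma psi_in_max_region: "\<rho>h < cmod w \<Longrightarrow> cmod w < 1 / \<rho>0 \<Longrightarrow> \<psi> w \<in> G_region \<psi> (ereal (1 / \<rho>0))"
  using radii by simp

lemma M_holo: "M holomorphic_on {w. \<rho>0 < cmod w \<and> cmod w < 1 / \<rho>0}"
  unfolding M_def[abs_def] using rho0 by (intro holo_compose_psi[OF kappa_holo]) (auto intro!: psi_in_max_region)

lemma M_inj: "inj_on M {w. \<rho>0 < cmod w \<and> cmod w < 1 / \<rho>0}"
proof (rule inj_onI)
  fix v w assume *: "v \<in> {w. \<rho>0 < cmod w \<and> cmod w < 1 / \<rho>0}" "w \<in> {w. \<rho>0 < cmod w \<and> cmod w < 1 / \<rho>0}" "M v = M w"
  then have "\<psi> v = \<psi> w"
    using rho0 inj_onD[OF kappa_inj, of "\<psi> v" "\<psi> w"] psi_in_max_region[of v] psi_in_max_region[of w]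
    by (simp add: M_def)
  then show "v = w" using * psi_inj_iff[of v w] rho0 by auto
qed

lemma M_has_derivative:
  assumes "\<rho>h < cmod w" "cmod w < 1 / \<rho>0"
  shows "(M has_field_derivative (q (\<psi> w))\<^sup>2 * deriv \<psi> w) (at w)"
proof -
  have "(\<kappa> has_field_derivative (q (\<psi> w))\<^sup>2) (at (\<psi> w))"
    using holomorphic_derivI[OF kappa_holo open_max_region psi_in_max_region[OF assms]]
      q_sq[OF psi_in_max_region[OF assms]] by simp
  from DERIV_chain2[OF this psi_has_derivative[OF assms(1)]] show ?thesis by (simp add: M_def[abs_def])
qed

lemma kappa_ball: "\<kappa> ` G_region \<psi> 1 = ball 0 1"
  using \<kappa> by (simp add: interior_map_def)

lemma G_one_subset: "G_region \<psi> 1 \<subseteq> G_region \<psi> (ereal (1 / \<rho>0))"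
  using G_region_mono[of 1 "1 / \<rho>0"] radius_less_1 radii by (simp add: one_ereal_def)

lemma closure_G_one_subset: "- Omega \<psi> 1 \<subseteq> G_region \<psi> (ereal (1 / \<rho>0))"
proof
  fix z assume z: "z \<in> - Omega \<psi> 1"
  show "z \<in> G_region \<psi> (ereal (1 / \<rho>0))"
  proof (rule ccontr)
    assume "z \<notin> G_region \<psi> (ereal (1 / \<rho>0))"
    then obtain w where "z = \<psi> w" "1 / \<rho>0 \<le> cmod w" by (rule not_in_G_regionE[OF _ radii(7)])
    then show False using z radii radius_less_1 by auto
  qed
qed

lemma norm_kappa_closure: "z \<notin> Omega \<psi> 1 \<Longrightarrow> cmod (\<kappa> z) \<le> 1"
proof -
  assume z: "z \<notin> Omega \<psi> 1"
  have "\<kappa> ` closure (G_region \<psi> 1) \<subseteq> cball 0 1"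
  proof (rule image_closure_subset)
    show "continuous_on (closure (G_region \<psi> 1)) \<kappa>"
      using closure_G_one_subset unfolding closure_G_region_one
      by (intro holomorphic_on_imp_continuous_on holomorphic_on_subset[OF kappa_holo])
    show "\<kappa> ` G_region \<psi> 1 \<subseteq> cball 0 1" using kappa_ball by auto
  qed auto
  then show ?thesis using z closure_G_region_one by auto
qed

lemma G_one_iff [simp]: "\<rho>h < cmod w \<Longrightarrow> \<psi> w \<in> G_region \<psi> 1 \<longleftrightarrow> cmod w < 1"
  using psi_in_G_region_iff[of 1 w] radius_less_1 by (simp add: one_ereal_def)

text \<open>At most 1 by continuity from inside. A value of modulus less than 1 is already taken by
  \<open>\<kappa>\<close> in \<open>G_1\<close>, and the continued \<open>\<kappa>\<close> is
  injective.\<close>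

lemma norm_M_circle: assumes w: "cmod w = 1" shows "cmod (M w) = 1"
proof -
  have w': "\<rho>h < cmod w" "cmod w < 1 / \<rho>0" using w radius_less_1 le_one_less_inv[of "cmod w"] by auto
  have "\<psi> w \<notin> Omega \<psi> 1" using w radius_less_1 by simp
  then have "cmod (M w) \<le> 1" using norm_kappa_closure by (simp add: M_def)
  moreover have "\<not> cmod (M w) < 1"
  proof
    assume "cmod (M w) < 1"
    then have "M w \<in> \<kappa> ` G_region \<psi> 1" using kappa_ball by simp
    then obtain z where z: "z \<in> G_region \<psi> 1" "\<kappa> (\<psi> w) = \<kappa> z" by (auto simp: M_def)
    then have "\<psi> w = z"
      using inj_onD[OF kappa_inj z(2)] psi_in_max_region[OF w'] G_one_subset by auto
    then have "\<psi> w \<in> G_region \<psi> 1" using z(1) by simp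
    then show False using w G_one_iff[OF w'(1)] by simp
  qed
  ultimately show ?thesis by simp
qed

lemma odd_density_holo: "odd_density holomorphic_on {w. \<rho>0 < cmod w \<and> cmod w < 1}"
proof -
  let ?A = "{w. \<rho>0 < cmod w \<and> cmod w < 1}"
  have "(\<lambda>w. \<Delta>e (\<psi> w)) holomorphic_on ?A" "(\<lambda>w. \<Delta>i (\<psi> w)) holomorphic_on ?A"
       "(\<lambda>w. S (\<psi> w)) holomorphic_on ?A" "(\<lambda>w. q (\<psi> w)) holomorphic_on ?A"
    using rho0 radii le_one_less_inv
    by (auto intro!: holo_compose_psi[OF Delta_e_holo] holo_compose_psi[OF Delta_i_holo]
          holo_compose_psi[OF S_holo] holo_compose_psi[OF q_holo] psi_in_max_region)
  moreover have "deriv \<psi> holomorphic_on ?A"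
    using rho0 by (intro holomorphic_on_subset[OF deriv_psi_holo]) (auto simp: ext_disk_def)
  ultimately show ?thesis
    unfolding odd_density_def[abs_def] by (intro holomorphic_on_mult holomorphic_on_power holomorphic_on_ident)
qed

section \<open>Analytic continuation of \<open>1 / \<Delta>i\<close> across \<open>L\<close>\<close>

lemma R_interior: "z \<notin> Omega \<psi> 1 \<Longrightarrow> R z = 1 / \<Delta>i z"
  by (simp add: recip_interior_szego_def closure_G_region_one)

text \<open>The exterior case of \<open>R\<close> in the coordinate \<open>w\<close>, but not
  restricted to \<open>|w| > 1\<close>: near the circle its values on the inner side are compared
  with \<open>1 / \<Delta>i\<close>.\<close>

definition reflected_recip :: "complex \<Rightarrow> complex" where
  "reflected_recip w = \<Delta>e (\<psi> w) * cnj (\<Delta>e (\<psi> (1 / cnj w))) * cnj (\<Delta>i (\<psi> (1 / cnj w)))"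

lemma R_exterior: "1 < cmod w \<Longrightarrow> R (\<psi> w) = reflected_recip w"
  using radius_less_1
  by (simp add: recip_interior_szego_def reflected_recip_def closure_G_region_one schwarz_reflection_psi)

lemma norm_reflected: "w \<noteq> 0 \<Longrightarrow> cmod (1 / cnj w) = 1 / cmod w"
  by (simp add: norm_divide)

text \<open>Near \<open>L\<^sub>1\<close> the two branches of \<open>R\<close> agree by the identity theorem: the product of the reflected
  branch with \<open>\<Delta>\<^sub>i\<close> equals \<open>1\<close> on \<open>L\<^sub>1\<close>.\<close>

lemma R_near_boundary:
  assumes w0: "1 \<le> cmod w0" "cmod w0 < 1 / \<rho>0"
  shows "\<exists>N. open N \<and> w0 \<in> N \<and> N \<subseteq> {w. \<rho>0 < cmod w \<and> cmod w < 1 / \<rho>0} \<and>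
             reflected_recip holomorphic_on N \<and> (\<forall>w\<in>N. R (\<psi> w) = reflected_recip w)"
proof -
  let ?A = "{w. \<rho>0 < cmod w \<and> cmod w < 1 / \<rho>0}"
  obtain U where U: "open U" "- Omega \<psi> 1 \<subseteq> U" "\<Delta>i holomorphic_on U" by (rule Delta_i_nbhd)
  define T where "T = ?A \<inter> \<psi> -` U"
  have psiA: "\<psi> holomorphic_on ?A"
    using rho0 by (intro holomorphic_on_subset[OF psi_holo]) (auto simp: ext_disk_def)
  have T: "open T"
    unfolding T_def by (rule continuous_open_preimage[OF holomorphic_on_imp_continuous_on[OF psiA] open_annulus U(1)])
  have inT: "w \<in> T" if "\<rho>0 < cmod w" "cmod w \<le> 1" for w
    using that U(2) rho0 radius_less_1 le_one_less_inv[of "cmod w"] by (auto simp: T_def)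
  \<comment> \<open>The points whose reflection lands where \<open>\<Delta>i\<close> is holomorphic.
    Besides the outer half of the annulus, \<open>V\<close> contains a neighbourhood of the circle,
    since \<open>\<Delta>i\<close> is analytic slightly beyond \<open>L\<close>.\<close>
  define V where "V = ?A \<inter> (\<lambda>w. 1 / cnj w) -` T"
  have V: "open V"
    unfolding V_def using rho0 by (intro continuous_open_preimage open_annulus T continuous_intros) auto
  have Vout: "w \<in> V" if "1 \<le> cmod w" "cmod w < 1 / \<rho>0" for w
  proof -
    have "w \<noteq> 0" using that by auto
    then have "1 / cnj w \<in> T" using that rho0 by (intro inT) (auto simp: norm_reflected field_simps)
    then show ?thesis using that rho0 by (auto simp: V_def)
  qed
  have AV: "w \<in> V \<Longrightarrow> w \<in> ?A" for w by (auto simp: V_def)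
  have De: "(\<lambda>w. \<Delta>e (\<psi> w)) holomorphic_on ?A"
    using rho0 by (intro holo_compose_psi[OF Delta_e_holo]) auto
  have Di: "(\<lambda>w. \<Delta>i (\<psi> w)) holomorphic_on T"
    using rho0 by (intro holo_compose_psi[OF U(3)]) (auto simp: T_def)
  have VT: "w \<noteq> 0 \<and> 1 / cnj w \<in> T" if "w \<in> V" for w using that rho0 by (auto simp: V_def)
  have VA: "w \<noteq> 0 \<and> 1 / cnj w \<in> ?A" if "w \<in> V" for w using VT[OF that] by (auto simp: T_def)
  have refl: "reflected_recip holomorphic_on V"
    unfolding reflected_recip_def[abs_def]
    using holomorphic_on_circle_reflection[OF De VA open_annulus] holomorphic_on_circle_reflection[OF Di VT T]
      holomorphic_on_subset[OF De, of V] AV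
    by (intro holomorphic_intros) auto
  show ?thesis
  proof (cases "cmod w0 = 1")
    case False
    define N where "N = V \<inter> {w. 1 < cmod w \<and> cmod w < 1 / \<rho>0}"
    have "open N" "w0 \<in> N" "N \<subseteq> ?A" "reflected_recip holomorphic_on N"
      unfolding N_def using False w0 Vout AV holomorphic_on_subset[OF refl]
      by (auto intro!: open_Int V open_annulus)
    then show ?thesis using R_exterior by (intro exI[of _ N]) (auto simp: N_def)
  next
    case True
    have "w0 \<in> V \<inter> T" using Vout inT True rho0 w0 by auto
    then obtain d where d: "d > 0" "ball w0 d \<subseteq> V \<inter> T"
      using open_Int[OF V T] open_contains_ball by blast
    define X where "X w = reflected_recip w * \<Delta>i (\<psi> w) - 1" for w
    have X1: "X w = 0" if w: "cmod w = 1" for w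
    proof -
      have "w * cnj w = 1" using complex_norm_square[of w] w by simp
      moreover have "cnj w \<noteq> 0" using w by auto
      ultimately have "1 / cnj w = w" by (simp add: divide_eq_eq)
      then have "reflected_recip w * \<Delta>i (\<psi> w) =
          (\<Delta>e (\<psi> w) * cnj (\<Delta>e (\<psi> w))) * (\<Delta>i (\<psi> w) * cnj (\<Delta>i (\<psi> w)))"
        by (simp add: reflected_recip_def)
      also have "\<dots> = of_real ((cmod (\<Delta>e (\<psi> w)))\<^sup>2) * h (\<psi> w)"
        by (simp only: complex_norm_square[symmetric] h_eq_i[OF w])
      also have "\<dots> = 1" using Delta_e_nonzero[of w] w by (simp add: h_eq_e[OF w])
      finally show ?thesis by (simp add: X_def)
    qed
    have X0: "X w = 0" if "w \<in> ball w0 d" for w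
    proof (rule analytic_continuation[where f = X and S = "ball w0 d" and U = "ball w0 d \<inter> sphere 0 1" and \<xi> = w0])
      show "X holomorphic_on ball w0 d"
        unfolding X_def[abs_def] using d
        by (intro holomorphic_intros holomorphic_on_subset[OF refl] holomorphic_on_subset[OF Di]) auto
      \<comment> \<open>The circle is connected and has more than one point, so each of its points
        is a limit of others.\<close>
      have "w0 islimpt sphere (0::complex) 1"
      proof (rule connected_imp_perfect)
        show "connected (sphere (0::complex) 1)" by (rule connected_sphere) simp
        show "sphere (0::complex) 1 \<noteq> {x}" for x
        proof
          assume *: "sphere (0::complex) 1 = {x}"
          have "1 \<in> sphere (0::complex) 1" "-1 \<in> sphere (0::complex) 1" by auto
          then show False unfolding * by auto
        qed
      qed (use True in auto)
      then show "w0 islimpt ball w0 d \<inter> sphere 0 1"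
        unfolding islimpt_approachable
      proof (intro allI impI)
        fix e :: real assume *: "\<forall>e>0. \<exists>x'\<in>sphere 0 1. x' \<noteq> w0 \<and> dist x' w0 < e" and "0 < e"
        then obtain x where "x \<in> sphere 0 1" "x \<noteq> w0" "dist x w0 < min e d"
          using d(1) by (metis min_less_iff_conj)
        then show "\<exists>x'\<in>ball w0 d \<inter> sphere 0 1. x' \<noteq> w0 \<and> dist x' w0 < e"
          by (intro bexI[of _ x]) (auto simp: dist_commute)
      qed
    qed (use that d X1 in auto)
    have "R (\<psi> w) = reflected_recip w" if w: "w \<in> ball w0 d" for w
    proof (cases "1 < cmod w")
      case True then show ?thesis by (rule R_exterior)
    next
      case False
      have "w \<in> ?A" using w d AV by auto
      then have "\<psi> w \<notin> Omega \<psi> 1" using False rho0 radius_less_1 by simp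
      then show ?thesis using X0[OF w] Delta_i_nonzero[of "\<psi> w"] by (simp add: R_interior X_def field_simps)
    qed
    then show ?thesis using d AV holomorphic_on_subset[OF refl, of "ball w0 d"]
      by (intro exI[of _ "ball w0 d"]) auto
  qed
qed

text \<open>In \<open>G_1\<close> this is \<open>1 / \<Delta>i\<close>. Every other point is
  \<open>\<psi> w0\<close> with \<open>1 \<le> |w0|\<close>, and near it \<open>R\<close> is
  \<open>reflected_recip\<close> carried over by \<open>\<phi>\<close>; the points of
  \<open>L\<close> are included there.\<close>

lemma R_holo: "R holomorphic_on G_region \<psi> (ereal (1 / \<rho>0))"
proof -
  have "R field_differentiable at z" if z: "z \<in> G_region \<psi> (ereal (1 / \<rho>0))" for z
  proof (cases "z \<in> G_region \<psi> 1")
    case True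
    have op: "open (G_region \<psi> 1)" using open_G_region[of 1] radius_less_1 by (simp add: one_ereal_def)
    have sub: "G_region \<psi> 1 \<subseteq> - Omega \<psi> 1" using closure_subset closure_G_region_one by blast
    have "(\<lambda>z. 1 / \<Delta>i z) holomorphic_on G_region \<psi> 1"
      using Delta_i_nonzero sub by (intro holomorphic_intros Delta_i_holo) auto
    then have "R holomorphic_on G_region \<psi> 1"
      by (rule holomorphic_transform) (use R_interior sub in auto)
    then show ?thesis using True op holomorphic_on_imp_differentiable_at by blast
  next
    case False
    then obtain w0 where w0: "z = \<psi> w0" "1 \<le> cmod w0"
      by (auto simp: G_region_one)
    have "cmod w0 < 1 / \<rho>0" using z radii(7) radius_less_1 w0 by simp
    from R_near_boundary[OF w0(2) this] obtain N where N: "open N" "w0 \<in> N" "N \<subseteq> {w. \<rho>0 < cmod w \<and> cmod w < 1 / \<rho>0}"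
        "reflected_recip holomorphic_on N" "\<And>w. w \<in> N \<Longrightarrow> R (\<psi> w) = reflected_recip w"
      by blast
    have sub: "N \<subseteq> ext_disk \<rho>h" using N(3) rho0 by (auto simp: ext_disk_def)
    have "open (\<psi> ` N)"
      using open_mapping_thm3[OF holomorphic_on_subset[OF psi_holo sub] N(1) inj_on_subset[OF psi_inj sub]] .
    moreover have "R holomorphic_on \<psi> ` N"
    proof (rule holomorphic_transform)
      have "(reflected_recip \<circ> \<phi>) holomorphic_on \<psi> ` N"
        using sub by (intro holomorphic_on_compose_gen[OF holomorphic_on_subset[OF phi_holo] N(4)])
          (auto simp: ext_disk_def subset_iff)
      then show "(\<lambda>z. reflected_recip (\<phi> z)) holomorphic_on \<psi> ` N" by (simp add: o_def)
    qed (use N(5) sub in \<open>auto simp: ext_disk_def subset_iff\<close>)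
    ultimately show ?thesis using w0 N(2) holomorphic_on_imp_differentiable_at by blast
  qed
  then show ?thesis by (simp add: holomorphic_on_def field_differentiable_at_within)
qed

lemma even_density_holo: "even_density holomorphic_on {w. 1 < cmod w \<and> cmod w < 1 / \<rho>0}"
proof -
  let ?A = "{w. 1 < cmod w \<and> cmod w < 1 / \<rho>0}"
  have "(\<lambda>w. \<Delta>e (\<psi> w)) holomorphic_on ?A"
       "(\<lambda>w. S (\<psi> w)) holomorphic_on ?A" "(\<lambda>w. R (\<psi> w)) holomorphic_on ?A"
    using rho0 radii
    by (auto intro!: holo_compose_psi[OF Delta_e_holo] holo_compose_psi[OF R_holo]
          holo_compose_psi[OF S_holo] psi_in_max_region)
  moreover have "deriv \<psi> holomorphic_on ?A"
    using rho0 by (intro holomorphic_on_subset[OF deriv_psi_holo]) (auto simp: ext_disk_def)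
  ultimately show ?thesis
    unfolding even_density_def[abs_def] using Delta_e_nonzero
    by (intro holomorphic_on_mult holomorphic_on_divide holomorphic_on_power holomorphic_on_ident) auto
qed

subsection \<open>Estimates for the transforms\<close>

abbreviation "f \<equiv> f_transform \<psi> \<phi> S \<Delta>e \<Delta>i R (kernel_W \<kappa> q) r n"

lemma sphere_ext_disk: "\<rho>h < s \<Longrightarrow> sphere 0 s \<subseteq> ext_disk \<rho>h"
  by (auto simp: ext_disk_def)

lemma level_path_integral:
  "\<rho>h < s \<Longrightarrow> 0 < s \<Longrightarrow> contour_integral (level_path \<psi> s) g =
     contour_integral (circlepath 0 s) (\<lambda>w. g (\<psi> w) * deriv \<psi> w)"
  by (rule contour_integral_level_path[OF psi_holo open_ext_disk sphere_ext_disk])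

text \<open>The factor \<open>q z\<close> of the kernel does not depend on the integration variable
  and leaves the integral; the other \<open>q\<close> is part of \<open>odd_density\<close>.\<close>

lemma f_odd:
  "f (2 * k + 1) z = - q z * cauchy_transform r (\<lambda>w. f (2 * k) (\<psi> w) * odd_density w) M (\<kappa> z)"
proof -
  define c where "c = - (1 / (2 * complex_of_real pi * \<i>))"
  have "f (2 * k + 1) z = c * contour_integral (level_path \<psi> r)
      (\<lambda>\<zeta>. f (2 * k) \<zeta> * \<Delta>e \<zeta> * \<Delta>i \<zeta> * kernel_W \<kappa> q \<zeta> z * S \<zeta> * \<phi> \<zeta> ^ n)"
    by (simp add: c_def)
  also have "\<dots> = c * contour_integral (circlepath 0 r)
      (\<lambda>w. q z * (f (2 * k) (\<psi> w) * odd_density w / (M w - \<kappa> z)))"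
    unfolding level_path_integral[OF rho0(6,5)]
    by (intro arg_cong[where f = "\<lambda>x. c * x"] contour_integral_circlepath_cong rho0(5))
       (use rho0 in \<open>simp add: kernel_W_def odd_density_def M_def\<close>)
  finally show ?thesis
    unfolding contour_integral_cmult by (simp add: cauchy_transform_def c_def)
qed

lemma f_even:
  "f (2 * k + 2) z = cauchy_transform (1 / r) (\<lambda>w. f (2 * k + 1) (\<psi> w) * even_density w) (\<lambda>w. w) (\<phi> z)"
proof -
  define c where "c = 1 / (2 * complex_of_real pi * \<i>)"
  have "f (2 * k + 2) z = c * contour_integral (level_path \<psi> (1 / r))
      (\<lambda>\<zeta>. f (2 * k + 1) \<zeta> * S \<zeta> * \<phi> \<zeta> powi (- int n) * R \<zeta> / (\<Delta>e \<zeta> * (\<phi> \<zeta> - \<phi> z)))"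
    by (simp add: c_def)
  also have "\<dots> = c * contour_integral (circlepath 0 (1 / r))
      (\<lambda>w. f (2 * k + 1) (\<psi> w) * even_density w / (w - \<phi> z))"
    unfolding level_path_integral[OF radii(6,4)]
  proof (intro arg_cong[where f = "\<lambda>x. c * x"] contour_integral_circlepath_cong radii(4))
    fix w :: complex assume "cmod w = 1 / r"
    then have "\<rho>h < cmod w" using radii by simp
    then show "f (2 * k + 1) (\<psi> w) * S (\<psi> w) * \<phi> (\<psi> w) powi (- int n) * R (\<psi> w) /
        (\<Delta>e (\<psi> w) * (\<phi> (\<psi> w) - \<phi> z)) * deriv \<psi> w =
        f (2 * k + 1) (\<psi> w) * even_density w / (w - \<phi> z)"
      unfolding even_density_def
      by (simp only: phi_psi power_int_minus power_int_of_nat divide_inverse inverse_mult_distrib mult_ac)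
  qed
  finally show ?thesis by (simp add: cauchy_transform_def c_def)
qed

lemma f_zero: "f 0 z = 1"
  by simp

text \<open>From here on the transforms are used only through \<open>f_zero\<close>,
  \<open>f_odd\<close> and \<open>f_even\<close>; unfolding would bring back the integrals over
  level curves.\<close>

declare f_transform.simps [simp del]

lemma in_inner_annulus: "cmod w = r \<Longrightarrow> w \<in> {w. \<rho>0 < cmod w \<and> cmod w < 1}"
  and in_outer_annulus: "cmod w = 1 / r \<Longrightarrow> w \<in> {w. 1 < cmod w \<and> cmod w < 1 / \<rho>0}"
  and in_annulus: "cmod w = r \<or> cmod w = 1 / r \<Longrightarrow> w \<in> {w. \<rho>0 < cmod w \<and> cmod w < 1 / \<rho>0}"
proof -
  show "cmod w = r \<Longrightarrow> w \<in> {w. \<rho>0 < cmod w \<and> cmod w < 1}" using rho0 r by simp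
  show "cmod w = 1 / r \<Longrightarrow> w \<in> {w. 1 < cmod w \<and> cmod w < 1 / \<rho>0}" using radii(1,2) by simp
  have "\<rho>0 < r" "r < 1 / \<rho>0" "\<rho>0 < 1 / r" "1 / r < 1 / \<rho>0"
    using rho0(4,7) r radii(1,2) by linarith+
  then show "cmod w = r \<or> cmod w = 1 / r \<Longrightarrow> w \<in> {w. \<rho>0 < cmod w \<and> cmod w < 1 / \<rho>0}"
    by (elim disjE) simp_all
qed

lemma odd_density_cont: "continuous_on (sphere 0 r) odd_density"
  using in_inner_annulus
  by (intro holomorphic_on_imp_continuous_on holomorphic_on_subset[OF odd_density_holo]) auto

lemma even_density_cont: "continuous_on (sphere 0 (1 / r)) even_density"
  using in_outer_annulus
  by (intro holomorphic_on_imp_continuous_on holomorphic_on_subset[OF even_density_holo]) auto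

lemma M_cont:
  assumes "s = r \<or> s = 1 / r"
  shows "continuous_on (sphere 0 s) M"
proof -
  have "sphere 0 s \<subseteq> {w. \<rho>0 < cmod w \<and> cmod w < 1 / \<rho>0}"
    by (rule subsetI, rule in_annulus) (use assms in auto)
  then show ?thesis
    by (intro holomorphic_on_imp_continuous_on holomorphic_on_subset[OF M_holo])
qed

lemma kappa_notin_image:
  assumes "z \<in> G_region \<psi> (ereal (1 / \<rho>0))" "z \<notin> \<psi> ` T" "T \<subseteq> {w. \<rho>0 < cmod w \<and> cmod w < 1 / \<rho>0}"
  shows "\<kappa> z \<notin> M ` T"
proof
  assume "\<kappa> z \<in> M ` T"
  then obtain w where w: "w \<in> T" "\<kappa> z = \<kappa> (\<psi> w)" by (auto simp: M_def)
  then have "\<psi> w \<in> G_region \<psi> (ereal (1 / \<rho>0))" using assms(3) rho0 by (intro psi_in_max_region) auto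
  then have "z = \<psi> w" using inj_onD[OF kappa_inj w(2) assms(1)] by simp
  then show False using w assms(2) by auto
qed

lemma odd_transform_holo:
  assumes "continuous_on (sphere 0 s) m" "\<rho>0 < s" "s < 1 / \<rho>0"
  shows "(\<lambda>z. - q z * cauchy_transform s m M (\<kappa> z)) holomorphic_on
           G_region \<psi> (ereal (1 / \<rho>0)) - \<psi> ` sphere 0 s"
proof -
  let ?B = "G_region \<psi> (ereal (1 / \<rho>0)) - \<psi> ` sphere 0 s"
  have sub: "sphere 0 s \<subseteq> {w. \<rho>0 < cmod w \<and> cmod w < 1 / \<rho>0}" using assms by auto
  have "continuous_on (sphere 0 s) M"
    by (intro holomorphic_on_imp_continuous_on holomorphic_on_subset[OF M_holo sub])
  then have "cauchy_transform s m M holomorphic_on - M ` sphere 0 s"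
    using assms rho0 by (intro holomorphic_on_cauchy_transform) auto
  moreover have "\<kappa> holomorphic_on ?B" by (rule holomorphic_on_subset[OF kappa_holo]) auto
  moreover have "\<kappa> ` ?B \<subseteq> - M ` sphere 0 s" using kappa_notin_image[OF _ _ sub] by auto
  ultimately have "(cauchy_transform s m M \<circ> \<kappa>) holomorphic_on ?B"
    by (metis holomorphic_on_compose_gen)
  moreover have "q holomorphic_on ?B" by (rule holomorphic_on_subset[OF q_holo]) auto
  ultimately show ?thesis by (auto simp: o_def intro!: holomorphic_intros)
qed

section \<open>The constants and the contraction estimate\<close>

lemma bdd_above_level_curve:
  fixes g :: "complex \<Rightarrow> complex"
  assumes "\<rho>h < s" "continuous_on (sphere 0 s) (\<lambda>w. g (\<psi> w))"
  shows "bdd_above ((\<lambda>\<zeta>. cmod (g \<zeta>)) ` level_curve \<psi> s)"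
proof -
  have "compact ((\<lambda>w. cmod (g (\<psi> w))) ` sphere 0 s)"
    by (intro compact_continuous_image continuous_on_norm assms) auto
  then show ?thesis unfolding level_curve_eq[OF assms(1)] image_image
    by (intro bounded_imp_bdd_above compact_imp_bounded)
qed

lemma Delta_e_cont: "\<rho>0 < s \<Longrightarrow> continuous_on (sphere 0 s) (\<lambda>w. \<Delta>e (\<psi> w))"
  using rho0 by (intro holomorphic_on_imp_continuous_on holo_compose_psi[OF Delta_e_holo]) auto

lemma S_cont: "\<rho>h < s \<Longrightarrow> continuous_on (sphere 0 s) (\<lambda>w. S (\<psi> w))"
  by (intro holomorphic_on_imp_continuous_on holo_compose_psi[OF S_holo]) (auto simp: radius_nonneg)

lemma q_cont: "\<rho>h < s \<Longrightarrow> s < 1 / \<rho>0 \<Longrightarrow> continuous_on (sphere 0 s) (\<lambda>w. q (\<psi> w))"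
  by (intro holomorphic_on_imp_continuous_on holo_compose_psi[OF q_holo]) (auto intro!: psi_in_max_region)

text \<open>A supremum dominates its members once the set is bounded above; here, in
  \<open>Lambda'_bound\<close> and in \<open>M_bound\<close> this comes from continuity on compact
  sets.\<close>

lemma Lambda_bound:
  assumes "cmod w = r"
  shows "cmod (\<Delta>e (\<psi> w) * \<Delta>i (\<psi> w) / S (\<psi> w)) \<le> Lambda_const \<psi> S \<Delta>e \<Delta>i r"
proof -
  have "continuous_on (sphere 0 r) (\<lambda>w. \<Delta>i (\<psi> w))"
    using rho0 r by (intro holomorphic_on_imp_continuous_on holo_compose_psi[OF Delta_i_holo]) auto
  then have "continuous_on (sphere 0 r) (\<lambda>w. \<Delta>e (\<psi> w) * \<Delta>i (\<psi> w) / S (\<psi> w))"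
    using rho0 S_nonzero by (intro continuous_intros Delta_e_cont S_cont) auto
  from bdd_above_level_curve[OF rho0(6) this] show ?thesis
    unfolding Lambda_const_def by (rule cSUP_upper[rotated]) (use assms in \<open>simp add: level_curve_eq rho0\<close>)
qed

lemma R_cont: "continuous_on (sphere 0 (1 / r)) (\<lambda>w. R (\<psi> w))"
  using radii(2,6) by (intro holomorphic_on_imp_continuous_on holo_compose_psi[OF R_holo])
     (auto intro!: psi_in_max_region simp del: divide_less_cancel)

lemma Lambda'_bound:
  assumes "cmod w = 1 / r"
  shows "cmod (R (\<psi> w) / (S (\<psi> w) * \<Delta>e (\<psi> w))) \<le> Lambda'_const \<psi> S \<Delta>e R r"
proof -
  have "1 / r > \<rho>0" using radii(1) rho0(7) by linarith
  then have "continuous_on (sphere 0 (1 / r)) (\<lambda>w. R (\<psi> w) / (S (\<psi> w) * \<Delta>e (\<psi> w)))"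
    using radii(1,6) S_nonzero Delta_e_nonzero
    by (intro continuous_intros Delta_e_cont S_cont R_cont) (auto simp del: divide_less_cancel)
  from bdd_above_level_curve[OF radii(6) this] show ?thesis
    unfolding Lambda'_const_def
    by (rule cSUP_upper[rotated]) (use assms radii(6) in \<open>simp add: level_curve_eq\<close>)
qed

lemma M_bound:
  assumes v: "cmod v = r" and w: "cmod w = 1 / r"
  shows "cmod (q (\<psi> w) * q (\<psi> v) / (M v - M w)) \<le> M_const \<psi> (kernel_W \<kappa> q) r"
proof -
  let ?X = "sphere (0::complex) r \<times> sphere (0::complex) (1 / r)"
  let ?g = "\<lambda>p. cmod (q (\<psi> (snd p)) * q (\<psi> (fst p)) / (M (fst p) - M (snd p)))"
  \<comment> \<open>The two circles have different radii and \<open>M\<close> is injective on the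
    annulus, so the kernel has no singularity on the product.\<close>
  have ne: "M (fst p) \<noteq> M (snd p)" if "p \<in> ?X" for p
  proof
    assume "M (fst p) = M (snd p)"
    then have "fst p = snd p" by (rule inj_onD[OF M_inj _ in_annulus in_annulus]) (use that in auto)
    then show False using that r radii(1) by auto
  qed
  have rr: "\<rho>h < r" "r < 1 / \<rho>0" "\<rho>h < 1 / r" "1 / r < 1 / \<rho>0"
    using rho0 radii le_one_less_inv[of r] r by auto
  have fs: "continuous_on ?X fst" "continuous_on ?X snd" by (auto intro: continuous_intros)
  have c1: "continuous_on ?X (\<lambda>p. q (\<psi> (snd p)))"
    by (rule continuous_on_compose2[OF q_cont[OF rr(3,4)] fs(2)]) auto
  have c2: "continuous_on ?X (\<lambda>p. q (\<psi> (fst p)))"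
    by (rule continuous_on_compose2[OF q_cont[OF rr(1,2)] fs(1)]) auto
  have c3: "continuous_on ?X (\<lambda>p. M (fst p))"
    by (rule continuous_on_compose2[OF M_cont[of r] fs(1)]) auto
  have c4: "continuous_on ?X (\<lambda>p. M (snd p))"
    by (rule continuous_on_compose2[OF M_cont[of "1 / r"] fs(2)]) auto
  have "compact (?g ` ?X)"
    using ne by (intro compact_continuous_image continuous_intros c1 c2 c3 c4 compact_Times) auto
  then have bdd: "bdd_above (?g ` ?X)" by (intro bounded_imp_bdd_above compact_imp_bounded)
  have eq: "(\<lambda>(\<zeta>, z). cmod (kernel_W \<kappa> q \<zeta> z)) ` (\<psi> ` sphere 0 r \<times> \<psi> ` sphere 0 (1 / r)) = ?g ` ?X"
  proof -
    have "\<psi> ` sphere 0 r \<times> \<psi> ` sphere 0 (1 / r) = (\<lambda>p. (\<psi> (fst p), \<psi> (snd p))) ` ?X"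
      using image_paired_Times[of \<psi> \<psi> "sphere 0 r" "sphere 0 (1 / r)"] by (simp add: case_prod_unfold)
    then show ?thesis by (simp only: image_image split kernel_W_def M_def)
  qed
  have "?g (v, w) \<le> Sup (?g ` ?X)" using v w by (intro cSUP_upper bdd) auto
  also have "Sup (?g ` ?X) = M_const \<psi> (kernel_W \<kappa> q) r"
    unfolding M_const_def level_curve_eq[OF rr(1)] level_curve_eq[OF rr(3)] eq ..
  finally show ?thesis by simp
qed

text \<open>The left side of the smallness hypothesis: the factor gained on \<open>L_r\<close> by
  one odd step followed by one even step.\<close>

definition ratio :: real where
  "ratio = Lambda_const \<psi> S \<Delta>e \<Delta>i r * Lambda'_const \<psi> S \<Delta>e R r * M_const \<psi> (kernel_W \<kappa> q) r
             * r ^ (2 * n) / (1 / r - r)"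

text \<open>The bound for a single odd step from \<open>L_r\<close> to \<open>L_{1/r}\<close>:
  \<open>r ^ n\<close> is \<open>|\<phi>| ^ n\<close> on \<open>L_r\<close>, and the last
  \<open>r\<close> is the length of the circle divided by \<open>2 \<pi>\<close>.\<close>

definition odd_factor :: real where
  "odd_factor = Lambda_const \<psi> S \<Delta>e \<Delta>i r * M_const \<psi> (kernel_W \<kappa> q) r * r ^ n * r"

lemma const_nonneg:
  "0 \<le> Lambda_const \<psi> S \<Delta>e \<Delta>i r" "0 \<le> Lambda'_const \<psi> S \<Delta>e R r" "0 \<le> M_const \<psi> (kernel_W \<kappa> q) r"
proof -
  have a: "cmod (of_real r) = r" "cmod (of_real (1 / r)) = 1 / r"
    using rho0(5) by (simp_all only: norm_of_real) simp_all
  show "0 \<le> Lambda_const \<psi> S \<Delta>e \<Delta>i r" using order_trans[OF norm_ge_zero Lambda_bound[OF a(1)]] .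
  show "0 \<le> Lambda'_const \<psi> S \<Delta>e R r" using order_trans[OF norm_ge_zero Lambda'_bound[OF a(2)]] .
  show "0 \<le> M_const \<psi> (kernel_W \<kappa> q) r" using order_trans[OF norm_ge_zero M_bound[OF a]] .
qed

lemma ratio_nonneg: "0 \<le> ratio" and odd_factor_nonneg: "0 \<le> odd_factor"
proof -
  have "r < 1 / r" using r radii(1) by linarith
  then show "0 \<le> ratio" "0 \<le> odd_factor"
    unfolding ratio_def odd_factor_def using const_nonneg rho0 by simp_all
qed

text \<open>The transforms contain \<open>S * \<psi>'\<close>, the constant contains
  \<open>1 / S\<close>; these agree because \<open>S^2 * \<psi>' = 1\<close>. The same exchange is
  made for the even density.\<close>

lemma odd_density_norm:
  assumes "cmod v = r"
  shows "cmod (odd_density v) = cmod (\<Delta>e (\<psi> v) * \<Delta>i (\<psi> v) / S (\<psi> v)) * cmod (q (\<psi> v)) * r ^ n"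
proof -
  have v: "\<rho>h < cmod v" using assms rho0 by simp
  have "S (\<psi> v) * deriv \<psi> v = 1 / S (\<psi> v)"
    using S_sq[OF v] S_nonzero[OF v] by (simp add: field_simps power2_eq_square)
  then have "odd_density v = \<Delta>e (\<psi> v) * \<Delta>i (\<psi> v) * (1 / S (\<psi> v)) * q (\<psi> v) * v ^ n"
    unfolding odd_density_def by (metis mult.assoc mult.commute)
  then show ?thesis using assms by (simp add: norm_mult norm_divide norm_power)
qed

lemma even_density_norm:
  assumes "cmod w = 1 / r"
  shows "cmod (even_density w) = cmod (R (\<psi> w) / (S (\<psi> w) * \<Delta>e (\<psi> w))) * r ^ n"
proof -
  have w: "\<rho>h < cmod w" using assms radii by simp
  have "S (\<psi> w) * deriv \<psi> w = 1 / S (\<psi> w)"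
    using S_sq[OF w] S_nonzero[OF w] by (simp add: field_simps power2_eq_square)
  moreover have "even_density w = (S (\<psi> w) * deriv \<psi> w) * R (\<psi> w) / (w ^ n * \<Delta>e (\<psi> w))"
    by (simp only: even_density_def mult_ac)
  ultimately have "even_density w = R (\<psi> w) / (S (\<psi> w) * \<Delta>e (\<psi> w)) / w ^ n"
    by (simp add: mult_ac)
  then have "cmod (even_density w) = cmod (R (\<psi> w) / (S (\<psi> w) * \<Delta>e (\<psi> w))) / (1 / r) ^ n"
    using assms by (simp only: norm_divide norm_power)
  then show ?thesis by (simp add: power_one_over)
qed

lemma f_odd_bound:
  assumes c: "continuous_on (sphere 0 r) (\<lambda>v. f (2 * k) (\<psi> v))"
    and b: "\<And>v. cmod v = r \<Longrightarrow> cmod (f (2 * k) (\<psi> v)) \<le> B" and w: "cmod w = 1 / r"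
  shows "cmod (f (2 * k + 1) (\<psi> w)) \<le> odd_factor * B"
proof -
  let ?L = "Lambda_const \<psi> S \<Delta>e \<Delta>i r" and ?M = "M_const \<psi> (kernel_W \<kappa> q) r"
  have B: "0 \<le> B" using order_trans[OF norm_ge_zero b[of "of_real r"]] rho0 by simp
  have ne: "M w \<notin> M ` sphere 0 r"
  proof
    assume "M w \<in> M ` sphere 0 r"
    then obtain v where v: "cmod v = r" "M w = M v" by auto
    from v(2) have "w = v" by (rule inj_onD[OF M_inj _ in_annulus in_annulus]) (use v w in auto)
    then show False using v w r radii(1) by auto
  qed
  \<comment> \<open>The factor \<open>- q (\<psi> w)\<close> is moved into the density, because
    \<open>M_const\<close> bounds the whole kernel \<open>W\<close> and not
    \<open>1 / (M v - M w)\<close> alone.\<close>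
  have "cmod (cauchy_transform r (\<lambda>v. - q (\<psi> w) * (f (2 * k) (\<psi> v) * odd_density v)) M (M w)) \<le> (B * ?L * ?M * r ^ n) * r"
  proof (rule norm_cauchy_transform_le)
    fix v assume v: "cmod v = r"
    define X where "X = cmod (\<Delta>e (\<psi> v) * \<Delta>i (\<psi> v) / S (\<psi> v))"
    define Y where "Y = cmod (q (\<psi> w) * q (\<psi> v) / (M v - M w))"
    have X: "cmod (odd_density v) = X * cmod (q (\<psi> v)) * r ^ n"
      unfolding X_def by (rule odd_density_norm[OF v])
    have Y: "Y = cmod (q (\<psi> w)) * cmod (q (\<psi> v)) / cmod (M v - M w)"
      by (simp add: Y_def norm_mult norm_divide)
    have "cmod (- q (\<psi> w) * (f (2 * k) (\<psi> v) * odd_density v) / (M v - M w)) =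
        cmod (f (2 * k) (\<psi> v)) * X * Y * r ^ n"
      unfolding Y norm_mult norm_divide norm_minus_cancel X by (simp only: divide_inverse mult_ac)
    also have "\<dots> \<le> B * ?L * ?M * r ^ n"
      unfolding X_def Y_def using B const_nonneg rho0(5)
      by (intro mult_mono b v Lambda_bound M_bound w mult_nonneg_nonneg norm_ge_zero order_refl) simp_all
    finally show "cmod (- q (\<psi> w) * (f (2 * k) (\<psi> v) * odd_density v) / (M v - M w)) \<le> B * ?L * ?M * r ^ n" .
  qed (use rho0 B const_nonneg ne in \<open>auto intro!: continuous_intros c odd_density_cont M_cont\<close>)
  then show ?thesis
    unfolding f_odd cauchy_transform_cmult by (simp add: M_def[symmetric] odd_factor_def mult_ac)
qed

lemma f_even_bound:
  assumes c: "continuous_on (sphere 0 (1 / r)) (\<lambda>w. f (2 * k + 1) (\<psi> w))"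
    and b: "\<And>w. cmod w = 1 / r \<Longrightarrow> cmod (f (2 * k + 1) (\<psi> w)) \<le> odd_factor * B"
    and B: "0 \<le> B" and v: "cmod v = r"
  shows "cmod (f (2 * k + 2) (\<psi> v)) \<le> ratio * B"
proof -
  let ?L = "Lambda'_const \<psi> S \<Delta>e R r"
  have rr: "r < 1 / r" using r radii(1) by linarith
  have cc: "continuous_on (sphere 0 (1 / r)) (\<lambda>w. f (2 * k + 1) (\<psi> w) * even_density w)"
    by (intro continuous_intros c even_density_cont)
  have "cmod (cauchy_transform (1 / r) (\<lambda>w. f (2 * k + 1) (\<psi> w) * even_density w) (\<lambda>w. w) v)
      \<le> (odd_factor * B * (?L * r ^ n) / (1 / r - r)) * (1 / r)"
  proof (rule norm_cauchy_transform_le)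
    fix w assume w: "cmod w = 1 / r"
    have "1 / r - r \<le> cmod (w - v)" using norm_triangle_ineq2[of w v] w v by simp
    moreover have "cmod (f (2 * k + 1) (\<psi> w) * even_density w) \<le> odd_factor * B * (?L * r ^ n)"
      unfolding norm_mult even_density_norm[OF w]
      using B odd_factor_nonneg const_nonneg rho0
      by (intro mult_mono b w Lambda'_bound) (auto intro!: mult_nonneg_nonneg)
    moreover have "0 \<le> odd_factor * B * (?L * r ^ n)" using B odd_factor_nonneg const_nonneg rho0(5) by simp
    ultimately show "cmod (f (2 * k + 1) (\<psi> w) * even_density w / (w - v))
        \<le> odd_factor * B * (?L * r ^ n) / (1 / r - r)"
      unfolding norm_divide using rr by (intro frac_le) simp_all
  next
    show "v \<notin> (\<lambda>w. w) ` sphere 0 (1 / r)" using v rr by auto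
    show "0 \<le> odd_factor * B * (?L * r ^ n) / (1 / r - r)"
      using rr B odd_factor_nonneg const_nonneg rho0 by (intro divide_nonneg_nonneg mult_nonneg_nonneg) auto
  qed (rule radii(4) cc continuous_on_id)+
  \<comment> \<open>The \<open>r\<close> in \<open>odd_factor\<close> cancels the
    \<open>1 / r\<close> from the length of the outer circle, and the two powers
    \<open>r ^ n\<close> combine to \<open>r ^ (2 * n)\<close>.\<close>
  moreover have "(odd_factor * B * (?L * r ^ n) / (1 / r - r)) * (1 / r) = ratio * B"
    using rho0(5) by (simp add: odd_factor_def ratio_def mult_2 power_add)
  moreover have "\<phi> (\<psi> v) = v" using v rho0 by simp
  ultimately show ?thesis unfolding f_even by simp
qed

lemma f_odd_cont:
  assumes "continuous_on (sphere 0 r) (\<lambda>v. f (2 * k) (\<psi> v))"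
  shows "continuous_on (sphere 0 (1 / r)) (\<lambda>w. f (2 * k + 1) (\<psi> w))"
proof -
  have "(\<lambda>z. f (2 * k + 1) z) holomorphic_on G_region \<psi> (ereal (1 / \<rho>0)) - \<psi> ` sphere 0 r"
    unfolding f_odd using rho0 r le_one_less_inv[of r]
    by (intro odd_transform_holo continuous_intros assms odd_density_cont) auto
  then have "(\<lambda>w. f (2 * k + 1) (\<psi> w)) holomorphic_on sphere 0 (1 / r)"
  proof (rule holo_compose_psi)
    fix w :: complex assume "w \<in> sphere 0 (1 / r)"
    then have w: "cmod w = 1 / r" by simp
    have "\<psi> w \<notin> \<psi> ` sphere 0 r" using w radii(1,6) rho0(6) r by (auto simp: psi_inj_iff)
    then show "\<rho>h < cmod w \<and> \<psi> w \<in> G_region \<psi> (ereal (1 / \<rho>0)) - \<psi> ` sphere 0 r"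
      using w radii(2,6) by (auto intro!: psi_in_max_region simp del: divide_less_cancel)
  qed
  then show ?thesis by (rule holomorphic_on_imp_continuous_on)
qed

lemma even_transform_holo:
  assumes "continuous_on (sphere 0 s) m" "0 < s"
  shows "cauchy_transform s m (\<lambda>w. w) holomorphic_on - sphere 0 s"
  using holomorphic_on_cauchy_transform[OF assms(2,1), of "\<lambda>w. w"] by (simp add: continuous_on_id)

lemma f_even_cont:
  assumes "continuous_on (sphere 0 (1 / r)) (\<lambda>w. f (2 * k + 1) (\<psi> w))"
  shows "continuous_on (sphere 0 r) (\<lambda>v. f (2 * k + 2) (\<psi> v))"
proof -
  have "continuous_on (- sphere 0 (1 / r))
      (cauchy_transform (1 / r) (\<lambda>w. f (2 * k + 1) (\<psi> w) * even_density w) (\<lambda>w. w))"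
    using radii(4)
    by (intro holomorphic_on_imp_continuous_on even_transform_holo continuous_intros assms even_density_cont)
  then have "continuous_on (sphere 0 r)
      (cauchy_transform (1 / r) (\<lambda>w. f (2 * k + 1) (\<psi> w) * even_density w) (\<lambda>w. w))"
    by (rule continuous_on_subset) (use r radii(1) in auto)
  then show ?thesis unfolding f_even
    by (rule continuous_on_eq) (use rho0 in auto)
qed

text \<open>The induction goes around a cycle of two contours: data on \<open>L_r\<close> give data
  on \<open>L_{1/r}\<close>, and these give data on \<open>L_r\<close> with one more factor
  \<open>ratio\<close>. Continuity is carried along since the bounds on the transforms assume
  it.\<close>

lemma f_even_estimates:
  "continuous_on (sphere 0 r) (\<lambda>v. f (2 * k) (\<psi> v)) \<and> (\<forall>v. cmod v = r \<longrightarrow> cmod (f (2 * k) (\<psi> v)) \<le> ratio ^ k)"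
proof (induction k)
  case 0
  then show ?case by (simp add: f_zero)
next
  case (Suc k)
  have "2 * Suc k = 2 * k + 2" by simp
  moreover have "continuous_on (sphere 0 r) (\<lambda>v. f (2 * k + 2) (\<psi> v))"
    using Suc by (intro f_even_cont f_odd_cont) auto
  moreover have "cmod (f (2 * k + 2) (\<psi> v)) \<le> ratio * ratio ^ k" if "cmod v = r" for v
    using Suc ratio_nonneg by (intro f_even_bound f_odd_cont f_odd_bound that) auto
  ultimately show ?case by (simp only: power_Suc) blast
qed

lemma f_odd_estimates:
  "continuous_on (sphere 0 (1 / r)) (\<lambda>w. f (2 * k + 1) (\<psi> w))"
  "cmod w = 1 / r \<Longrightarrow> cmod (f (2 * k + 1) (\<psi> w)) \<le> odd_factor * ratio ^ k"
proof -
  show "continuous_on (sphere 0 (1 / r)) (\<lambda>w. f (2 * k + 1) (\<psi> w))"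
    by (rule f_odd_cont) (use f_even_estimates in blast)
  show "cmod (f (2 * k + 1) (\<psi> w)) \<le> odd_factor * ratio ^ k" if "cmod w = 1 / r"
    by (rule f_odd_bound[OF _ _ that]) (use f_even_estimates in blast)+
qed

subsection \<open>Pairings over the boundary curve\<close>

lemma M_tangent:
  assumes w: "cmod w = 1"
  shows "w * ((q (\<psi> w))\<^sup>2 * deriv \<psi> w) = M w * of_real (cmod ((q (\<psi> w))\<^sup>2 * deriv \<psi> w))"
proof (rule boundary_tangent[OF M_has_derivative w norm_M_circle])
  show "\<rho>h < cmod w" "cmod w < 1 / \<rho>0" using w radius_less_1 radii(5) by simp_all
  show "0 < 1 - \<rho>h" using radius_less_1 by simp
  fix t :: real assume t: "0 < t" "t < 1 - \<rho>h"
  \<comment> \<open>This keeps the radial points above the radius \<open>\<rho>h\<close>, where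
    \<open>\<psi>\<close> is available.\<close>
  have "1 + - t \<le> exp (- t)" by (rule exp_ge_add_one_self)
  then have e: "\<rho>h < exp (- t)" "exp (- t) < 1" using t by auto
  have n: "cmod (w * exp (of_real (- t))) = exp (- t)" using w by (simp add: norm_mult)
  have "\<psi> (w * exp (of_real (- t))) \<notin> Omega \<psi> 1"
    using e n radius_less_1 psi_in_Omega_iff[of 1 "w * exp (of_real (- t))"] by auto
  then show "cmod (M (w * exp (of_real (- t)))) \<le> 1" unfolding M_def by (rule norm_kappa_closure)
qed

lemma norm_M_interior: "\<rho>h < cmod v \<Longrightarrow> cmod v < 1 \<Longrightarrow> cmod (M v) < 1"
proof -
  assume "\<rho>h < cmod v" "cmod v < 1"
  then have "\<kappa> (\<psi> v) \<in> \<kappa> ` G_region \<psi> 1" by (intro imageI) simp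
  then show ?thesis unfolding kappa_ball by (simp add: M_def)
qed

text \<open>The interior of \<open>L\<close> is not covered by the coordinate \<open>w\<close>, so
  the circle cannot be contracted. Cauchy's theorem is applied on \<open>L\<close> itself, in its
  form with winding numbers: whatever is not in \<open>T\<close> lies outside \<open>L\<close>. The
  denominator has no zero since \<open>|b| < 1\<close> and \<open>|\<kappa>| \<le> 1\<close>; later
  \<open>b\<close> is \<open>cnj (M v)\<close>.\<close>

lemma interior_cauchy:
  assumes g: "g holomorphic_on UNIV" and v: "cmod b < 1"
  shows "contour_integral (circlepath 0 1) (\<lambda>w. g (\<psi> w) * \<Delta>i (\<psi> w) * q (\<psi> w) / (b * M w - 1) * deriv \<psi> w) = 0"
proof -
  obtain U where U: "open U" "- Omega \<psi> 1 \<subseteq> U" "\<Delta>i holomorphic_on U" by (rule Delta_i_nbhd)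
  let ?G = "G_region \<psi> (ereal (1 / \<rho>0))"
  define T where "T = U \<inter> (?G \<inter> (\<lambda>z. b * \<kappa> z - 1) -` (- {0}))"
  have "continuous_on ?G (\<lambda>z. b * \<kappa> z - 1)"
    by (intro continuous_intros holomorphic_on_imp_continuous_on kappa_holo)
  then have T: "open T" unfolding T_def
    by (intro open_Int U continuous_open_preimage open_max_region) auto
  have sub: "- Omega \<psi> 1 \<subseteq> T"
  proof
    fix z assume z: "z \<in> - Omega \<psi> 1"
    have "cmod (b * \<kappa> z) < 1"
      using v norm_kappa_closure[of z] z mult_left_le[of "cmod (\<kappa> z)" "cmod b"] by (simp add: norm_mult)
    then have "b * \<kappa> z - 1 \<noteq> 0" by auto
    then show "z \<in> T" using z U(2) closure_G_one_subset by (auto simp: T_def)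
  qed
  have "\<Delta>i holomorphic_on T" "q holomorphic_on T" "\<kappa> holomorphic_on T" "g holomorphic_on T"
    by (rule holomorphic_on_subset[OF U(3)] holomorphic_on_subset[OF q_holo]
        holomorphic_on_subset[OF kappa_holo] holomorphic_on_subset[OF g]; auto simp: T_def)+
  then have hol: "(\<lambda>z. g z * \<Delta>i z * q z / (b * \<kappa> z - 1)) holomorphic_on T"
    by (intro holomorphic_on_mult holomorphic_on_divide holomorphic_on_diff holomorphic_on_const) (auto simp: T_def)
  have sph: "sphere 0 1 \<subseteq> ext_disk \<rho>h" using radius_less_1 by (auto simp: ext_disk_def)
  have img: "path_image (level_path \<psi> 1) = L"
    by (simp add: level_path_def path_image_compose L_eq)
  have valid: "valid_path (level_path \<psi> 1)"
    unfolding level_path_def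
    by (rule valid_path_compose_holomorphic[OF _ psi_holo open_ext_disk]) (use sph in auto)
  have loop: "pathfinish (level_path \<psi> 1) = pathstart (level_path \<psi> 1)"
    by (simp add: level_path_def pathfinish_compose pathstart_compose)
  have LT: "L \<subseteq> T" using sub radius_less_1 by (auto simp: L_eq)
  have wn: "winding_number (level_path \<psi> 1) z = 0" if "z \<notin> T" for z
  proof (rule winding_number_zero_in_outside[OF valid_path_imp_path[OF valid] loop])
    show "z \<in> outside (path_image (level_path \<psi> 1))" unfolding img Omega_1[symmetric] using that sub by auto
  qed
  have "((\<lambda>z. g z * \<Delta>i z * q z / (b * \<kappa> z - 1)) has_contour_integral 0) (level_path \<psi> 1)"
    by (rule Cauchy_theorem_global[OF T hol valid loop _ wn]) (use LT img in auto)
  then have "contour_integral (level_path \<psi> 1) (\<lambda>z. g z * \<Delta>i z * q z / (b * \<kappa> z - 1)) = 0"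
    by (rule contour_integral_unique)
  then show ?thesis
    using contour_integral_level_path[OF psi_holo open_ext_disk sph] by (simp add: M_def)
qed

text \<open>By \<open>M_tangent\<close>, the integrand is on the circle the conjugate of an analytic function in the interior
  (up to the factor \<open>w\<^sup>2\<close>, which turns \<open>dw\<close> into its conjugate).\<close>

lemma exterior_kernel_orthogonal:
  assumes g: "g holomorphic_on UNIV" and v: "\<rho>h < cmod v" "cmod v < 1"
  shows "contour_integral (circlepath 0 1)
           (\<lambda>w. q (\<psi> w) * (cnj (g (\<psi> w) * \<Delta>i (\<psi> w)) * of_real (cmod (deriv \<psi> w)) / w) / (M v - M w)) = 0"
proof -
  \<comment> \<open>\<open>X w / w^2\<close> is the integrand of \<open>interior_cauchy\<close> with
    \<open>b = cnj (M v)\<close>; \<open>contour_integral_circlepath_cnj\<close> undoes the factor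
    \<open>w^2\<close>.\<close>
  define X where "X w = w\<^sup>2 * (g (\<psi> w) * \<Delta>i (\<psi> w) * q (\<psi> w) / (cnj (M v) * M w - 1) * deriv \<psi> w)" for w
  have Mv: "cmod (M v) < 1" by (rule norm_M_interior[OF v])
  have eq: "q (\<psi> w) * (cnj (g (\<psi> w) * \<Delta>i (\<psi> w)) * of_real (cmod (deriv \<psi> w)) / w) / (M v - M w) = cnj (X w)"
    if w: "cmod w = 1" for w
  proof -
    have w': "\<rho>h < cmod w" "cmod w < 1 / \<rho>0" "w \<noteq> 0" using w radius_less_1 radii(5) by auto
    have ww: "w * cnj w = 1" using w complex_norm_square[of w] by simp
    have MM: "M w * cnj (M w) = 1" using norm_M_circle[OF w] complex_norm_square[of "M w"] by simp
    have Mw: "M w \<noteq> 0" using MM by auto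
    have ne: "M v - M w \<noteq> 0" using Mv norm_M_circle[OF w] by auto
    define Q where "Q = q (\<psi> w)"
    define P where "P = deriv \<psi> w"
    have QP: "Q * P \<noteq> 0"
      unfolding Q_def P_def using q_nonzero[OF psi_in_max_region[OF w'(1,2)]] deriv_psi_nonzero[OF w'(1)] by simp
    have tang: "w * (Q\<^sup>2 * P) = M w * of_real (cmod (Q\<^sup>2 * P))" unfolding Q_def P_def by (rule M_tangent[OF w])
    have QQ: "of_real (cmod (Q\<^sup>2 * P)) * of_real (cmod P) = (Q * cnj Q) * (P * cnj P)"
      by (simp add: norm_mult norm_power complex_norm_square[symmetric] power2_eq_square)
    \<comment> \<open>The tangent relation contains the square of \<open>q\<close>. Multiplying by
      \<open>|\<psi>'|\<close> and cancelling \<open>Q * P\<close> leaves a relation linear in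
      \<open>Q\<close> and its conjugate.\<close>
    have "(w * Q * of_real (cmod P)) * (Q * P) = (w * (Q\<^sup>2 * P)) * of_real (cmod P)"
      by (simp add: power2_eq_square mult_ac)
    also have "\<dots> = M w * (of_real (cmod (Q\<^sup>2 * P)) * of_real (cmod P))" by (simp only: tang mult.assoc)
    also have "\<dots> = M w * ((Q * cnj Q) * (P * cnj P))" by (simp only: QQ)
    also have "\<dots> = (M w * cnj Q * cnj P) * (Q * P)" by (simp only: mult_ac)
    finally have key: "w * Q * of_real (cmod P) = M w * cnj Q * cnj P" using QP by simp
    have "cnj (X w) = (cnj w)\<^sup>2 * (cnj (g (\<psi> w) * \<Delta>i (\<psi> w)) * cnj Q / (M v * cnj (M w) - 1) * cnj P)"
      by (simp add: X_def Q_def P_def)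
    also have "cnj w = 1 / w" using ww w' by (simp add: field_simps)
    also have "M v * cnj (M w) - 1 = (M v - M w) / M w"
      using MM Mw by (simp add: field_simps)
    also have "(1 / w)\<^sup>2 * (cnj (g (\<psi> w) * \<Delta>i (\<psi> w)) * cnj Q / ((M v - M w) / M w) * cnj P) =
        (M w * cnj Q * cnj P) * cnj (g (\<psi> w) * \<Delta>i (\<psi> w)) / (w\<^sup>2 * (M v - M w))"
      by (simp add: power_divide)
    also have "\<dots> = (w * Q * of_real (cmod P)) * cnj (g (\<psi> w) * \<Delta>i (\<psi> w)) / (w\<^sup>2 * (M v - M w))"
      by (simp only: key)
    also have "\<dots> = Q * (cnj (g (\<psi> w) * \<Delta>i (\<psi> w)) * of_real (cmod P) / w) / (M v - M w)"
      using w' by (simp add: power2_eq_square)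
    finally show ?thesis by (simp add: Q_def P_def)
  qed
  have "contour_integral (circlepath 0 1)
          (\<lambda>w. q (\<psi> w) * (cnj (g (\<psi> w) * \<Delta>i (\<psi> w)) * of_real (cmod (deriv \<psi> w)) / w) / (M v - M w)) =
        contour_integral (circlepath 0 1) (\<lambda>w. cnj (X w))"
    by (intro contour_integral_circlepath_cong eq) auto
  also have "\<dots> = - cnj (contour_integral (circlepath 0 1) (\<lambda>w. X w / w\<^sup>2))"
    by (rule contour_integral_circlepath_cnj)
  also have "contour_integral (circlepath 0 1) (\<lambda>w. X w / w\<^sup>2) =
      contour_integral (circlepath 0 1) (\<lambda>w. g (\<psi> w) * \<Delta>i (\<psi> w) * q (\<psi> w) / (cnj (M v) * M w - 1) * deriv \<psi> w)"
    by (rule contour_integral_circlepath_cong) (auto simp: X_def)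
  also have "\<dots> = 0" using Mv by (intro interior_cauchy g) simp
  finally show ?thesis by simp
qed

section \<open>The inner product of polynomials on the circle\<close>

lemma h_circle_cont: "continuous_on (sphere 0 1) (\<lambda>w. h (\<psi> w))"
proof (rule continuous_on_eq)
  show "continuous_on (sphere 0 1) (\<lambda>w. complex_of_real (1 / (cmod (\<Delta>e (\<psi> w)))\<^sup>2))"
    using Delta_e_nonzero rho0 by (intro continuous_intros Delta_e_cont) auto
qed (use h_eq_e in auto)

lemma deriv_psi_cont: "\<rho>h < s \<Longrightarrow> continuous_on (sphere 0 s) (deriv \<psi>)"
  by (rule holomorphic_on_imp_continuous_on, rule holomorphic_on_subset[OF deriv_psi_holo]) (auto simp: ext_disk_def)

lemma psi_circle_cont: "\<rho>h < s \<Longrightarrow> continuous_on (sphere 0 s) \<psi>"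
  by (rule continuous_on_subset[OF psi_cont]) auto

lemma entire_circle_cont: "g holomorphic_on UNIV \<Longrightarrow> \<rho>h < s \<Longrightarrow> continuous_on (sphere 0 s) (\<lambda>w. g (\<psi> w))"
  by (rule continuous_on_compose2[OF holomorphic_on_imp_continuous_on psi_circle_cont]) auto

lemma Delta_i_circle_cont: "continuous_on (sphere 0 1) (\<lambda>w. \<Delta>i (\<psi> w))"
proof -
  obtain U where U: "- Omega \<psi> 1 \<subseteq> U" "\<Delta>i holomorphic_on U" by (rule Delta_i_nbhd)
  show ?thesis
    by (rule continuous_on_compose2[OF holomorphic_on_imp_continuous_on[OF U(2)] psi_circle_cont])
       (use U radius_less_1 in auto)
qed

lemma M_cont_annulus: "\<rho>0 < s \<Longrightarrow> s < 1 / \<rho>0 \<Longrightarrow> continuous_on (sphere 0 s) M"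
  by (rule holomorphic_on_imp_continuous_on, rule holomorphic_on_subset[OF M_holo]) auto

text \<open>The inner product of the orthonormality relation, with weight \<open>h |dz|\<close> and
  factor \<open>1 / (2 \<pi>)\<close>; the extra \<open>\<i>\<close> and \<open>1 / w\<close> come
  from \<open>|dw|\<close>.\<close>

definition pairing :: "complex poly \<Rightarrow> complex poly \<Rightarrow> complex" where
  "pairing p1 p2 = contour_integral (circlepath 0 1)
     (\<lambda>w. poly p1 (\<psi> w) * cnj (poly p2 (\<psi> w)) * h (\<psi> w) * of_real (cmod (deriv \<psi> w)) / w) / (2 * of_real pi * \<i>)"

lemma arclength_pairing:
  "1 / (2 * complex_of_real pi) * arclength_integral (level_path \<psi> 1) (\<lambda>z. poly p1 z * cnj (poly p2 z) * h z) = pairing p1 p2"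
proof -
  have sph: "sphere 0 1 \<subseteq> ext_disk \<rho>h" using radius_less_1 by (auto simp: ext_disk_def)
  show ?thesis
    unfolding arclength_integral_level_path[OF psi_holo open_ext_disk sph] pairing_def
    by (simp only: times_divide_times_eq mult_1)
qed

lemma pairing_integrable:
  "(\<lambda>w. poly p1 (\<psi> w) * cnj (poly p2 (\<psi> w)) * h (\<psi> w) * of_real (cmod (deriv \<psi> w)) / w)
     contour_integrable_on circlepath 0 1"
proof -
  note c = entire_circle_cont[OF poly_holo radius_less_1] deriv_psi_cont[OF radius_less_1]
  have "continuous_on (sphere 0 1)
      (\<lambda>w. poly p1 (\<psi> w) * cnj (poly p2 (\<psi> w)) * h (\<psi> w) * of_real (cmod (deriv \<psi> w)) / w)"
    by (intro continuous_on_mult continuous_on_divide continuous_on_cnj continuous_on_of_real continuous_on_norm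
        continuous_on_id c h_circle_cont) auto
  then show ?thesis by (intro continuous_contour_integrable_circlepath) auto
qed

lemma pairing_diff: "pairing (p1 - p2) p3 = pairing p1 p3 - pairing p2 p3"
  using contour_integral_diff[OF pairing_integrable pairing_integrable, of p1 p3 p2 p3]
  by (simp add: pairing_def left_diff_distrib diff_divide_distrib)

lemma pairing_smult: "pairing (smult a p1) p2 = a * pairing p1 p2"
  using contour_integral_cmult[of "circlepath 0 1" a
      "\<lambda>w. poly p1 (\<psi> w) * cnj (poly p2 (\<psi> w)) * h (\<psi> w) * of_real (cmod (deriv \<psi> w)) / w"]
  by (simp add: pairing_def mult.assoc)

lemma pairing_smult_right: "pairing p1 (smult a p2) = cnj a * pairing p1 p2"
  using contour_integral_cmult[of "circlepath 0 1" "cnj a"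
      "\<lambda>w. poly p1 (\<psi> w) * cnj (poly p2 (\<psi> w)) * h (\<psi> w) * of_real (cmod (deriv \<psi> w)) / w"]
  by (simp add: pairing_def mult_ac)

lemma pairing_sum: "finite A \<Longrightarrow> pairing (\<Sum>m\<in>A. g m) p2 = (\<Sum>m\<in>A. pairing (g m) p2)"
proof (induction A rule: finite_induct)
  case empty
  have "pairing 0 p2 = 0" using pairing_smult[of 0 0 p2] by simp
  then show ?case by simp
next
  case (insert x A)
  have "pairing (g x + (\<Sum>m\<in>A. g m)) p2 = pairing (g x) p2 + pairing (\<Sum>m\<in>A. g m) p2"
    using pairing_diff[of "g x" "smult (-1) (\<Sum>m\<in>A. g m)" p2] pairing_smult[of "-1" "\<Sum>m\<in>A. g m" p2]
    by simp
  with insert show ?case by simp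
qed

end

subsection \<open>The sums of the transforms\<close>

locale szego_convergent = szego_setting +
  assumes ratio_less_1: "ratio < 1"
begin

text \<open>A function of \<open>u = \<phi> z\<close>, because \<open>even_pairing\<close> needs it
  on the whole closed unit disk. The \<open>1\<close> is the term of index 0.\<close>

definition even_sum :: "complex \<Rightarrow> complex" where
  "even_sum u = 1 + cauchy_transform (1 / r) (\<lambda>w. (\<Sum>k. f (2 * k + 1) (\<psi> w)) * even_density w) (\<lambda>w. w) u"

text \<open>Written with \<open>even_sum\<close> instead of the series of even terms; together with
  \<open>even_sum_eq\<close> this makes each sum the transform of the other.\<close>

definition odd_sum :: "complex \<Rightarrow> complex" where
  "odd_sum z = - q z * cauchy_transform r (\<lambda>w. even_sum w * odd_density w) M (\<kappa> z)"

lemma summable_ratio: "summable (\<lambda>k. ratio ^ k)" "summable (\<lambda>k. odd_factor * ratio ^ k)"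
  using ratio_nonneg ratio_less_1 by (auto intro!: summable_mult summable_geometric)

lemma odd_series_cont: "continuous_on (sphere 0 (1 / r)) (\<lambda>w. \<Sum>k. f (2 * k + 1) (\<psi> w))"
  using circlepath_integral_sums(1)[OF radii(4) f_odd_estimates(1) summable_ratio(2) f_odd_estimates(2)
      continuous_on_const[of _ 0]] .

lemma even_transform_sums:
  assumes "cmod u \<noteq> 1 / r"
  shows "(\<lambda>k. cauchy_transform (1 / r) (\<lambda>w. f (2 * k + 1) (\<psi> w) * even_density w) (\<lambda>w. w) u) sums (even_sum u - 1)"
proof -
  have "u \<notin> (\<lambda>w. w) ` sphere 0 (1 / r)" using assms by auto
  then have "(\<lambda>k. cauchy_transform (1 / r) (\<lambda>w. f (2 * k + 1) (\<psi> w) * even_density w) (\<lambda>w. w) u) sums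
      cauchy_transform (1 / r) (\<lambda>w. (\<Sum>k. f (2 * k + 1) (\<psi> w)) * even_density w) (\<lambda>w. w) u"
    by (intro cauchy_transform_sums[where a = "\<lambda>k w. f (2 * k + 1) (\<psi> w)" and B = "\<lambda>k. odd_factor * ratio ^ k"]
        radii(4) summable_ratio(2) even_density_cont continuous_on_id f_odd_estimates)
  then show ?thesis by (simp add: even_sum_def)
qed

lemma even_sums:
  assumes "cmod (\<phi> z) \<noteq> 1 / r"
  shows "(\<lambda>k. f (2 * k) z) sums even_sum (\<phi> z)"
proof -
  have "(\<lambda>k. f (2 * k + 2) z) sums (even_sum (\<phi> z) - 1)"
    unfolding f_even by (rule even_transform_sums[OF assms])
  then have "(\<lambda>k. f (2 * Suc k) z) sums (even_sum (\<phi> z) - f (2 * 0) z)" by (simp add: f_zero)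
  then have "(\<lambda>k. f (2 * k) z) sums (even_sum (\<phi> z) - f (2 * 0) z + f (2 * 0) z)"
    by (rule sums_Suc[of "\<lambda>k. f (2 * k) z"])
  then show ?thesis by simp
qed

lemma even_series: "cmod w = r \<Longrightarrow> (\<Sum>k. f (2 * k) (\<psi> w)) = even_sum w"
  using even_sums[of "\<psi> w"] rho0(6) r radii(1) by (auto simp: sums_iff)

text \<open>The majorant \<open>ratio ^ k\<close> is needed only on the contour \<open>L_r\<close>;
  the point \<open>z\<close> enters through the kernel alone.\<close>

lemma odd_sums:
  assumes "z \<in> G_region \<psi> (ereal (1 / \<rho>0))" "z \<notin> \<psi> ` sphere 0 r"
  shows "(\<lambda>k. f (2 * k + 1) z) sums odd_sum z"
proof -
  have "sphere 0 r \<subseteq> {w. \<rho>0 < cmod w \<and> cmod w < 1 / \<rho>0}" using in_annulus by auto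
  from kappa_notin_image[OF assms this] have "\<kappa> z \<notin> M ` sphere 0 r" .
  then have "(\<lambda>k. cauchy_transform r (\<lambda>w. f (2 * k) (\<psi> w) * odd_density w) M (\<kappa> z)) sums
      cauchy_transform r (\<lambda>w. (\<Sum>k. f (2 * k) (\<psi> w)) * odd_density w) M (\<kappa> z)"
    using f_even_estimates
    by (intro cauchy_transform_sums[where a = "\<lambda>k w. f (2 * k) (\<psi> w)" and B = "\<lambda>k. ratio ^ k"]
        rho0(5) summable_ratio(1) odd_density_cont M_cont) blast+
  moreover have "cauchy_transform r (\<lambda>w. (\<Sum>k. f (2 * k) (\<psi> w)) * odd_density w) M (\<kappa> z) =
      cauchy_transform r (\<lambda>w. even_sum w * odd_density w) M (\<kappa> z)"
    by (intro cauchy_transform_cong rho0) (simp only: even_series)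
  ultimately show ?thesis unfolding f_odd odd_sum_def by (simp only: sums_mult)
qed

lemma odd_series: "cmod w = 1 / r \<Longrightarrow> (\<Sum>k. f (2 * k + 1) (\<psi> w)) = odd_sum (\<psi> w)"
proof -
  assume w: "cmod w = 1 / r"
  then have "\<psi> w \<in> G_region \<psi> (ereal (1 / \<rho>0))"
    using radii(2,6) by (intro psi_in_max_region) auto
  moreover have "\<psi> w \<notin> \<psi> ` sphere 0 r" using w radii(1,6) rho0(6) r by (auto simp: psi_inj_iff)
  ultimately show ?thesis using odd_sums sums_unique by metis
qed

lemma even_sum_eq:
  "even_sum u = 1 + cauchy_transform (1 / r) (\<lambda>w. odd_sum (\<psi> w) * even_density w) (\<lambda>w. w) u"
  unfolding even_sum_def
  by (intro arg_cong[where f = "\<lambda>x. 1 + x"] cauchy_transform_cong radii(4)) (simp only: odd_series)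

subsection \<open>The polynomial\<close>

text \<open>Moving the contours from \<open>L\<^sub>r\<close> out to \<open>r1\<close> and from \<open>L\<^sub>1\<^sub>/\<^sub>r\<close> in to \<open>r2\<close> continues the outer formulas of the
  theorem analytically across these curves; the residue picked up on the way is the missing term of the
  middle formula.\<close>

definition r1 :: real where "r1 = (r + 1) / 2"
definition r2 :: real where "r2 = (1 / r + 1) / 2"

lemma r12: "r < r1" "r1 < 1" "1 < r2" "r2 < 1 / r" "\<rho>0 < r1" "r1 < 1 / \<rho>0" "r2 < 1 / \<rho>0" "\<rho>0 < r2"
  "0 < r1" "0 < r2" "\<rho>h < r1" "\<rho>h < r2"
proof -
  have "2 * r1 = r + 1" "2 * r2 = 1 / r + 1" by (simp_all add: r1_def r2_def)
  then show "r < r1" "r1 < 1" "1 < r2" "r2 < 1 / r" "\<rho>0 < r1" "r1 < 1 / \<rho>0" "r2 < 1 / \<rho>0" "\<rho>0 < r2"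
    "0 < r1" "0 < r2" "\<rho>h < r1" "\<rho>h < r2"
    using rho0 r radii by linarith+
qed

lemma even_sum_holo: "even_sum holomorphic_on - sphere 0 (1 / r)"
proof -
  have "continuous_on (sphere 0 (1 / r)) (\<lambda>w. (\<Sum>k. f (2 * k + 1) (\<psi> w)) * even_density w)"
    by (intro continuous_intros odd_series_cont even_density_cont)
  from even_transform_holo[OF this radii(4)] show ?thesis
    unfolding even_sum_def[abs_def] by (rule holomorphic_on_add[OF holomorphic_on_const])
qed

lemma inner_density_holo: "(\<lambda>w. even_sum w * odd_density w) holomorphic_on {w. \<rho>0 < cmod w \<and> cmod w < 1}"
proof (intro holomorphic_on_mult odd_density_holo)
  show "even_sum holomorphic_on {w. \<rho>0 < cmod w \<and> cmod w < 1}"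
    by (rule holomorphic_on_subset[OF even_sum_holo]) (use radii(1) in auto)
qed

lemma inner_density_cont: "\<rho>0 < s \<Longrightarrow> s < 1 \<Longrightarrow> continuous_on (sphere 0 s) (\<lambda>w. even_sum w * odd_density w)"
  by (rule holomorphic_on_imp_continuous_on, rule holomorphic_on_subset[OF inner_density_holo]) auto

lemma odd_sum_holo: "odd_sum holomorphic_on G_region \<psi> (ereal (1 / \<rho>0)) - \<psi> ` sphere 0 r"
  unfolding odd_sum_def[abs_def]
  using rho0 r le_one_less_inv[of r] by (intro odd_transform_holo inner_density_cont) auto

lemma psi_in_odd_domain:
  assumes "\<rho>0 < cmod w" "cmod w < 1 / \<rho>0" "cmod w \<noteq> r"
  shows "\<psi> w \<in> G_region \<psi> (ereal (1 / \<rho>0)) - \<psi> ` sphere 0 r"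
  using assms rho0 by (auto simp: psi_inj_iff intro!: psi_in_max_region)

lemma outer_density_holo: "(\<lambda>w. odd_sum (\<psi> w) * even_density w) holomorphic_on {w. 1 < cmod w \<and> cmod w < 1 / \<rho>0}"
  using rho0 r by (intro holomorphic_on_mult even_density_holo holo_compose_psi[OF odd_sum_holo] conjI psi_in_odd_domain) auto

lemma outer_density_cont: "1 < s \<Longrightarrow> s < 1 / \<rho>0 \<Longrightarrow> continuous_on (sphere 0 s) (\<lambda>w. odd_sum (\<psi> w) * even_density w)"
  by (rule holomorphic_on_imp_continuous_on, rule holomorphic_on_subset[OF outer_density_holo]) auto

definition inner_part :: "complex \<Rightarrow> complex" where
  "inner_part z = - R z * (- q z * cauchy_transform r1 (\<lambda>w. even_sum w * odd_density w) M (\<kappa> z))"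

definition middle_part :: "complex \<Rightarrow> complex" where
  "middle_part z = lead z * even_sum (\<phi> z) - R z * odd_sum z"

definition outer_part :: "complex \<Rightarrow> complex" where
  "outer_part z = lead z * (1 + cauchy_transform r2 (\<lambda>w. odd_sum (\<psi> w) * even_density w) (\<lambda>w. w) (\<phi> z))"

lemma G_r1_subset: "s \<le> r1 \<Longrightarrow> \<rho>h < s \<Longrightarrow> G_region \<psi> (ereal s) \<subseteq> G_region \<psi> (ereal (1 / \<rho>0)) - \<psi> ` sphere 0 r1"
  using G_region_mono[of s "1 / \<rho>0"] r12 by (auto simp: G_region_eq)

lemma inner_part_holo: "inner_part holomorphic_on G_region \<psi> (ereal r1)"
proof -
  let ?G = "G_region \<psi> (ereal r1)"
  have sub: "?G \<subseteq> G_region \<psi> (ereal (1 / \<rho>0)) - \<psi> ` sphere 0 r1" using r12 by (intro G_r1_subset) auto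
  have "(\<lambda>z. - q z * cauchy_transform r1 (\<lambda>w. even_sum w * odd_density w) M (\<kappa> z)) holomorphic_on ?G"
    by (rule holomorphic_on_subset[OF odd_transform_holo sub]) (intro inner_density_cont r12)+
  moreover have "(\<lambda>z. - R z) holomorphic_on ?G"
    by (intro holomorphic_on_minus holomorphic_on_subset[OF R_holo]) (use sub in auto)
  ultimately show ?thesis
    unfolding inner_part_def[abs_def] by (intro holomorphic_on_mult[of "\<lambda>z. - R z"])
qed

lemma lead_holo: "lead holomorphic_on Omega \<psi> \<rho>0"
proof -
  have "Omega \<psi> \<rho>0 \<subseteq> Omega \<psi> \<rho>h" using rho0 by (intro Omega_mono) auto
  then show ?thesis unfolding lead_def[abs_def]
    by (intro holomorphic_on_mult holomorphic_on_power Delta_e_holo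
        holomorphic_on_subset[OF S_holo] holomorphic_on_subset[OF phi_holo])
qed

lemma phi_holo_Omega: "\<rho>h \<le> s \<Longrightarrow> \<phi> holomorphic_on Omega \<psi> s"
  by (rule holomorphic_on_subset[OF phi_holo Omega_mono])

lemma outer_part_holo: "outer_part holomorphic_on Omega \<psi> r2"
proof -
  have "cauchy_transform r2 (\<lambda>w. odd_sum (\<psi> w) * even_density w) (\<lambda>w. w) holomorphic_on - sphere 0 r2"
    using r12 by (intro even_transform_holo outer_density_cont) auto
  moreover have "\<phi> ` Omega \<psi> r2 \<subseteq> - sphere 0 r2" using r12 by (auto elim!: OmegaE)
  moreover have "\<phi> holomorphic_on Omega \<psi> r2" using r12 by (intro phi_holo_Omega) auto
  ultimately have "(cauchy_transform r2 (\<lambda>w. odd_sum (\<psi> w) * even_density w) (\<lambda>w. w) \<circ> \<phi>) holomorphic_on Omega \<psi> r2"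
    by (blast intro: holomorphic_on_compose_gen)
  moreover have "lead holomorphic_on Omega \<psi> r2"
    using r12 by (intro holomorphic_on_subset[OF lead_holo Omega_mono]) auto
  ultimately show ?thesis unfolding outer_part_def[abs_def] o_def
    by (intro holomorphic_on_mult holomorphic_on_add holomorphic_on_const)
qed

lemma middle_part_holo: "middle_part holomorphic_on Omega \<psi> r \<inter> G_region \<psi> (ereal (1 / r))"
proof -
  let ?A = "Omega \<psi> r \<inter> G_region \<psi> (ereal (1 / r))"
  have sub: "?A \<subseteq> G_region \<psi> (ereal (1 / \<rho>0)) - \<psi> ` sphere 0 r"
    using G_region_mono[OF radii(6), of "1 / \<rho>0"] radii(2) rho0(6) by (auto elim!: OmegaE simp: psi_inj_iff)
  have "\<phi> ` ?A \<subseteq> - sphere 0 (1 / r)"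
    using rho0(6) radii(6) by (auto elim!: OmegaE)
  moreover have ph: "\<phi> holomorphic_on ?A"
    using rho0 by (intro holomorphic_on_subset[OF phi_holo_Omega[of r]]) auto
  ultimately have "(even_sum \<circ> \<phi>) holomorphic_on ?A"
    by (blast intro: holomorphic_on_compose_gen[OF _ even_sum_holo])
  moreover have "lead holomorphic_on ?A"
    using rho0 Omega_mono[of \<rho>0 r] by (intro holomorphic_on_subset[OF lead_holo]) auto
  moreover have "odd_sum holomorphic_on ?A" by (rule holomorphic_on_subset[OF odd_sum_holo sub])
  moreover have "R holomorphic_on ?A" by (rule holomorphic_on_subset[OF R_holo]) (use sub in auto)
  ultimately show ?thesis unfolding middle_part_def[abs_def] o_def
    by (intro holomorphic_on_mult holomorphic_on_diff)
qed

section \<open>Agreement of the formulas on the overlaps\<close>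

lemma inner_eq_odd_sum:
  assumes z: "z \<in> G_region \<psi> (ereal r)"
  shows "inner_part z = - R z * odd_sum z"
proof -
  let ?C = "{w. r \<le> cmod w \<and> cmod w \<le> r1}"
  have C: "?C \<subseteq> {w. \<rho>0 < cmod w \<and> cmod w < 1}" using rho0 r12 by auto
  have "z \<notin> \<psi> ` ?C" using z rho0 by (auto simp: G_region_eq)
  moreover have "?C \<subseteq> {w. \<rho>0 < cmod w \<and> cmod w < 1 / \<rho>0}" using rho0 r12 by auto
  moreover have "z \<in> G_region \<psi> (ereal (1 / \<rho>0))" using z G_r1_subset[of r] r12 rho0 by auto
  ultimately have nin: "\<kappa> z \<notin> M ` ?C" by (intro kappa_notin_image)
  have "{w. \<rho>0 < cmod w \<and> cmod w < 1} \<subseteq> {w. \<rho>0 < cmod w \<and> cmod w < 1 / \<rho>0}"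
    using radii(5) by auto
  from cauchy_transform_annulus[OF inner_density_holo holomorphic_on_subset[OF M_holo this] open_annulus rho0(5) _ C nin]
  show ?thesis using r12 by (simp add: inner_part_def odd_sum_def)
qed

text \<open>Moving the contour from \<open>r\<close> to \<open>r1\<close> passes the pole at
  \<open>w\<close>. The residue carries \<open>1 / (q^2 * \<psi>')\<close>, which cancels
  \<open>q * \<psi>'\<close> in the density and the outer factor \<open>q\<close>. What remains is
  \<open>\<Delta>i\<close> times \<open>lead * even_sum\<close>, and
  \<open>R * \<Delta>i = 1\<close> since \<open>|w| < 1\<close>.\<close>

lemma inner_eq_middle:
  assumes w: "r < cmod w" "cmod w < r1"
  shows "inner_part (\<psi> w) = middle_part (\<psi> w)"
proof -
  let ?A = "{w. \<rho>0 < cmod w \<and> cmod w < 1}"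
  have A: "?A \<subseteq> {w. \<rho>0 < cmod w \<and> cmod w < 1 / \<rho>0}" using radii(5) by auto
  have C: "{w. r \<le> cmod w \<and> cmod w \<le> r1} \<subseteq> ?A" using rho0 r12 by auto
  have w': "\<rho>h < cmod w" "cmod w < 1 / \<rho>0" "cmod w < 1" using w rho0 r12 by auto
  have jump: "cauchy_transform r1 (\<lambda>w. even_sum w * odd_density w) M (M w) =
      cauchy_transform r (\<lambda>w. even_sum w * odd_density w) M (M w) + even_sum w * odd_density w / deriv M w"
    by (rule cauchy_transform_jump[OF inner_density_holo holomorphic_on_subset[OF M_holo A] open_annulus
        inj_on_subset[OF M_inj A] rho0(5) C w])
  have dM: "deriv M w = (q (\<psi> w))\<^sup>2 * deriv \<psi> w" by (rule DERIV_imp_deriv[OF M_has_derivative[OF w'(1,2)]])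
  have "q (\<psi> w) \<noteq> 0" by (rule q_nonzero[OF psi_in_max_region[OF w'(1,2)]])
  moreover have "deriv \<psi> w \<noteq> 0" by (rule deriv_psi_nonzero[OF w'(1)])
  ultimately have quot: "q (\<psi> w) * (even_sum w * odd_density w / deriv M w) = \<Delta>i (\<psi> w) * (lead (\<psi> w) * even_sum w)"
    unfolding dM odd_density_def lead_def phi_psi[OF w'(1)] by (simp add: power2_eq_square)
  have out: "\<psi> w \<notin> Omega \<psi> 1" using w' radius_less_1 by simp
  have "R (\<psi> w) * (\<Delta>i (\<psi> w) * (lead (\<psi> w) * even_sum w)) = lead (\<psi> w) * even_sum w"
    using Delta_i_nonzero[OF out] by (simp add: R_interior[OF out])
  then have "R (\<psi> w) * (q (\<psi> w) * (even_sum w * odd_density w / deriv M w)) = lead (\<psi> w) * even_sum w"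
    by (simp only: quot)
  moreover have "inner_part (\<psi> w) = R (\<psi> w) * (q (\<psi> w) * cauchy_transform r (\<lambda>w. even_sum w * odd_density w) M (M w))
      + R (\<psi> w) * (q (\<psi> w) * (even_sum w * odd_density w / deriv M w))"
    unfolding inner_part_def M_def[symmetric] jump by (simp only: minus_mult_minus mult_minus_left mult_minus_right minus_minus distrib_left)
  moreover have "odd_sum (\<psi> w) = - (q (\<psi> w) * cauchy_transform r (\<lambda>w. even_sum w * odd_density w) M (M w))"
    unfolding odd_sum_def M_def[symmetric] by simp
  ultimately show ?thesis unfolding middle_part_def phi_psi[OF w'(1)] by simp
qed

text \<open>By \<open>S^2 * \<psi>' = 1\<close>, \<open>even_density\<close> is
  \<open>R / lead\<close> in disguise. So the residue of the even transform, multiplied by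
  \<open>lead\<close>, is the term \<open>R * odd_sum\<close> of the middle formula.\<close>

lemma lead_even_density:
  assumes "1 \<le> cmod w" shows "lead (\<psi> w) * even_density w = R (\<psi> w)"
proof -
  have w: "\<rho>h < cmod w" "w \<noteq> 0" using assms radius_less_1 by auto
  have "lead (\<psi> w) * even_density w = ((S (\<psi> w))\<^sup>2 * deriv \<psi> w) * R (\<psi> w)"
    using w(2) Delta_e_nonzero[OF assms] by (simp add: lead_def even_density_def w(1) power2_eq_square)
  then show ?thesis by (simp only: S_sq[OF w(1)] mult_1)
qed

text \<open>The residue argument for the contour moved inwards from \<open>1 / r\<close> to
  \<open>r2\<close>: \<open>even_sum\<close> belongs to the outer position, so the residue is
  subtracted from it to give \<open>outer_part\<close>.\<close>

lemma outer_eq_middle: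
  assumes w: "r2 < cmod w" "cmod w < 1 / r"
  shows "outer_part (\<psi> w) = middle_part (\<psi> w)"
proof -
  let ?m = "\<lambda>w. odd_sum (\<psi> w) * even_density w"
  have C: "{w. r2 \<le> cmod w \<and> cmod w \<le> 1 / r} \<subseteq> {w. 1 < cmod w \<and> cmod w < 1 / \<rho>0}"
    using r12(3) radii(2) by (auto simp del: divide_less_cancel)
  have w': "\<rho>h < cmod w" "1 \<le> cmod w" using w r12 by auto
  have "cauchy_transform (1 / r) ?m (\<lambda>w. w) w = cauchy_transform r2 ?m (\<lambda>w. w) w + ?m w / deriv (\<lambda>w. w) w"
    by (rule cauchy_transform_jump[OF outer_density_holo holomorphic_on_ident open_annulus _ r12(10) C w]) (simp add: inj_on_def)
  then have "even_sum w = 1 + cauchy_transform r2 ?m (\<lambda>w. w) w + ?m w"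
    unfolding even_sum_eq[of w] by simp
  then have "lead (\<psi> w) * even_sum w = outer_part (\<psi> w) + odd_sum (\<psi> w) * (lead (\<psi> w) * even_density w)"
    unfolding outer_part_def phi_psi[OF w'(1)] by (simp add: algebra_simps)
  then show ?thesis unfolding lead_even_density[OF w'(2)] middle_part_def phi_psi[OF w'(1)] by simp
qed

lemma outer_eq_even_sum:
  assumes z: "z \<in> Omega \<psi> (1 / r)"
  shows "outer_part z = lead z * even_sum (\<phi> z)"
proof -
  let ?m = "\<lambda>w. odd_sum (\<psi> w) * even_density w"
  obtain w where w: "z = \<psi> w" "1 / r < cmod w" using z by (rule OmegaE)
  have C: "{w. r2 \<le> cmod w \<and> cmod w \<le> 1 / r} \<subseteq> {w. 1 < cmod w \<and> cmod w < 1 / \<rho>0}"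
    using r12(3) radii(2) by (auto simp del: divide_less_cancel)
  have "cauchy_transform r2 ?m (\<lambda>w. w) w = cauchy_transform (1 / r) ?m (\<lambda>w. w) w"
    by (rule cauchy_transform_annulus[OF outer_density_holo holomorphic_on_ident open_annulus r12(10) _ C])
       (use w r12(4) in auto)
  then have "1 + cauchy_transform r2 ?m (\<lambda>w. w) w = even_sum w"
    by (simp only: even_sum_eq[of w])
  moreover have "\<phi> z = w" using w radii(6) by simp
  ultimately show ?thesis by (simp only: outer_part_def)
qed

text \<open>Neighbouring domains overlap because \<open>r < r1\<close> and
  \<open>r2 < 1 / r\<close>, and the formulas agree there. The last case is reached only at points
  \<open>\<psi> w\<close> with \<open>r1 \<le> |w| \<le> r2\<close>, well inside the domain of the
  middle formula.\<close>

definition glued :: "complex \<Rightarrow> complex" where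
  "glued z = (if z \<in> G_region \<psi> (ereal r1) then inner_part z
              else if z \<in> Omega \<psi> r2 then outer_part z else middle_part z)"

lemma glued_inner: "z \<in> G_region \<psi> (ereal r1) \<Longrightarrow> glued z = inner_part z"
  by (simp add: glued_def)

lemma glued_outer: "z \<in> Omega \<psi> r2 \<Longrightarrow> glued z = outer_part z"
proof -
  assume z: "z \<in> Omega \<psi> r2"
  then obtain w where "z = \<psi> w" "r2 < cmod w" by (rule OmegaE)
  then have "z \<notin> G_region \<psi> (ereal r1)" using r12 by simp
  then show ?thesis using z by (simp add: glued_def)
qed

lemma glued_middle: "z \<in> Omega \<psi> r \<inter> G_region \<psi> (ereal (1 / r)) \<Longrightarrow> glued z = middle_part z"
proof -
  assume z: "z \<in> Omega \<psi> r \<inter> G_region \<psi> (ereal (1 / r))"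
  then obtain w where w: "z = \<psi> w" "r < cmod w" by (auto elim: OmegaE)
  then have w': "\<rho>h < cmod w" using rho0 by simp
  then have "cmod w < 1 / r" using z w radii(6) by simp
  then show ?thesis
    using inner_eq_middle[OF w(2)] outer_eq_middle[of w] psi_in_G_region_iff[OF r12(11) w']
      psi_in_Omega_iff[OF less_imp_le[OF r12(12)] w']
    unfolding w(1) by (auto simp: glued_def simp del: psi_in_G_region_iff psi_in_Omega_iff)
qed

lemma glued_holo: "glued holomorphic_on UNIV"
proof -
  have op: "open (G_region \<psi> (ereal r1))" "open (Omega \<psi> r2)" "open (Omega \<psi> r \<inter> G_region \<psi> (ereal (1 / r)))"
    using r12(11,12) rho0(6) radii(6) by (auto intro!: open_G_region open_Omega open_Int less_imp_le)
  have "glued holomorphic_on G_region \<psi> (ereal r1)"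
    by (rule holomorphic_transform[OF inner_part_holo]) (simp add: glued_inner)
  moreover have "glued holomorphic_on Omega \<psi> r2"
    by (rule holomorphic_transform[OF outer_part_holo]) (simp add: glued_outer)
  moreover have "glued holomorphic_on Omega \<psi> r \<inter> G_region \<psi> (ereal (1 / r))"
    by (rule holomorphic_transform[OF middle_part_holo]) (simp add: glued_middle)
  ultimately have "glued holomorphic_on (G_region \<psi> (ereal r1) \<union> Omega \<psi> r2) \<union> (Omega \<psi> r \<inter> G_region \<psi> (ereal (1 / r)))"
    by (intro holomorphic_on_Un op open_Un)
  moreover have "z \<in> (G_region \<psi> (ereal r1) \<union> Omega \<psi> r2) \<union> (Omega \<psi> r \<inter> G_region \<psi> (ereal (1 / r)))" for z
  proof (cases "z \<in> G_region \<psi> (ereal r1)")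
    case False
    then obtain w where w: "z = \<psi> w" "r1 \<le> cmod w" using not_in_G_regionE r12(11) by blast
    then have "\<rho>h < cmod w" "r < cmod w" using r12 by auto
    then show ?thesis using w radii(6) rho0(6) r12(4,12)
      by (cases "r2 < cmod w") auto
  qed auto
  ultimately show ?thesis using holomorphic_on_subset by blast
qed

section \<open>Limits at infinity and the degree of the glued function\<close>

definition S_lim :: real where "S_lim = Re (Lim at_infinity S)"
definition Delta_lim :: real where "Delta_lim = Re (Lim at_infinity \<Delta>e)"

lemma S_lim: "(S \<longlongrightarrow> of_real S_lim) at_infinity" "0 < S_lim"
  unfolding S_lim_def by (rule positive_at_infinity_Lim[OF S_inf])+

lemma Delta_lim: "(\<Delta>e \<longlongrightarrow> of_real Delta_lim) at_infinity" "0 < Delta_lim" "Lim at_infinity \<Delta>e = of_real Delta_lim"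
  using positive_at_infinity_Lim[of \<Delta>e] ext_szego by (auto simp: Delta_lim_def exterior_szego_def)

text \<open>The limit of the branch \<open>S\<close> is given as positive, and squaring it gives the
  limit of \<open>\<phi>'\<close>. Expressing the constants by \<open>S_lim\<close> avoids
  half-integer powers.\<close>

lemma deriv_phi_tendsto: "(deriv \<phi> \<longlongrightarrow> of_real (S_lim\<^sup>2)) at_infinity"
proof -
  have "((\<lambda>z. (S z)\<^sup>2) \<longlongrightarrow> (of_real S_lim)\<^sup>2) at_infinity" by (intro tendsto_power S_lim)
  moreover have "\<forall>\<^sub>F z in at_infinity. (S z)\<^sup>2 = deriv \<phi> z"
    using eventually_in_Omega[OF order_refl] by eventually_elim (use S in \<open>auto simp: sqrt_branch_def\<close>)
  ultimately show ?thesis by (simp add: tendsto_cong)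
qed

lemma phi_quotient_tendsto: "((\<lambda>z. \<phi> z / z) \<longlongrightarrow> of_real (S_lim\<^sup>2)) at_infinity"
proof -
  obtain B where B: "\<And>z. B \<le> cmod z \<Longrightarrow> z \<in> Omega \<psi> \<rho>h"
    using eventually_in_Omega[of \<rho>h] by (auto simp: eventually_at_infinity)
  show ?thesis
    using holomorphic_on_imp_differentiable_at[OF phi_holo open_Omega] B
    by (intro tendsto_times_infinity_quotient[where B = B] deriv_phi_tendsto) auto
qed

text \<open>This is \<open>\<Delta>e(\<infinity>) \<phi>'(\<infinity>)^(n + 1/2)\<close>: each of
  the \<open>n\<close> factors \<open>\<phi>\<close> contributes \<open>S_lim^2\<close>, and
  \<open>S\<close> one more \<open>S_lim\<close>.\<close>

definition lead_const :: real where "lead_const = Delta_lim * S_lim ^ (2 * n + 1)"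

lemma lead_const_pos: "0 < lead_const"
  using S_lim Delta_lim by (simp add: lead_const_def)

lemma lead_tendsto: "((\<lambda>z. lead z / z ^ n) \<longlongrightarrow> of_real lead_const) at_infinity"
proof -
  have "((\<lambda>z. \<Delta>e z * S z * (\<phi> z / z) ^ n) \<longlongrightarrow> of_real Delta_lim * of_real S_lim * (of_real (S_lim\<^sup>2)) ^ n) at_infinity"
    by (intro tendsto_intros Delta_lim S_lim phi_quotient_tendsto)
  moreover have "of_real Delta_lim * of_real S_lim * (of_real (S_lim\<^sup>2)) ^ n = complex_of_real lead_const"
    by (simp add: lead_const_def power_mult)
  ultimately show ?thesis by (simp add: lead_def power_divide)
qed

lemma lead_nonzero: "1 \<le> cmod w \<Longrightarrow> lead (\<psi> w) \<noteq> 0"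
  using Delta_e_nonzero[of w] S_nonzero[of w] radius_less_1 by (auto simp: lead_def)

text \<open>Near infinity only the outer formula is relevant, and its Cauchy transform dies out as
  \<open>\<phi>\<close> tends to infinity.\<close>

lemma glued_over_lead: "((\<lambda>z. glued z / lead z) \<longlongrightarrow> 1) at_infinity"
proof -
  have "((\<lambda>z. cauchy_transform r2 (\<lambda>w. odd_sum (\<psi> w) * even_density w) (\<lambda>w. w) (\<phi> z)) \<longlongrightarrow> 0) at_infinity"
    by (rule filterlim_compose[OF cauchy_transform_tendsto_0 phi_infinity]) (intro outer_density_cont r12)+
  then have "((\<lambda>z. 1 + cauchy_transform r2 (\<lambda>w. odd_sum (\<psi> w) * even_density w) (\<lambda>w. w) (\<phi> z)) \<longlongrightarrow> 1 + 0) at_infinity"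
    by (intro tendsto_add tendsto_const)
  moreover have "\<forall>\<^sub>F z in at_infinity. 1 + cauchy_transform r2 (\<lambda>w. odd_sum (\<psi> w) * even_density w) (\<lambda>w. w) (\<phi> z) = glued z / lead z"
    using eventually_in_Omega[OF less_imp_le[OF r12(12)]]
  proof eventually_elim
    case (elim z)
    then obtain w where w: "z = \<psi> w" "r2 < cmod w" by (auto elim: OmegaE)
    then have "lead z \<noteq> 0" using lead_nonzero[of w] r12(3) by simp
    then show ?case using elim by (simp add: glued_outer outer_part_def)
  qed
  ultimately show ?thesis by (simp add: tendsto_cong)
qed

lemma glued_tendsto: "((\<lambda>z. glued z / z ^ n) \<longlongrightarrow> of_real lead_const) at_infinity"
proof -
  have "((\<lambda>z. (glued z / lead z) * (lead z / z ^ n)) \<longlongrightarrow> 1 * of_real lead_const) at_infinity"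
    by (intro tendsto_mult glued_over_lead lead_tendsto)
  moreover have "\<forall>\<^sub>F z in at_infinity. (glued z / lead z) * (lead z / z ^ n) = glued z / z ^ n"
    using eventually_in_Omega[OF less_imp_le[OF radius_less_1]]
  proof eventually_elim
    case (elim z)
    then obtain w where w: "z = \<psi> w" "1 < cmod w" by (auto elim: OmegaE)
    then show ?case using lead_nonzero[of w] by simp
  qed
  ultimately have "((\<lambda>z. glued z / z ^ n) \<longlongrightarrow> 1 * of_real lead_const) at_infinity"
    by (rule Lim_transform_eventually)
  then show ?thesis by simp
qed

text \<open>Liouville's theorem for growth of order \<open>z ^ n\<close>; the coefficient of index
  \<open>n\<close> is read off from the limit in \<open>glued_tendsto\<close>.\<close>

lemma glued_poly: "\<exists>F. (\<forall>z. glued z = poly F z) \<and> degree F \<le> n \<and> coeff F n = of_real lead_const"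
proof -
  have "\<forall>\<^sub>F z in at_infinity. dist (glued z / z ^ n) (of_real lead_const) < 1"
    using tendstoD[OF glued_tendsto, of 1] by simp
  then obtain A where A: "\<And>z. A \<le> cmod z \<Longrightarrow> dist (glued z / z ^ n) (of_real lead_const) < 1"
    by (auto simp: eventually_at_infinity)
  have bd: "cmod (glued z) \<le> (lead_const + 1) * cmod z ^ n" if z: "max A 1 \<le> cmod z" for z
  proof -
    have "cmod (glued z / z ^ n - of_real lead_const) < 1" using A[of z] z by (simp add: dist_norm)
    then have "cmod (glued z / z ^ n) \<le> lead_const + 1"
      using norm_triangle_ineq2[of "glued z / z ^ n" "of_real lead_const"] lead_const_pos by simp
    moreover have "0 < cmod z ^ n" using z by (intro zero_less_power) linarith
    ultimately show ?thesis by (simp add: norm_divide norm_power pos_divide_le_eq)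
  qed
  define a where "a k = (deriv ^^ k) glued 0 / fact k" for k
  have eq: "glued z = (\<Sum>k\<le>n. a k * z ^ k)" for z
    unfolding a_def by (rule Liouville_polynomial[OF glued_holo bd])
  have "((\<lambda>z. glued z / z ^ n) \<longlongrightarrow> a n) at_infinity"
    unfolding eq by (rule coeff_sum_tendsto_at_infinity)
  then have an: "a n = of_real lead_const" using tendsto_unique[OF trivial_limit_at_infinity _ glued_tendsto] by blast
  define F where "F = (\<Sum>k\<le>n. monom (a k) k)"
  have "poly F z = glued z" for z by (simp add: F_def poly_sum poly_monom eq)
  moreover have "degree F \<le> n" unfolding F_def
    by (intro degree_sum_le) (auto intro: order_trans[OF degree_monom_le])
  moreover have "coeff F n = a n" by (simp add: F_def coeff_sum)
  ultimately show ?thesis using an by (intro exI[of _ F]) auto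
qed

subsection \<open>Orthogonality\<close>

text \<open>On \<open>L\<close> the weight is \<open>\<Delta>i * cnj \<Delta>i\<close> and
  \<open>R\<close> is \<open>1 / \<Delta>i\<close>, so an odd transform is paired with the interior
  function \<open>g * \<Delta>i\<close>. After exchanging the integrals, the one over
  \<open>L\<close> vanishes for every \<open>v\<close> on the circle of radius \<open>r\<close> by
  \<open>exterior_kernel_orthogonal\<close>.\<close>

lemma odd_pairing:
  assumes g: "g holomorphic_on UNIV"
  shows "contour_integral (circlepath 0 1)
    (\<lambda>w. R (\<psi> w) * odd_sum (\<psi> w) * cnj (g (\<psi> w)) * h (\<psi> w) * of_real (cmod (deriv \<psi> w)) / w) = 0"
proof -
  define c where "c = - (1 / (2 * complex_of_real pi * \<i>))"
  define m where "m v = even_sum v * odd_density v" for v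
  define H where "H w = cnj (g (\<psi> w) * \<Delta>i (\<psi> w)) * of_real (cmod (deriv \<psi> w)) / w" for w
  define K where "K w v = c * m v * (q (\<psi> w) * H w / (M v - M w))" for w v
  have Hc: "continuous_on (sphere 0 1) H"
    unfolding H_def using radius_less_1
    by (intro continuous_intros entire_circle_cont g Delta_i_circle_cont deriv_psi_cont) auto
  have mc: "continuous_on (sphere 0 r) m" unfolding m_def using rho0 r by (intro inner_density_cont) auto
  have eq: "R (\<psi> w) * odd_sum (\<psi> w) * cnj (g (\<psi> w)) * h (\<psi> w) * of_real (cmod (deriv \<psi> w)) / w =
      contour_integral (circlepath 0 r) (K w)" if w: "cmod w = 1" for w
  proof -
    have out: "\<psi> w \<notin> Omega \<psi> 1" using w radius_less_1 by simp
    have "h (\<psi> w) = \<Delta>i (\<psi> w) * cnj (\<Delta>i (\<psi> w))" by (simp only: h_eq_i[OF w] complex_norm_square)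
    then have "R (\<psi> w) * odd_sum (\<psi> w) * cnj (g (\<psi> w)) * h (\<psi> w) * of_real (cmod (deriv \<psi> w)) / w = odd_sum (\<psi> w) * H w"
      using Delta_i_nonzero[OF out] by (simp add: R_interior[OF out] H_def)
    also have "\<dots> = (q (\<psi> w) * c * contour_integral (circlepath 0 r) (\<lambda>v. m v / (M v - M w))) * H w"
      by (simp add: odd_sum_def cauchy_transform_def c_def m_def M_def)
    also have "\<dots> =
        (q (\<psi> w) * c * H w) * contour_integral (circlepath 0 r) (\<lambda>v. m v / (M v - M w))" by (simp only: mult_ac)
    also have "\<dots> = contour_integral (circlepath 0 r) (\<lambda>v. (q (\<psi> w) * c * H w) * (m v / (M v - M w)))"
      by (rule contour_integral_cmult[symmetric])
    also have "(\<lambda>v. (q (\<psi> w) * c * H w) * (m v / (M v - M w))) = K w"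
      by (rule ext) (simp add: K_def)
    finally show ?thesis .
  qed
  have "contour_integral (circlepath 0 1)
    (\<lambda>w. R (\<psi> w) * odd_sum (\<psi> w) * cnj (g (\<psi> w)) * h (\<psi> w) * of_real (cmod (deriv \<psi> w)) / w) =
    contour_integral (circlepath 0 1) (\<lambda>w. contour_integral (circlepath 0 r) (K w))"
    by (intro contour_integral_circlepath_cong eq) auto
  also have "\<dots> = contour_integral (circlepath 0 r) (\<lambda>v. contour_integral (circlepath 0 1) (\<lambda>w. K w v))"
  proof (rule contour_integral_swap)
    let ?X = "sphere (0::complex) 1 \<times> sphere (0::complex) r"
    have f: "continuous_on ?X fst" "continuous_on ?X snd" by (auto intro: continuous_intros)
    \<comment> \<open>\<open>|M|\<close> is less than 1 on the inner circle and equal to 1 on the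
      unit circle: the kernel is continuous on the product, as the exchange requires.\<close>
    have ne: "M (snd p) - M (fst p) \<noteq> 0" if "p \<in> ?X" for p
    proof -
      have "cmod (M (snd p)) < 1" "cmod (M (fst p)) = 1"
        using that rho0 r by (auto intro!: norm_M_interior norm_M_circle)
      then show ?thesis by auto
    qed
    have c1: "continuous_on ?X (\<lambda>p. q (\<psi> (fst p)))"
      by (rule continuous_on_compose2[OF q_cont f(1)]) (use radius_less_1 radii(5) in auto)
    have c2: "continuous_on ?X (\<lambda>p. H (fst p))"
      by (rule continuous_on_compose2[OF Hc f(1)]) auto
    have c3: "continuous_on ?X (\<lambda>p. m (snd p))"
      by (rule continuous_on_compose2[OF mc f(2)]) auto
    have c4: "continuous_on ?X (\<lambda>p. M (fst p))"
      by (rule continuous_on_compose2[OF M_cont_annulus[OF rho0(7) radii(5)] f(1)]) auto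
    have c5: "continuous_on ?X (\<lambda>p. M (snd p))"
      by (rule continuous_on_compose2[OF M_cont[of r] f(2)]) auto
    have "continuous_on ?X (\<lambda>p. K (fst p) (snd p))"
      unfolding K_def using ne by (intro continuous_intros c1 c2 c3 c4 c5) auto
    then show "continuous_on (path_image (circlepath 0 1) \<times> path_image (circlepath 0 r)) (\<lambda>(w, v). K w v)"
      using rho0(5) by (simp add: case_prod_unfold)
  qed (auto simp: vector_derivative_circlepath intro!: continuous_intros)
  also have "\<dots> = contour_integral (circlepath 0 r) (\<lambda>v. 0)"
  proof (rule contour_integral_circlepath_cong[OF rho0(5)])
    fix v assume v: "cmod v = r"
    have "contour_integral (circlepath 0 1) (\<lambda>w. q (\<psi> w) * H w / (M v - M w)) = 0"
      unfolding H_def using v rho0 r by (intro exterior_kernel_orthogonal g) auto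
    then show "contour_integral (circlepath 0 1) (\<lambda>w. K w v) = 0"
      unfolding K_def contour_integral_cmult by simp
  qed
  also have "\<dots> = 0" by simp
  finally show ?thesis .
qed

text \<open>\<open>|\<Delta>e|^2\<close> cancels \<open>h\<close>, and \<open>|S|^2\<close> cancels
  \<open>|\<psi>'|\<close>: dividing by \<open>lead\<close> removes the weight and leaves
  \<open>dw / w\<close> on the unit circle.\<close>

lemma weight_times_lead:
  assumes w: "cmod w = 1"
  shows "lead (\<psi> w) * cnj (lead (\<psi> w)) * h (\<psi> w) * of_real (cmod (deriv \<psi> w)) = 1"
proof -
  have w': "\<rho>h < cmod w" using w radius_less_1 by simp
  have "lead (\<psi> w) * cnj (lead (\<psi> w)) = of_real ((cmod (lead (\<psi> w)))\<^sup>2)" by (rule complex_norm_square[symmetric])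
  also have "(cmod (lead (\<psi> w)))\<^sup>2 = (cmod (\<Delta>e (\<psi> w)))\<^sup>2 * cmod ((S (\<psi> w))\<^sup>2)"
    using w by (simp add: lead_def phi_psi[OF w'] norm_mult norm_power power_mult_distrib)
  finally have "lead (\<psi> w) * cnj (lead (\<psi> w)) * h (\<psi> w) * of_real (cmod (deriv \<psi> w)) =
      of_real (cmod ((S (\<psi> w))\<^sup>2 * deriv \<psi> w))"
    using Delta_e_nonzero[of w] w by (simp add: h_eq_e[OF w] norm_mult)
  then show ?thesis by (simp only: S_sq[OF w']) simp
qed

text \<open>On the unit circle \<open>even_sum\<close> is analytic inside and the conjugate of \<open>g / lead\<close> is the reflection of a
  function analytic at infinity, so the integral is evaluated by Cauchy's formula at \<open>0\<close>.\<close>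

lemma even_pairing:
  assumes g: "g holomorphic_on UNIV" and lim: "((\<lambda>z. g z / lead z) \<longlongrightarrow> l) at_infinity"
  shows "((\<lambda>w. lead (\<psi> w) * even_sum w * cnj (g (\<psi> w)) * h (\<psi> w) * of_real (cmod (deriv \<psi> w)) / w)
           has_contour_integral 2 * of_real pi * \<i> * (even_sum 0 * cnj l)) (circlepath 0 1)"
proof -
  define V where "V = {v. \<rho>0 < cmod v} \<inter> (\<lambda>v. lead (\<psi> v)) -` (- {0})"
  have lead_psi: "(\<lambda>v. lead (\<psi> v)) holomorphic_on {v. \<rho>0 < cmod v}"
    using rho0 by (intro holo_compose_psi[OF lead_holo]) auto
  have op: "open {v::complex. \<rho>0 < cmod v}" by (intro open_Collect_less continuous_intros)
  have V: "open V" unfolding V_def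
    by (rule continuous_open_preimage[OF holomorphic_on_imp_continuous_on[OF lead_psi] op]) auto
  have outV: "v \<in> V" if "1 \<le> cmod v" for v
    using lead_nonzero[OF that] that rho0(7) by (auto simp: V_def)
  define k where "k v = g (\<psi> v) / lead (\<psi> v)" for v
  have k: "k holomorphic_on V"
    unfolding k_def[abs_def] using rho0
    by (intro holomorphic_on_divide holo_compose_psi[OF g] holomorphic_on_subset[OF lead_psi]) (auto simp: V_def)
  define V' where "V' = - {0} \<inter> (\<lambda>w. 1 / cnj w) -` V"
  have V': "open V'" unfolding V'_def
    by (intro continuous_open_preimage V continuous_intros open_Compl) auto
  have inV': "w \<in> V'" if "w \<noteq> 0" "cmod w \<le> 1" for w
    using that by (auto simp: V'_def norm_reflected intro!: outV)
  define b where "b w = cnj (k (1 / cnj w))" for w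
  have b: "b holomorphic_on V'" unfolding b_def
    by (rule holomorphic_on_circle_reflection[OF k _ V]) (auto simp: V'_def)
  \<comment> \<open>Reflection exchanges 0 and infinity, so the conjugate of \<open>l\<close>
    becomes the value of the reflected function at the removable singularity 0.\<close>
  have "filterlim (\<lambda>w. 1 / cnj w) at_infinity (at (0::complex))"
  proof -
    have "filterlim (\<lambda>w. inverse (cnj w)) at_infinity (at (0::complex))"
      by (rule filterlim_compose[OF filterlim_inverse_at_infinity])
         (auto simp: filterlim_at eventually_at_filter intro!: tendsto_eq_intros)
    then show ?thesis by (simp add: inverse_eq_divide)
  qed
  then have "((\<lambda>w. g (\<psi> (1 / cnj w)) / lead (\<psi> (1 / cnj w))) \<longlongrightarrow> l) (at 0)"
    by (rule filterlim_compose[OF lim filterlim_compose[OF psi_infinity]])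
  then have blim: "(b \<longlongrightarrow> cnj l) (at 0)" unfolding b_def k_def by (rule tendsto_cnj)
  define B where "B w = (if w = 0 then cnj l else b w)" for w
  have AV: "V' \<union> ball 0 1 - {0} = V'" using inV' by (auto simp: V'_def)
  have "B holomorphic_on V' \<union> ball 0 1"
    unfolding B_def by (rule removable_singularity[OF _ _ blim]) (use AV b V' in auto)
  then have "B holomorphic_on cball 0 1"
  proof (rule holomorphic_on_subset, intro subsetI)
    fix x :: complex assume "x \<in> cball 0 1"
    then show "x \<in> V' \<union> ball 0 1" using inV'[of x] by (cases "x = 0") auto
  qed
  moreover have "even_sum holomorphic_on cball 0 1"
    by (rule holomorphic_on_subset[OF even_sum_holo]) (use radii(1) in auto)
  ultimately have "(\<lambda>w. even_sum w * B w) holomorphic_on cball 0 1" by (intro holomorphic_on_mult)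
  from Cauchy_integral_circlepath_simple[OF this, of 0]
  have "((\<lambda>w. even_sum w * B w / (w - 0)) has_contour_integral 2 * of_real pi * \<i> * (even_sum 0 * B 0)) (circlepath 0 1)"
    by simp
  then have I: "((\<lambda>w. even_sum w * B w / (w - 0)) has_contour_integral 2 * of_real pi * \<i> * (even_sum 0 * cnj l)) (circlepath 0 1)"
    by (simp only: B_def if_True refl)
  show ?thesis
  proof (rule has_contour_integral_eq[OF I])
    fix w assume "w \<in> path_image (circlepath (0::complex) 1)"
    then have w: "cmod w = 1" by simp
    have ww: "w * cnj w = 1" using w complex_norm_square[of w] by simp
    have w0: "w \<noteq> 0" "cnj w \<noteq> 0" using w by auto
    have "1 / cnj w = w" using ww w0 by (simp add: divide_eq_eq)
    then have B: "B w = cnj (g (\<psi> w)) / cnj (lead (\<psi> w))" using w0 by (simp add: B_def b_def k_def)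
    have ln: "cnj (lead (\<psi> w)) \<noteq> 0" using lead_nonzero[of w] w by simp
    have "lead (\<psi> w) * even_sum w * cnj (g (\<psi> w)) * h (\<psi> w) * of_real (cmod (deriv \<psi> w)) / w =
        (lead (\<psi> w) * cnj (lead (\<psi> w)) * h (\<psi> w) * of_real (cmod (deriv \<psi> w))) * (even_sum w * (cnj (g (\<psi> w)) / cnj (lead (\<psi> w))) / w)"
      using ln by simp
    then show "even_sum w * B w / (w - 0) =
        lead (\<psi> w) * even_sum w * cnj (g (\<psi> w)) * h (\<psi> w) * of_real (cmod (deriv \<psi> w)) / w"
      by (simp only: weight_times_lead[OF w] B mult_1 diff_zero)
  qed
qed

text \<open>In the middle formula the odd part integrates to 0 and only \<open>even_pairing\<close>
  is left. Polynomials \<open>g\<close> of degree below \<open>n\<close> have \<open>l = 0\<close>,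
  which is the orthogonality; the glued function itself has \<open>l = 1\<close>, which is the
  norm.\<close>

lemma glued_pairing:
  assumes g: "g holomorphic_on UNIV" and lim: "((\<lambda>z. g z / lead z) \<longlongrightarrow> l) at_infinity"
  shows "contour_integral (circlepath 0 1)
           (\<lambda>w. glued (\<psi> w) * cnj (g (\<psi> w)) * h (\<psi> w) * of_real (cmod (deriv \<psi> w)) / w)
         = 2 * of_real pi * \<i> * (even_sum 0 * cnj l)"
proof -
  have rr: "\<rho>h < 1" "1 < 1 / \<rho>0" "\<rho>0 < 1" using radius_less_1 radii rho0 by auto
  have "continuous_on (sphere 0 1) (\<lambda>w. R (\<psi> w))"
    using rr by (intro holomorphic_on_imp_continuous_on holo_compose_psi[OF R_holo]) (auto intro!: psi_in_max_region)
  moreover have "continuous_on (sphere 0 1) (\<lambda>w. odd_sum (\<psi> w))"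
    using rr r by (intro holomorphic_on_imp_continuous_on holo_compose_psi[OF odd_sum_holo] conjI psi_in_odd_domain) auto
  moreover note entire_circle_cont[OF g rr(1)] deriv_psi_cont[OF rr(1)]
  ultimately have "continuous_on (sphere 0 1)
      (\<lambda>w. R (\<psi> w) * odd_sum (\<psi> w) * cnj (g (\<psi> w)) * h (\<psi> w) * of_real (cmod (deriv \<psi> w)) / w)"
    by (intro continuous_intros h_circle_cont) auto
  then have "(\<lambda>w. R (\<psi> w) * odd_sum (\<psi> w) * cnj (g (\<psi> w)) * h (\<psi> w) * of_real (cmod (deriv \<psi> w)) / w)
      contour_integrable_on circlepath 0 1"
    by (intro continuous_contour_integrable_circlepath) auto
  from has_contour_integral_diff[OF even_pairing[OF g lim] has_contour_integral_integral[OF this]]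
  have "((\<lambda>w. lead (\<psi> w) * even_sum w * cnj (g (\<psi> w)) * h (\<psi> w) * of_real (cmod (deriv \<psi> w)) / w -
      R (\<psi> w) * odd_sum (\<psi> w) * cnj (g (\<psi> w)) * h (\<psi> w) * of_real (cmod (deriv \<psi> w)) / w)
      has_contour_integral 2 * of_real pi * \<i> * (even_sum 0 * cnj l)) (circlepath 0 1)"
    unfolding odd_pairing[OF g] by simp
  then have "((\<lambda>w. glued (\<psi> w) * cnj (g (\<psi> w)) * h (\<psi> w) * of_real (cmod (deriv \<psi> w)) / w)
      has_contour_integral 2 * of_real pi * \<i> * (even_sum 0 * cnj l)) (circlepath 0 1)"
  proof (rule has_contour_integral_eq)
    fix w assume "w \<in> path_image (circlepath (0::complex) 1)"
    then have w: "cmod w = 1" by simp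
    then have "\<psi> w \<in> Omega \<psi> r \<inter> G_region \<psi> (ereal (1 / r))" using rr rho0(6) r radii(1,6) by simp
    then have gl: "glued (\<psi> w) = lead (\<psi> w) * even_sum w - R (\<psi> w) * odd_sum (\<psi> w)"
      using w rr by (simp add: glued_middle middle_part_def)
    show "lead (\<psi> w) * even_sum w * cnj (g (\<psi> w)) * h (\<psi> w) * of_real (cmod (deriv \<psi> w)) / w -
      R (\<psi> w) * odd_sum (\<psi> w) * cnj (g (\<psi> w)) * h (\<psi> w) * of_real (cmod (deriv \<psi> w)) / w =
      glued (\<psi> w) * cnj (g (\<psi> w)) * h (\<psi> w) * of_real (cmod (deriv \<psi> w)) / w"
      unfolding gl by (simp only: left_diff_distrib diff_divide_distrib)
  qed
  then show ?thesis by (rule contour_integral_unique)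
qed

lemma poly_over_lead:
  assumes "degree p \<le> n"
  shows "((\<lambda>z. poly p z / lead z) \<longlongrightarrow> coeff p n / of_real lead_const) at_infinity"
proof -
  have "((\<lambda>z. (poly p z / z ^ n) / (lead z / z ^ n)) \<longlongrightarrow> coeff p n / of_real lead_const) at_infinity"
    using lead_const_pos by (intro tendsto_divide poly_lead_tendsto_at_infinity assms lead_tendsto) auto
  moreover have "\<forall>\<^sub>F z in at_infinity. (poly p z / z ^ n) / (lead z / z ^ n) = poly p z / lead z"
    unfolding eventually_at_infinity by (intro exI[of _ 1]) auto
  ultimately show ?thesis by (rule Lim_transform_eventually)
qed

text \<open>\<open>F\<close> minus the multiple of \<open>p n\<close> with the same coefficient of
  index \<open>n\<close> is a combination of the \<open>p m\<close> with \<open>m < n\<close>, and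
  it is orthogonal to all of them, hence 0. The second claim compares two evaluations of the norm of
  \<open>F\<close>.\<close>

lemma glued_eq_orthogonal_poly:
  assumes orth: "orthonormal_polys (level_path \<psi> 1) h p \<gamma>"
  shows "glued z = of_real lead_const * poly (smult (1 / of_real (\<gamma> n)) (p n)) z"
    and "even_sum 0 = of_real (lead_const\<^sup>2 / (\<gamma> n)\<^sup>2)"
proof -
  have deg: "degree (p m) = m" "lead_coeff (p m) = of_real (\<gamma> m)" "0 < \<gamma> m" for m
    using orth unfolding orthonormal_polys_def by blast+
  have pp: "pairing (p i) (p j) = (if i = j then 1 else 0)" for i j
    using orth unfolding orthonormal_polys_def arclength_pairing by blast
  have nz: "p m \<noteq> 0" for m using deg(2,3)[of m] by auto
  obtain F where F: "\<And>z. glued z = poly F z" "degree F \<le> n" "coeff F n = of_real lead_const"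
    using glued_poly by blast
  have PF: "pairing F g = even_sum 0 * cnj (coeff g n / of_real lead_const)" if "degree g \<le> n" for g
    using glued_pairing[OF poly_holo poly_over_lead[OF that]] by (simp add: pairing_def F(1))
  have orthF: "pairing F (p m) = 0" if "m < n" for m
    using PF[of "p m"] that deg(1)[of m] by (simp add: coeff_eq_0)
  define a where "a = complex_of_real (lead_const / \<gamma> n)"
  define D where "D = F - smult a (p n)"
  have "coeff (p n) n = of_real (\<gamma> n)" using deg(1,2)[of n] by simp
  then have Dn: "coeff D n = 0" using deg(3)[of n] F(3) by (simp add: D_def a_def)
  have "coeff D k = 0" if "n \<le> k" for k
  proof (cases "k = n")
    case False
    then have "n < k" using that by simp
    then show ?thesis using F(2) deg(1)[of n] by (simp add: D_def coeff_eq_0)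
  qed (use Dn in simp)
  from poly_expansion_in_graded_basis[of p, OF deg(1) nz this] obtain c where
    c: "D = (\<Sum>m<n. smult (c m) (p m))" by blast
  have "c j = 0" if j: "j < n" for j
  proof -
    have "pairing D (p j) = (\<Sum>m<n. c m * pairing (p m) (p j))"
      unfolding c by (simp add: pairing_sum pairing_smult)
    also have "\<dots> = (\<Sum>m<n. if m = j then c j else 0)" by (intro sum.cong) (auto simp: pp)
    also have "\<dots> = c j" using j by simp
    finally have "pairing D (p j) = c j" .
    moreover have "pairing D (p j) = 0"
      unfolding D_def pairing_diff pairing_smult orthF[OF j] pp using j by simp
    ultimately show ?thesis by simp
  qed
  then have "D = 0" unfolding c by simp
  then have Feq: "F = smult a (p n)" by (simp add: D_def)
  show "glued z = of_real lead_const * poly (smult (1 / of_real (\<gamma> n)) (p n)) z"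
    unfolding F(1) Feq by (simp add: a_def)
  have "pairing F F = even_sum 0" using PF[OF F(2)] F(3) lead_const_pos by simp
  moreover have "pairing F F = a * cnj a" unfolding Feq pairing_smult pairing_smult_right pp by simp
  ultimately show "even_sum 0 = of_real (lead_const\<^sup>2 / (\<gamma> n)\<^sup>2)"
    by (simp add: a_def power2_eq_square)
qed

section \<open>Normalization and the final formulas\<close>

lemma Lim_deriv_phi: "Lim at_infinity (deriv \<phi>) = of_real (S_lim\<^sup>2)"
  by (rule tendsto_Lim[OF trivial_limit_at_infinity deriv_phi_tendsto])

text \<open>The base \<open>S_lim^2\<close> is positive, so the principal complex power is the real
  one and equals \<open>1 / S_lim ^ (2 * n + 1)\<close>.\<close>

lemma normalization:
  "of_real Delta_lim * x / complex_of_real (S_lim\<^sup>2) powr (- of_nat n - 1 / 2) = of_real lead_const * x"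
proof -
  have "S_lim powr 2 = S_lim\<^sup>2" using S_lim(2) by simp
  moreover have "2 * (- real n - 1 / 2) = - real (2 * n + 1)" by simp
  ultimately have "S_lim\<^sup>2 powr (- real n - 1 / 2) = S_lim powr (- real (2 * n + 1))"
    using powr_powr[of S_lim 2 "- real n - 1 / 2"] by (simp only:)
  also have "\<dots> = inverse (S_lim ^ (2 * n + 1))"
    unfolding powr_minus powr_realpow[OF S_lim(2)] ..
  finally have real: "S_lim\<^sup>2 powr (- real n - 1 / 2) = inverse (S_lim ^ (2 * n + 1))" .
  have "- of_nat n - 1 / 2 = complex_of_real (- real n - 1 / 2)" by simp
  then have "complex_of_real (S_lim\<^sup>2) powr (- of_nat n - 1 / 2) = of_real (S_lim\<^sup>2 powr (- real n - 1 / 2))"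
    using powr_of_real[of "S_lim\<^sup>2" "- real n - 1 / 2"] by (simp only: zero_le_power2)
  then have "complex_of_real (S_lim\<^sup>2) powr (- of_nat n - 1 / 2) = inverse (of_real (S_lim ^ (2 * n + 1)))"
    unfolding real by (simp only: of_real_inverse)
  then show ?thesis
    by (simp only: lead_const_def divide_inverse inverse_inverse_eq of_real_mult mult_ac)
qed

text \<open>Putting \<open>u = 0\<close> in the kernel \<open>1 / (w - u)\<close> supplies the
  additional factor \<open>1 / \<phi>\<close> in the formula for \<open>\<gamma>_n\<close>; so the
  series there has the sum \<open>even_sum 0 - 1\<close>.\<close>

lemma odd_term_eq:
  "1 / (2 * complex_of_real pi * \<i>) * contour_integral (level_path \<psi> (1 / r))
      (\<lambda>\<zeta>. f (2 * k + 1) \<zeta> * S \<zeta> * \<phi> \<zeta> powi (- int n - 1) * R \<zeta> / \<Delta>e \<zeta>) =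
   cauchy_transform (1 / r) (\<lambda>w. f (2 * k + 1) (\<psi> w) * even_density w) (\<lambda>w. w) 0"
proof -
  have "contour_integral (circlepath 0 (1 / r))
      (\<lambda>w. f (2 * k + 1) (\<psi> w) * S (\<psi> w) * \<phi> (\<psi> w) powi (- int n - 1) * R (\<psi> w) / \<Delta>e (\<psi> w) * deriv \<psi> w) =
    contour_integral (circlepath 0 (1 / r)) (\<lambda>w. f (2 * k + 1) (\<psi> w) * even_density w / (w - 0))"
  proof (rule contour_integral_circlepath_cong[OF radii(4)])
    fix w :: complex assume w: "cmod w = 1 / r"
    then have w': "\<rho>h < cmod w" "w \<noteq> 0" using radii(6) rho0(5) by auto
    have "- int n - 1 = - int (Suc n)" by simp
    then have "w powi (- int n - 1) = inverse (w ^ n * w)"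
      by (simp only: power_int_minus power_int_of_nat power_Suc2)
    then show "f (2 * k + 1) (\<psi> w) * S (\<psi> w) * \<phi> (\<psi> w) powi (- int n - 1) * R (\<psi> w) / \<Delta>e (\<psi> w) * deriv \<psi> w =
        f (2 * k + 1) (\<psi> w) * even_density w / (w - 0)"
      unfolding phi_psi[OF w'(1)] even_density_def diff_zero
      by (simp only: divide_inverse inverse_mult_distrib mult_ac)
  qed
  then show ?thesis
    unfolding level_path_integral[OF radii(6,4)] cauchy_transform_def by (simp only:)
qed

theorem szego_expansion:
  assumes orth: "orthonormal_polys (level_path \<psi> 1) h p \<gamma>"
  defines "Pn \<equiv> smult (1 / complex_of_real (\<gamma> n)) (p n)"
  defines "\<phi>'_inf \<equiv> Lim at_infinity (deriv \<phi>)" and "\<Delta>e_inf \<equiv> Lim at_infinity \<Delta>e"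
  shows "z \<in> Omega \<psi> (1 / r) \<Longrightarrow> summable (\<lambda>k. f (2 * k) z) \<and>
        \<Delta>e_inf * poly Pn z / \<phi>'_inf powr (- of_nat n - 1 / 2) = \<Delta>e z * S z * \<phi> z ^ n * (\<Sum>k. f (2 * k) z)"
    and "z \<in> Omega \<psi> r \<inter> G_region \<psi> (1 / ereal r) \<Longrightarrow>
        summable (\<lambda>k. f (2 * k) z) \<and> summable (\<lambda>k. f (2 * k + 1) z) \<and>
        \<Delta>e_inf * poly Pn z / \<phi>'_inf powr (- of_nat n - 1 / 2)
          = \<Delta>e z * S z * \<phi> z ^ n * (\<Sum>k. f (2 * k) z) - R z * (\<Sum>k. f (2 * k + 1) z)"
    and "z \<in> G_region \<psi> (ereal r) \<Longrightarrow> summable (\<lambda>k. f (2 * k + 1) z) \<and>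
        \<Delta>e_inf * poly Pn z / \<phi>'_inf powr (- of_nat n - 1 / 2) = - R z * (\<Sum>k. f (2 * k + 1) z)"
    and "summable (\<lambda>k. 1 / (2 * complex_of_real pi * \<i>) * contour_integral (level_path \<psi> (1 / r))
          (\<lambda>\<zeta>. f (2 * k + 1) \<zeta> * S \<zeta> * \<phi> \<zeta> powi (- int n - 1) * R \<zeta> / \<Delta>e \<zeta>))"
    and "complex_of_real (\<gamma> n) powi (-2) = \<Delta>e_inf powi (-2) * \<phi>'_inf powi (- 2 * int n - 1) *
         (1 + (\<Sum>k. 1 / (2 * complex_of_real pi * \<i>) * contour_integral (level_path \<psi> (1 / r))
              (\<lambda>\<zeta>. f (2 * k + 1) \<zeta> * S \<zeta> * \<phi> \<zeta> powi (- int n - 1) * R \<zeta> / \<Delta>e \<zeta>)))"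
proof -
  \<comment> \<open>The three cases share this left side, so each of them only has to identify the
    matching formula for \<open>glued\<close>.\<close>
  have LHS: "\<Delta>e_inf * poly Pn z / \<phi>'_inf powr (- of_nat n - 1 / 2) = glued z" for z
    unfolding glued_eq_orthogonal_poly(1)[OF orth] \<Delta>e_inf_def \<phi>'_inf_def Delta_lim(3) Lim_deriv_phi normalization Pn_def ..
  have one_over: "1 / ereal r = ereal (1 / r)" using rho0(5) by (simp add: one_ereal_def)
  {
    assume z: "z \<in> Omega \<psi> (1 / r)"
    then obtain w where w: "z = \<psi> w" "1 / r < cmod w" by (rule OmegaE)
    have "cmod (\<phi> z) \<noteq> 1 / r" using w radii(6) by simp
    note sums = even_sums[OF this]
    have "z \<in> Omega \<psi> r2" using z Omega_mono[of r2 "1 / r"] r12(4) by auto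
    then show "summable (\<lambda>k. f (2 * k) z) \<and>
        \<Delta>e_inf * poly Pn z / \<phi>'_inf powr (- of_nat n - 1 / 2) = \<Delta>e z * S z * \<phi> z ^ n * (\<Sum>k. f (2 * k) z)"
      unfolding LHS glued_outer[OF \<open>z \<in> Omega \<psi> r2\<close>] outer_eq_even_sum[OF z] lead_def
      using sums_summable[OF sums] sums_unique[OF sums] by (simp only: simp_thms)
  next
    assume "z \<in> Omega \<psi> r \<inter> G_region \<psi> (1 / ereal r)"
    then have z: "z \<in> Omega \<psi> r \<inter> G_region \<psi> (ereal (1 / r))" by (simp only: one_over)
    then obtain w where w: "z = \<psi> w" "r < cmod w" by (auto elim: OmegaE)
    have w': "\<rho>h < cmod w" using w rho0(6) by simp
    then have "cmod w < 1 / r" using z w radii(6) by simp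
    then have "cmod (\<phi> z) \<noteq> 1 / r" "cmod w < 1 / \<rho>0" "\<rho>0 < cmod w" using w w' radii(2) rho0(4) by auto
    then have "z \<in> G_region \<psi> (ereal (1 / \<rho>0)) - \<psi> ` sphere 0 r"
      unfolding w(1) using w(2) by (intro psi_in_odd_domain) auto
    then have "z \<in> G_region \<psi> (ereal (1 / \<rho>0))" "z \<notin> \<psi> ` sphere 0 r" by simp_all
    note sums = even_sums[OF \<open>cmod (\<phi> z) \<noteq> 1 / r\<close>] odd_sums[OF this]
    show "summable (\<lambda>k. f (2 * k) z) \<and> summable (\<lambda>k. f (2 * k + 1) z) \<and>
        \<Delta>e_inf * poly Pn z / \<phi>'_inf powr (- of_nat n - 1 / 2)
          = \<Delta>e z * S z * \<phi> z ^ n * (\<Sum>k. f (2 * k) z) - R z * (\<Sum>k. f (2 * k + 1) z)"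
      unfolding LHS glued_middle[OF z] middle_part_def lead_def
      using sums_summable[OF sums(1)] sums_summable[OF sums(2)] sums_unique[OF sums(1)] sums_unique[OF sums(2)]
      by (simp only: simp_thms)
  next
    assume z: "z \<in> G_region \<psi> (ereal r)"
    then have G: "z \<in> G_region \<psi> (ereal (1 / \<rho>0))" "z \<in> G_region \<psi> (ereal r1)"
      using G_region_mono[of r "1 / \<rho>0"] G_region_mono[of r r1] rho0(6) r12(1,6) by auto
    have "z \<notin> \<psi> ` sphere 0 r" using z rho0(6) by (auto simp: G_region_eq)
    note sums = odd_sums[OF G(1) this]
    show "summable (\<lambda>k. f (2 * k + 1) z) \<and>
        \<Delta>e_inf * poly Pn z / \<phi>'_inf powr (- of_nat n - 1 / 2) = - R z * (\<Sum>k. f (2 * k + 1) z)"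
      unfolding LHS glued_inner[OF G(2)] inner_eq_odd_sum[OF z]
      using sums_summable[OF sums] sums_unique[OF sums] by (simp only: simp_thms)
  }
  have s: "(\<lambda>k. 1 / (2 * complex_of_real pi * \<i>) * contour_integral (level_path \<psi> (1 / r))
          (\<lambda>\<zeta>. f (2 * k + 1) \<zeta> * S \<zeta> * \<phi> \<zeta> powi (- int n - 1) * R \<zeta> / \<Delta>e \<zeta>)) sums (even_sum 0 - 1)"
    unfolding odd_term_eq using radii(4) by (intro even_transform_sums) simp
  then show "summable (\<lambda>k. 1 / (2 * complex_of_real pi * \<i>) * contour_integral (level_path \<psi> (1 / r))
          (\<lambda>\<zeta>. f (2 * k + 1) \<zeta> * S \<zeta> * \<phi> \<zeta> powi (- int n - 1) * R \<zeta> / \<Delta>e \<zeta>))"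
    by (rule sums_summable)
  have "complex_of_real (\<gamma> n) powi (-2) = of_real (1 / (\<gamma> n)\<^sup>2)"
    by (simp add: power_int_minus inverse_eq_divide)
  \<comment> \<open>\<open>lead_const^2\<close> is
    \<open>\<Delta>e(\<infinity>)^2 \<phi>'(\<infinity>)^(2 n + 1)\<close>, the reciprocal of the
    prefactor in the theorem.\<close>
  also have "\<dots> = of_real (1 / (Delta_lim\<^sup>2 * (S_lim\<^sup>2) ^ (2 * n + 1)) * (lead_const\<^sup>2 / (\<gamma> n)\<^sup>2))"
    using S_lim(2) Delta_lim(2)
    by (simp add: lead_const_def power_mult_distrib flip: power_mult)
  also have "\<dots> = \<Delta>e_inf powi (-2) * \<phi>'_inf powi (- 2 * int n - 1) * even_sum 0"
  proof -
    have "- 2 * int n - 1 = - int (2 * n + 1)" by simp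
    then have "\<phi>'_inf powi (- 2 * int n - 1) = inverse (\<phi>'_inf ^ (2 * n + 1))"
      by (simp only: power_int_minus power_int_of_nat)
    moreover have "\<Delta>e_inf powi (-2) = inverse (\<Delta>e_inf\<^sup>2)" by (simp add: power_int_minus)
    ultimately show ?thesis
      unfolding glued_eq_orthogonal_poly(2)[OF orth] \<Delta>e_inf_def \<phi>'_inf_def Delta_lim(3) Lim_deriv_phi
      by (simp add: divide_inverse)
  qed
  also have "even_sum 0 = 1 + (even_sum 0 - 1)" by simp
  finally show "complex_of_real (\<gamma> n) powi (-2) = \<Delta>e_inf powi (-2) * \<phi>'_inf powi (- 2 * int n - 1) *
         (1 + (\<Sum>k. 1 / (2 * complex_of_real pi * \<i>) * contour_integral (level_path \<psi> (1 / r))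
              (\<lambda>\<zeta>. f (2 * k + 1) \<zeta> * S \<zeta> * \<phi> \<zeta> powi (- int n - 1) * R \<zeta> / \<Delta>e \<zeta>)))"
    by (simp only: sums_unique[OF s])
qed

end

theorem theorem1p1:
  fixes L :: "complex set"
    and h \<psi> \<phi> S \<Delta>e \<Delta>i R \<kappa> q :: "complex \<Rightarrow> complex"
    and W :: "complex \<Rightarrow> complex \<Rightarrow> complex"
    and p P :: "nat \<Rightarrow> complex poly" and \<gamma> :: "nat \<Rightarrow> real"
    and \<rho>h \<rho> r :: real and n :: nat
    and f :: "nat \<Rightarrow> complex \<Rightarrow> complex"
    and \<phi>'_inf \<Delta>e_inf :: complex
  assumes "analytic_jordan_curve L"
    and "positive_weight L h"
    and "exterior_map L \<psi>"
    and "least_univalence_radius \<psi> \<rho>h"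
    and "orthonormal_polys (level_path \<psi> 1) h p \<gamma>"
    and "P = (\<lambda>m. smult (1 / complex_of_real (\<gamma> m)) (p m))"
    and "\<phi> = ext_inverse \<psi> \<rho>h"
    and "sqrt_branch (Omega \<psi> \<rho>h) (deriv \<phi>) S"
    and "positive_at_infinity S"
    and "exterior_szego L \<psi> h \<Delta>e"
    and "least_analyticity_radius \<psi> \<rho>h \<Delta>e \<rho>"
    and "interior_szego L \<psi> h \<Delta>i"
    and "R = recip_interior_szego \<psi> \<phi> \<Delta>e \<Delta>i"
    and "interior_map \<psi> \<rho>h \<phi> \<kappa>"
    and "sqrt_branch (G_region \<psi> (1 / ereal \<rho>h)) (deriv \<kappa>) q"
    and "W = kernel_W \<kappa> q"
    and "\<phi>'_inf = Lim at_infinity (deriv \<phi>)"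
    and "\<Delta>e_inf = Lim at_infinity \<Delta>e"
    and "\<rho> < r" and "r < 1"
    and "f = f_transform \<psi> \<phi> S \<Delta>e \<Delta>i R W r n"
    and "Lambda_const \<psi> S \<Delta>e \<Delta>i r * Lambda'_const \<psi> S \<Delta>e R r * M_const \<psi> W r * r ^ (2 * n)
           / (1 / r - r) < 1"
  shows
    "(\<forall>z\<in>Omega \<psi> (1 / r).
        summable (\<lambda>k. f (2 * k) z) \<and>
        \<Delta>e_inf * poly (P n) z / \<phi>'_inf powr (- of_nat n - 1 / 2)
          = \<Delta>e z * S z * \<phi> z ^ n * (\<Sum>k. f (2 * k) z)) \<and>
     (\<forall>z\<in>Omega \<psi> r \<inter> G_region \<psi> (1 / ereal r).
        summable (\<lambda>k. f (2 * k) z) \<and> summable (\<lambda>k. f (2 * k + 1) z) \<and>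
        \<Delta>e_inf * poly (P n) z / \<phi>'_inf powr (- of_nat n - 1 / 2)
          = \<Delta>e z * S z * \<phi> z ^ n * (\<Sum>k. f (2 * k) z) - R z * (\<Sum>k. f (2 * k + 1) z)) \<and>
     (\<forall>z\<in>G_region \<psi> (ereal r).
        summable (\<lambda>k. f (2 * k + 1) z) \<and>
        \<Delta>e_inf * poly (P n) z / \<phi>'_inf powr (- of_nat n - 1 / 2)
          = - R z * (\<Sum>k. f (2 * k + 1) z)) \<and>
     summable (\<lambda>k. 1 / (2 * complex_of_real pi * \<i>) *
        contour_integral (level_path \<psi> (1 / r))
          (\<lambda>\<zeta>. f (2 * k + 1) \<zeta> * S \<zeta> * \<phi> \<zeta> powi (- int n - 1) * R \<zeta> / \<Delta>e \<zeta>)) \<and>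
     complex_of_real (\<gamma> n) powi (-2)
       = \<Delta>e_inf powi (-2) * \<phi>'_inf powi (- 2 * int n - 1) *
         (1 + (\<Sum>k. 1 / (2 * complex_of_real pi * \<i>) *
            contour_integral (level_path \<psi> (1 / r))
              (\<lambda>\<zeta>. f (2 * k + 1) \<zeta> * S \<zeta> * \<phi> \<zeta> powi (- int n - 1) * R \<zeta> / \<Delta>e \<zeta>)))"
proof -
  \<comment> \<open>This follows from \<open>\<rho>h \<le> \<rho> < r < 1\<close>; it lets
    \<open>\<psi>\<close> cross the unit circle, on which the locale of the exterior domain
    relies.\<close>
  have "\<rho>h < 1"
    using assms(11,19,20) by (simp add: least_analyticity_radius_def)
  then interpret szego_setting L \<psi> \<phi> \<rho>h h S \<Delta>e \<Delta>i \<kappa> q \<rho> r n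
    using assms by unfold_locales auto
  interpret szego_convergent L \<psi> \<phi> \<rho>h h S \<Delta>e \<Delta>i \<kappa> q \<rho> r n
    using assms(22) by unfold_locales (simp add: ratio_def assms(13,16))
  note E = szego_expansion[OF assms(5)]
  show ?thesis
    unfolding \<open>f = _\<close> \<open>R = _\<close> \<open>W = _\<close> \<open>P = _\<close> \<open>\<phi>'_inf = _\<close> \<open>\<Delta>e_inf = _\<close>
    by (intro conjI ballI)
      (erule E(1)[THEN conjunct1] E(1)[THEN conjunct2] E(2)[THEN conjunct1] E(2)[THEN conjunct2, THEN conjunct1]
         E(2)[THEN conjunct2, THEN conjunct2] E(3)[THEN conjunct1] E(3)[THEN conjunct2] | rule E(4) E(5))+
qed

end
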